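(* Let $A$ be a linear operator on a Banach space $X$ with $\sigma(A)\subset\overline{\mathbb C}_+$ such that \[\sup_{\alpha>0}(\alpha+1)\int_{\mathbb R}\big|\langle(\alpha+i\beta+A)^{-2}x,x^*\rangle\big|\,d\beta<\infty\quad\text{for all }x\in X,\ x^*\in X^*.\] Then $\lim_{t\to\infty}\|f(tA)\|=0$ for every $f\in\mathcal B_0$. Consequently there exist constants $M$ and $\omega>0$ such that $\|e^{-tA}\|\le Me^{-\omega t}$ for all $t\ge0$.
   Context: $\mathbb C_+=\{z:\Re z>0\}$. $\mathcal B$ is the Banach algebra of holomorphic $f$ on $\mathbb C_+$ with $\|f\|_{\mathcal B_0}:=\int_0^\infty\sup_{\beta\in\mathbb R}|f'(\alpha+i\beta)|\,d\alpha<\infty$, norm $\|f\|_{\mathcal B}=\sup|f|+\|f\|_{\mathcal B_0}$; $f(\infty):=\lim_{\Re z\to\infty}f(z)$ and $\mathcal B_0=\{f\in\mathcal B:f(\infty)=0\}$. The hypothesis implies (known result) that $A$ is densely defined... more precisely, for $A$ densely defined satisfying the hypothesis, the formula $\langle f(A)x,x^*\rangle=f(\infty)\langle x,x^*\rangle-\frac2\pi\int_0^\infty\alpha\int_{\mathbb R}\langle(\alpha-i\beta+A)^{-2}x,x^*\rangle f'(\alpha+i\beta)\,d\beta\,d\alpha$ defines a bounded algebra homomorphism $f\mapsto f(A)$ from $\mathcal B$ into $L(X)$, $-A$ generates a bounded $C_0$-semigroup $(e^{-tA})_{t\ge0}$ with $e^{-tA}=e_t(A)$ for $e_t(z)=e^{-tz}$,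 and $f(tA):=f_t(A)$ with $f_t(z)=f(tz)$. ($A$ is assumed densely defined, as a standing assumption.) *)

theory Defs
  imports "HOL-Analysis.Analysis"
begin

class complex_banach = banach +
  fixes cscale :: "complex \<Rightarrow> 'a \<Rightarrow> 'a"
  assumes cscale_add_right: "cscale a (x + y) = cscale a x + cscale a y"
    and cscale_add_left: "cscale (a + b) x = cscale a x + cscale b x"
    and cscale_cscale: "cscale a (cscale b x) = cscale (a * b) x"
    and cscale_one: "cscale 1 x = x"
    and cscale_of_real: "cscale (of_real r) x = scaleR r x"
    and norm_cscale: "norm (cscale a x) = cmod a * norm x"

definition dual_space :: "('a::complex_banach \<Rightarrow> complex) set" where
  "dual_space = {\<phi>. bounded_linear \<phi> \<and> (\<forall>c x. \<phi> (cscale c x) = c * \<phi> x)}"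

definition lin_operator :: "'a::complex_banach set \<Rightarrow> ('a \<Rightarrow> 'a) \<Rightarrow> bool" where
  "lin_operator D A \<longleftrightarrow> 0 \<in> D \<and> (\<forall>x\<in>D. \<forall>y\<in>D. x + y \<in> D) \<and> (\<forall>c. \<forall>x\<in>D. cscale c x \<in> D)
     \<and> (\<forall>x\<in>D. \<forall>y\<in>D. A (x + y) = A x + A y) \<and> (\<forall>c. \<forall>x\<in>D. A (cscale c x) = cscale c (A x))"

definition densely_defined :: "'a::complex_banach set \<Rightarrow> bool" where
  "densely_defined D \<longleftrightarrow> closure D = UNIV"

definition resolvent :: "'a::complex_banach set \<Rightarrow> ('a \<Rightarrow> 'a) \<Rightarrow> complex \<Rightarrow> 'a \<Rightarrow> 'a" where
  "resolvent D A z y = (THE x. x \<in> D \<and> cscale z x - A x = y)"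

definition resolvent_set :: "'a::complex_banach set \<Rightarrow> ('a \<Rightarrow> 'a) \<Rightarrow> complex set" where
  "resolvent_set D A = {z. (\<forall>y. \<exists>!x. x \<in> D \<and> cscale z x - A x = y)
                          \<and> bounded_linear (resolvent D A z)}"

definition op_spectrum :: "'a::complex_banach set \<Rightarrow> ('a \<Rightarrow> 'a) \<Rightarrow> complex set" where
  "op_spectrum D A = UNIV - resolvent_set D A"

definition res_plus :: "'a::complex_banach set \<Rightarrow> ('a \<Rightarrow> 'a) \<Rightarrow> complex \<Rightarrow> 'a \<Rightarrow> 'a" where
  "res_plus D A w y = (THE x. x \<in> D \<and> cscale w x + A x = y)"

definition rhp :: "complex set" where
  "rhp = {z. Re z > 0}"

definition B_space :: "(complex \<Rightarrow> complex) set" where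
  "B_space = {f. f holomorphic_on rhp \<and> bounded (f ` rhp)
     \<and> (\<integral>\<^sup>+ \<alpha>. indicator {0<..} \<alpha> * (SUP \<beta>. ennreal (cmod (deriv f (Complex \<alpha> \<beta>)))) \<partial>lborel) < \<infinity>}"

definition val_infty :: "(complex \<Rightarrow> complex) \<Rightarrow> complex" where
  "val_infty f = Lim (filtercomap Re at_top) f"

definition B0_space :: "(complex \<Rightarrow> complex) set" where
  "B0_space = {f \<in> B_space. val_infty f = 0}"

definition B_calc :: "'a::complex_banach set \<Rightarrow> ('a \<Rightarrow> 'a) \<Rightarrow> (complex \<Rightarrow> complex) \<Rightarrow> 'a \<Rightarrow> 'a" where
  "B_calc D A f = (THE T. bounded_linear T \<and> (\<forall>x. \<forall>\<phi>\<in>dual_space.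
      \<phi> (T x) = val_infty f * \<phi> x
        - of_real (2 / pi) * (LINT \<alpha>:{0<..}|lborel. of_real \<alpha> *
             (LINT \<beta>|lborel. \<phi> (res_plus D A (Complex \<alpha> (- \<beta>)) (res_plus D A (Complex \<alpha> (- \<beta>)) x))
                               * deriv f (Complex \<alpha> \<beta>)))))"

end

theory Submission
  imports Defs "HOL-Complex_Analysis.Complex_Analysis" "HOL-Real_Asymp.Real_Asymp"
begin

text \<open>
  By the uniform boundedness principle the integral condition becomes a bound
  \<open>C * onorm \<phi> * norm x / (\<alpha> + 1)\<close>, which also bounds the resolvent on the right half-plane. The weak
  formula for \<open>f(A)\<close> then defines a bounded form; on the range of \<open>(1 + A)\<^sup>-\<^sup>2\<close> it is given by a
  norm-convergent integral, so by density it comes from an operator on \<open>X\<close>, with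
  \<open>\<parallel>f(tA)\<parallel> \<le> const * \<integral> s / (s + t) * sup \<bar>f'(s + i\<beta>)\<bar> ds\<close>, and this tends to \<open>0\<close>. For the exponential
  decay it remains to see that \<open>e\<^sup>-\<^sup>t\<^sup>A\<close> is a semigroup. On the core it is the contour integral of
  \<open>e\<^sup>t\<^sup>w (w + A)\<^sup>-\<^sup>1 x / (w - 1)\<^sup>2\<close> along \<open>Re w = b < 1\<close>, and the product formula follows from the resolvent
  identity and Cauchy's formula on two different vertical lines.
\<close>

section \<open>Hahn-Banach and uniform boundedness\<close>

text \<open>The weak formula tests against functionals only, so by itself it yields elements of the
  bidual. Two facts bring it back into X. On vectors (1 + A)^-2 y the squared resolvent decays like
  (1 + |z|)^-2, and together with the factor \<alpha> of the formula this is dominated by a Poisson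
  kernel, whose mass on a vertical line is at most pi. And duality turns the bound of the form into
  a norm bound for representing vectors. The resolvent itself is estimated by integrating its
  derivative -(z + A)^-2 along a vertical line from infinity, where it vanishes on the domain. In
  the exponential case 1 / (w - 1)^2 is the symbol of (1 + A)^-2 at A = -w. Its pole at 1 lies to
  the right of the lines that carry it, so every term without a resolvent can be pushed to the far
  left and vanishes. With two lines at positive distance the double integral converges absolutely,
  and their order decides which term of the resolvent identity survives. Factors 2 in norm estimates
  stem from passing between real and complex functionals.\<close>

definition sublinear :: "('a::real_vector \<Rightarrow> real) \<Rightarrow> bool" where
  "sublinear p \<longleftrightarrow> (\<forall>x y. p (x + y) \<le> p x + p y) \<and> (\<forall>c\<ge>0. \<forall>x. p (c *\<^sub>R x) = c * p x)"

lemma sublinear_add: "sublinear p \<Longrightarrow> p (x + y) \<le> p x + p y"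
  by (simp add: sublinear_def)

lemma sublinear_scale: "sublinear p \<Longrightarrow> 0 \<le> c \<Longrightarrow> p (c *\<^sub>R x) = c * p x"
  by (simp add: sublinear_def)

lemma sublinear_zero: "sublinear p \<Longrightarrow> p 0 = 0"
  using sublinear_scale[of p 0 0] by simp

lemma sublinear_minus: "sublinear p \<Longrightarrow> - p (- x) \<le> p x"
  using sublinear_add[of p x "- x"] sublinear_zero[of p] by simp

text \<open>The reverse inequality is the assumed one for the factor 1 / c at the point c x.\<close>

lemma sublinearI:
  fixes p :: "'a::real_vector \<Rightarrow> real"
  assumes add: "\<And>x y. p (x + y) \<le> p x + p y" and zero: "p 0 = 0"
    and le: "\<And>c x. 0 < c \<Longrightarrow> p (c *\<^sub>R x) \<le> c * p x"
  shows "sublinear p"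
  unfolding sublinear_def
proof (intro conjI allI impI add)
  fix c :: real and x :: 'a
  assume c: "0 \<le> c"
  show "p (c *\<^sub>R x) = c * p x"
  proof (cases "c = 0")
    case False
    hence c: "c > 0" using c by simp
    have "p (inverse c *\<^sub>R (c *\<^sub>R x)) \<le> inverse c * p (c *\<^sub>R x)" using c by (intro le) simp
    hence "c * p x \<le> p (c *\<^sub>R x)" using c by (simp add: field_simps)
    with le[OF c, of x] show ?thesis by simp
  qed (simp add: zero)
qed

text \<open>Values at two different members are compared through a common lower member; this is
  where directedness enters, since an arbitrary infimum of sublinear functionals need not be
  subadditive.\<close>

lemma sublinear_INF:
  fixes P :: "('a::real_vector \<Rightarrow> real) set"
  assumes ne: "P \<noteq> {}" and sub: "\<And>p. p \<in> P \<Longrightarrow> sublinear p"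
    and dir: "\<And>p q. p \<in> P \<Longrightarrow> q \<in> P \<Longrightarrow> \<exists>r\<in>P. r \<le> p \<and> r \<le> q"
    and bdd: "\<And>x. bdd_below ((\<lambda>p. p x) ` P)"
  shows "sublinear (\<lambda>x. INF p\<in>P. p x)"
proof (rule sublinearI)
  fix x y
  show "(INF p\<in>P. p (x + y)) \<le> (INF p\<in>P. p x) + (INF p\<in>P. p y)"
  proof -
    have "(INF p\<in>P. p (x + y)) - q y \<le> (INF p\<in>P. p x)" if q: "q \<in> P" for q
    proof (rule cINF_greatest[OF ne])
      fix p assume p: "p \<in> P"
      obtain r where r: "r \<in> P" "r \<le> p" "r \<le> q" using dir p q by blast
      have "(INF p\<in>P. p (x + y)) \<le> r (x + y)" by (rule cINF_lower[OF bdd r(1)])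
      also have "\<dots> \<le> r x + r y" using sub r(1) by (simp add: sublinear_add)
      also have "\<dots> \<le> p x + q y" using r by (intro add_mono) (auto simp: le_fun_def)
      finally show "(INF p\<in>P. p (x + y)) - q y \<le> p x" by simp
    qed
    hence "(INF p\<in>P. p (x + y)) - (INF p\<in>P. p x) \<le> (INF p\<in>P. p y)"
      by (intro cINF_greatest[OF ne]) (simp add: algebra_simps)
    thus ?thesis by simp
  qed
next
  have "(INF p\<in>P. p 0) = (INF p\<in>P. 0)"
    using sub by (intro INF_cong refl) (simp add: sublinear_zero)
  thus "(INF p\<in>P. p 0) = 0" using ne by simp
next
  fix c :: real and x :: 'a
  assume c: "0 < c"
  have "(INF p\<in>P. p (c *\<^sub>R x)) / c \<le> (INF p\<in>P. p x)"
  proof (rule cINF_greatest[OF ne])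
    fix p assume p: "p \<in> P"
    have "(INF p\<in>P. p (c *\<^sub>R x)) \<le> p (c *\<^sub>R x)" by (rule cINF_lower[OF bdd p])
    also have "\<dots> = c * p x" using c sub[OF p] by (simp add: sublinear_scale)
    finally show "(INF p\<in>P. p (c *\<^sub>R x)) / c \<le> p x" using c by (simp add: field_simps)
  qed
  thus "(INF p\<in>P. p (c *\<^sub>R x)) \<le> c * (INF p\<in>P. p x)" using c by (simp add: field_simps)
qed

text \<open>The tilt lowers the value at \<open>- y\<close> to \<open>- p y\<close> without leaving
  the sublinear functionals below \<open>p\<close>. Any linear functional under it must then attain
  \<open>p y\<close> at \<open>y\<close>.\<close>

lemma sublinear_tilt:
  fixes p :: "'a::real_vector \<Rightarrow> real" and y :: 'a
  assumes p: "sublinear p"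
  defines "q \<equiv> \<lambda>x. INF t\<in>{0..}. p (x + t *\<^sub>R y) - t * p y"
  shows "sublinear q" and "q x \<le> p x" and "q (- y) \<le> - p y"
proof -
  have bdd: "bdd_below ((\<lambda>t. p (x + t *\<^sub>R y) - t * p y) ` {0..})" for x
  \<comment> \<open>Subadditivity for t y = (x + t y) + (- x) gives a lower bound that does not
    involve t.\<close>
  proof (rule bdd_belowI[of _ "- p (- x)"])
    fix s assume "s \<in> (\<lambda>t. p (x + t *\<^sub>R y) - t * p y) ` {0..}"
    then obtain t where t: "t \<ge> 0" "s = p (x + t *\<^sub>R y) - t * p y" by auto
    have "t * p y = p ((x + t *\<^sub>R y) + (- x))" using t p by (simp add: sublinear_scale)
    also have "\<dots> \<le> p (x + t *\<^sub>R y) + p (- x)" by (rule sublinear_add[OF p])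
    finally show "- p (- x) \<le> s" using t by simp
  qed
  have qx: "q x = (INF t\<in>{0..}. p (x + t *\<^sub>R y) - t * p y)" for x
    by (simp add: q_def)
  have low: "q x \<le> p (x + t *\<^sub>R y) - t * p y" if "t \<ge> 0" for x t
    unfolding q_def by (rule cINF_lower[OF bdd]) (use that in auto)
  show "q x \<le> p x" using low[of 0 x] by simp
  show "q (- y) \<le> - p y" using low[of 1 "- y"] sublinear_zero[OF p] by simp
  show "sublinear q"
  proof (rule sublinearI)
    fix x z
    have "q (x + z) - (p (z + u *\<^sub>R y) - u * p y) \<le> q x" if u: "u \<ge> 0" for u
      unfolding qx[of x]
    proof (rule cINF_greatest)
      fix t :: real assume "t \<in> {0..}"
      hence t: "t \<ge> 0" by simp
      have "q (x + z) \<le> p ((x + z) + (t + u) *\<^sub>R y) - (t + u) * p y" using t u by (intro low) simp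
      also have "(x + z) + (t + u) *\<^sub>R y = (x + t *\<^sub>R y) + (z + u *\<^sub>R y)" by (simp add: algebra_simps)
      also have "p \<dots> \<le> p (x + t *\<^sub>R y) + p (z + u *\<^sub>R y)" by (rule sublinear_add[OF p])
      finally show "q (x + z) - (p (z + u *\<^sub>R y) - u * p y) \<le> p (x + t *\<^sub>R y) - t * p y"
        by (simp add: algebra_simps)
    qed auto
    hence "q (x + z) - q x \<le> q z" unfolding qx[of z]
      by (intro cINF_greatest) (auto simp: algebra_simps)
    thus "q (x + z) \<le> q x + q z" by simp
  next
    have "p (t *\<^sub>R y) - t * p y = 0" if "t \<in> {0..}" for t :: real
      using that p by (simp add: sublinear_scale)
    thus "q 0 = 0" unfolding q_def by simp
  next
    fix c :: real and x :: 'a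
    assume c: "0 < c"
    have "q (c *\<^sub>R x) / c \<le> q x" unfolding qx[of x]
    proof (rule cINF_greatest)
      fix t :: real assume "t \<in> {0..}"
      hence t: "t \<ge> 0" by simp
      have "q (c *\<^sub>R x) \<le> p (c *\<^sub>R x + (c * t) *\<^sub>R y) - (c * t) * p y" using t c by (intro low) simp
      also have "c *\<^sub>R x + (c * t) *\<^sub>R y = c *\<^sub>R (x + t *\<^sub>R y)" by (simp add: algebra_simps)
      also have "p \<dots> = c * p (x + t *\<^sub>R y)" using c p by (simp add: sublinear_scale)
      finally have "q (c *\<^sub>R x) \<le> c * (p (x + t *\<^sub>R y) - t * p y)" by (simp add: algebra_simps)
      thus "q (c *\<^sub>R x) / c \<le> p (x + t *\<^sub>R y) - t * p y"
        using c by (simp add: pos_divide_le_eq mult.commute)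
    qed auto
    thus "q (c *\<^sub>R x) \<le> c * q x" using c by (simp add: field_simps)
  qed
qed

text \<open>A minimal sublinear functional equals each of its tilts, which forces additivity.\<close>

lemma exists_linear_below_sublinear:
  fixes p0 :: "'a::real_vector \<Rightarrow> real"
  assumes p0: "sublinear p0"
  shows "\<exists>u. linear u \<and> (\<forall>x. u x \<le> p0 x)"
proof -
  define S where "S = {p. sublinear p \<and> p \<le> p0}"
  \<comment> \<open>Zorn's lemma with the order reversed: maximal elements are pointwise minimal
    functionals.\<close>
  have "\<exists>m\<in>S. \<forall>a\<in>S. m \<ge> a \<longrightarrow> a = m"
  proof (rule predicate_Zorn)
    show "partial_order_on S (relation_of (\<ge>) S)"
      by (rule partial_order_on_relation_ofI) auto
  next
    fix C assume C: "C \<in> Chains (relation_of (\<ge>) S)"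
    have CS: "p \<in> S" if "p \<in> C" for p
      using C that by (auto simp: Chains_def relation_of_def)
    have tot: "p \<le> q \<or> q \<le> p" if "p \<in> C" "q \<in> C" for p q
      using C that by (auto simp: Chains_def relation_of_def)
    show "\<exists>u\<in>S. \<forall>a\<in>C. a \<ge> u"
    proof (cases "C = {}")
      case True
      thus ?thesis using p0 by (auto simp: S_def)
    next
      case False
      have bdd: "bdd_below ((\<lambda>p. p x) ` C)" for x
      proof (rule bdd_belowI[of _ "- p0 (- x)"])
        fix s assume "s \<in> (\<lambda>p. p x) ` C"
        then obtain p where p: "p \<in> C" "s = p x" by auto
        have "- p0 (- x) \<le> - p (- x)" using CS[OF p(1)] by (auto simp: S_def le_fun_def)
        also have "\<dots> \<le> p x" using CS[OF p(1)] by (auto simp: S_def sublinear_minus)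
        finally show "- p0 (- x) \<le> s" using p by simp
      qed
      define u where "u = (\<lambda>x. INF p\<in>C. p x)"
      have ul: "u \<le> p" if "p \<in> C" for p
        unfolding u_def le_fun_def using that by (auto intro: cINF_lower[OF bdd])
      have "sublinear u" unfolding u_def
      proof (rule sublinear_INF)
        show "\<exists>r\<in>C. r \<le> p \<and> r \<le> q" if "p \<in> C" "q \<in> C" for p q
          using tot[OF that] that by blast
      qed (use False CS bdd in \<open>auto simp: S_def\<close>)
      moreover obtain p where "p \<in> C" using False by auto
      hence "u \<le> p0" using ul CS by (force simp: S_def)
      ultimately have "u \<in> S" by (simp add: S_def)
      thus ?thesis using ul by auto
    qed
  qed
  then obtain m where m: "sublinear m" "m \<le> p0" and min0: "\<forall>a\<in>S. a \<le> m \<longrightarrow> a = m"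
    unfolding S_def by blast
  have min: "a = m" if "sublinear a" "a \<le> m" for a
    using min0 that order.trans[OF that(2) m(2)] unfolding S_def by blast
  have neg: "m (- y) = - m y" for y
  proof -
    define q where "q = (\<lambda>x. INF t\<in>{0..}. m (x + t *\<^sub>R y) - t * m y)"
    have "q = m" unfolding q_def
      by (intro min le_funI sublinear_tilt(1,2)[OF m(1)])
    moreover have "q (- y) \<le> - m y" unfolding q_def by (rule sublinear_tilt[OF m(1)])
    ultimately have "m (- y) \<le> - m y" by simp
    thus ?thesis using sublinear_minus[OF m(1), of y] by simp
  qed
  have add: "m (x + y) = m x + m y" for x y
    using sublinear_add[OF m(1), of x y] sublinear_add[OF m(1), of "x + y" "- y"] neg[of y] by simp
  have "m (c *\<^sub>R x) = c *\<^sub>R m x" for c x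
  proof (cases "c \<ge> 0")
    case False
    have "m (c *\<^sub>R x) = m (- ((- c) *\<^sub>R x))" by simp
    also have "\<dots> = - ((- c) * m x)" unfolding neg using False m(1) by (subst sublinear_scale) auto
    finally show ?thesis by simp
  qed (use m(1) in \<open>simp add: sublinear_scale\<close>)
  hence "linear m" using add by (intro linearI) auto
  thus ?thesis using m(2) by (auto simp: le_fun_def)
qed

text \<open>Tilting the norm in the direction \<open>x\<close> builds the prescribed value at
  \<open>x\<close> into the majorant, so no functional on a line has to be extended.\<close>

lemma real_norming_functional:
  fixes x :: "'a::real_normed_vector"
  shows "\<exists>u. linear u \<and> u x = norm x \<and> (\<forall>y. \<bar>u y\<bar> \<le> norm y)"
proof -
  have n: "sublinear (norm :: 'a \<Rightarrow> real)"
    by (simp add: sublinear_def norm_triangle_ineq)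
  define q where "q = (\<lambda>z. INF t\<in>{0..}. norm (z + t *\<^sub>R x) - t * norm x)"
  have q: "sublinear q" "\<And>z. q z \<le> norm z" "q (- x) \<le> - norm x"
    unfolding q_def by (rule sublinear_tilt[OF n])+
  from exists_linear_below_sublinear[OF q(1)] obtain u where u: "linear u" "\<And>x. u x \<le> q x" by blast
  have le: "u z \<le> norm z" for z using u(2)[of z] q(2)[of z] by simp
  have "\<bar>u y\<bar> \<le> norm y" for y
    using le[of y] le[of "- y"] linear_neg[OF u(1), of y] by simp
  moreover have "u x = norm x"
    using u(2)[of "- x"] q(3) linear_neg[OF u(1), of x] le[of x] by simp
  ultimately show ?thesis using u(1) by blast
qed

section \<open>Complex scalars and the complex dual space\<close>

lemma cscale_zero_left [simp]: "cscale 0 x = 0"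
  using cscale_of_real[of 0 x] by simp

lemma cscale_zero_right [simp]: "cscale c 0 = 0"
  using norm_cscale[of c 0] by simp

lemma cscale_minus_one: "cscale (- 1) x = - x"
  using cscale_of_real[of "- 1" x] by simp

lemma cscale_minus_left: "cscale (- c) x = - cscale c x"
  by (metis cscale_cscale cscale_minus_one mult_minus1)

lemma cscale_minus_right: "cscale c (- x) = - cscale c x"
  by (metis cscale_cscale cscale_minus_one mult.commute)

lemma cscale_diff_right: "cscale a (x - y) = cscale a x - cscale a y"
  by (metis cscale_add_right cscale_minus_right diff_conv_add_uminus)

lemma cscale_diff_left: "cscale (a - b) x = cscale a x - cscale b x"
  by (metis cscale_add_left cscale_minus_left diff_conv_add_uminus)

lemma cscale_scaleR: "cscale c (r *\<^sub>R x) = r *\<^sub>R cscale c x"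
  by (metis cscale_of_real cscale_cscale mult.commute)

lemma scaleR_cscale: "cscale (r *\<^sub>R c) x = r *\<^sub>R cscale c x"
  by (metis cscale_of_real cscale_cscale scaleR_conv_of_real)

lemma bounded_bilinear_cscale: "bounded_bilinear cscale"
  by standard
    (auto simp: cscale_add_right cscale_add_left cscale_scaleR scaleR_cscale norm_cscale
       intro!: exI[of _ 1])

interpretation cscale: bounded_bilinear cscale
  by (rule bounded_bilinear_cscale)

lemma cscale_inverse_eq: "c \<noteq> 0 \<Longrightarrow> y = cscale c x \<Longrightarrow> x = cscale (1 / c) y"
  by (simp add: cscale_cscale cscale_one)

lemma dual_bounded_linear: "\<phi> \<in> dual_space \<Longrightarrow> bounded_linear \<phi>"
  and dual_cscale: "\<phi> \<in> dual_space \<Longrightarrow> \<phi> (cscale c x) = c * \<phi> x"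
  by (auto simp: dual_space_def)

lemma dual_add: "\<phi> \<in> dual_space \<Longrightarrow> \<phi> (x + y) = \<phi> x + \<phi> y"
  and dual_diff: "\<phi> \<in> dual_space \<Longrightarrow> \<phi> (x - y) = \<phi> x - \<phi> y"
  and dual_zero: "\<phi> \<in> dual_space \<Longrightarrow> \<phi> 0 = 0"
  and dual_scaleR: "\<phi> \<in> dual_space \<Longrightarrow> \<phi> (r *\<^sub>R x) = r *\<^sub>R \<phi> x"
  using dual_bounded_linear[of \<phi>]
  by (auto simp: linear_simps bounded_linear.linear linear_add linear_diff linear_0 linear_scale)

lemma dual_bound: "\<phi> \<in> dual_space \<Longrightarrow> cmod (\<phi> x) \<le> onorm \<phi> * norm x"
  by (rule onorm[OF dual_bounded_linear])

lemma dual_onorm_nonneg: "\<phi> \<in> dual_space \<Longrightarrow> 0 \<le> onorm \<phi>"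
  by (rule onorm_pos_le[OF dual_bounded_linear])

text \<open>This is u(x) - i u(i x), the only complex linear functional with real part
  \<open>u\<close>.\<close>

definition complexify :: "('a::complex_banach \<Rightarrow> real) \<Rightarrow> 'a \<Rightarrow> complex" where
  "complexify u x = Complex (u x) (- u (cscale \<i> x))"

text \<open>The factor 2 comes from estimating real and imaginary part separately. It is harmless,
  because only the finiteness of constants matters later.\<close>

lemma complexify_dual:
  assumes u: "bounded_linear u"
  shows "complexify u \<in> dual_space" and "onorm (complexify u) \<le> 2 * onorm u"
proof -
  interpret u: bounded_linear u by (rule u)
  have le: "cmod (complexify u x) \<le> 2 * onorm u * norm x" for x
  proof -
    have "cmod (complexify u x) \<le> \<bar>u x\<bar> + \<bar>u (cscale \<i> x)\<bar>"
      unfolding complexify_def using cmod_le[of "Complex (u x) (- u (cscale \<i> x))"] by simp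
    also have "\<dots> \<le> onorm u * norm x + onorm u * norm (cscale \<i> x)"
      using onorm[OF u, of x] onorm[OF u, of "cscale \<i> x"] by simp
    finally show ?thesis by (simp add: norm_cscale)
  qed
  have add: "complexify u (x + y) = complexify u x + complexify u y" for x y
    by (simp add: complexify_def cscale_add_right u.add complex_eq_iff)
  have scR: "complexify u (r *\<^sub>R x) = r *\<^sub>R complexify u x" for r x
    by (simp add: complexify_def cscale_scaleR u.scaleR complex_eq_iff)
  have bl: "bounded_linear (complexify u)"
    using le by (intro bounded_linear_intro[of _ "2 * onorm u"] add scR) (simp add: mult.commute)
  have i: "complexify u (cscale \<i> x) = \<i> * complexify u x" for x
    by (simp add: complexify_def cscale_cscale cscale_minus_one u.neg complex_eq_iff)
  have "complexify u (cscale c x) = c * complexify u x" for c x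
  proof -
    have "cscale c x = Re c *\<^sub>R x + Im c *\<^sub>R cscale \<i> x"
      by (metis complex_eq cscale_add_left cscale_cscale cscale_of_real mult.commute)
    thus ?thesis
      by (simp add: add scR i) (simp add: complex_eq_iff algebra_simps)
  qed
  thus "complexify u \<in> dual_space" using bl by (simp add: dual_space_def)
  show "onorm (complexify u) \<le> 2 * onorm u"
    using le by (intro onorm_bound) (auto intro: onorm_pos_le[OF u])
qed

lemma complexify_Re:
  assumes "\<phi> \<in> dual_space"
  shows "complexify (\<lambda>x. Re (\<phi> x)) = \<phi>"
  using assms by (auto simp: complexify_def fun_eq_iff complex_eq_iff dual_cscale)

lemma dual_norming:
  fixes x :: "'a::complex_banach"
  shows "\<exists>\<phi>\<in>dual_space. onorm \<phi> \<le> 2 \<and> norm x \<le> cmod (\<phi> x)"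
proof -
  obtain u where u: "linear u" "u x = norm x" "\<And>y. \<bar>u y\<bar> \<le> norm y"
    using real_norming_functional[of x] by blast
  have bl: "bounded_linear u" using u
    by (intro bounded_linear_intro[of u 1]) (auto simp: linear_add linear_scale)
  have "onorm u \<le> 1" using u(3) by (intro onorm_bound) auto
  hence "onorm (complexify u) \<le> 2" using complexify_dual(2)[OF bl] by simp
  moreover have "norm x \<le> cmod (complexify u x)"
    using abs_Re_le_cmod[of "complexify u x"] u(2) by (simp add: complexify_def)
  ultimately show ?thesis using complexify_dual(1)[OF bl] by blast
qed

text \<open>The 2 is the bound on the norming functional. Norm estimates for vectors given only by
  their pairings are obtained through this inequality.\<close>

lemma norm_le_by_dual:
  fixes x :: "'a::complex_banach"
  assumes "\<And>\<phi>. \<phi> \<in> dual_space \<Longrightarrow> cmod (\<phi> x) \<le> onorm \<phi> * K"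
    and "0 \<le> K"
  shows "norm x \<le> 2 * K"
proof -
  obtain \<phi> where \<phi>: "\<phi> \<in> dual_space" "onorm \<phi> \<le> 2" "norm x \<le> cmod (\<phi> x)"
    using dual_norming by blast
  have "norm x \<le> onorm \<phi> * K" using \<phi> assms(1)[of \<phi>] by simp
  also have "\<dots> \<le> 2 * K" using \<phi> assms(2) by (intro mult_right_mono)
  finally show ?thesis .
qed

lemma dual_separates:
  fixes x y :: "'a::complex_banach"
  assumes "\<And>\<phi>. \<phi> \<in> dual_space \<Longrightarrow> \<phi> x = \<phi> y"
  shows "x = y"
  using norm_le_by_dual[of "x - y" 0] assms by (simp add: dual_diff)

text \<open>Baire category: the closed sublevel sets cover the space, so one of them contains a
  ball, and homogeneity spreads the bound. Values in \<open>ennreal\<close> allow suprema of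
  integrals to be inserted before anything is known to be finite.\<close>

lemma lsc_seminorm_bounded:
  fixes P :: "'b::banach \<Rightarrow> ennreal"
  assumes fin: "\<And>x. P x < \<infinity>"
    and closed: "\<And>n::nat. closed {x. P x \<le> of_nat n}"
    and tri: "\<And>x y. P (x + y) \<le> P x + P y"
    and scale: "\<And>c x. P (c *\<^sub>R x) = ennreal \<bar>c\<bar> * P x"
  shows "\<exists>C\<ge>0. \<forall>x. P x \<le> ennreal (C * norm x)"
proof -
  have Un: "(\<Union>n. {x. P x \<le> of_nat n}) = UNIV"
  proof -
    have "\<exists>n::nat. P x \<le> of_nat n" for x
      using ennreal_Ex_less_of_nat[of "P x"] fin[of x] by (auto intro: less_imp_le)
    thus ?thesis by auto
  qed
  have "\<exists>n. interior {x. P x \<le> of_nat n} \<noteq> {}"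
  proof (rule ccontr)
    assume "\<not> ?thesis"
    hence *: "\<And>n. interior {x. P x \<le> of_nat n} = {}" by blast
    have "euclidean interior_of \<Union>(range (\<lambda>n::nat. {x. P x \<le> of_nat n})) = {}"
    proof (rule Baire_category_alt)
      show "completely_metrizable_space (euclidean :: 'b topology) \<or>
        locally_compact_space (euclidean :: 'b topology) \<and> regular_space (euclidean :: 'b topology)"
        using completely_metrizable_space_euclidean by blast
    qed (use * closed in auto)
    thus False using Un by simp
  qed
  then obtain n x0 e where e: "e > 0" "ball x0 e \<subseteq> {x. P x \<le> of_nat n}"
    by (metis all_not_in_conv mem_interior)
  \<comment> \<open>Moving the ball from \<open>x0\<close> to the origin costs one further
    \<open>P x0\<close>, hence the factor 2.\<close>
  have le: "P y \<le> ennreal (2 * real n)" if "norm y < e" for y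
  proof -
    have "P y = P ((x0 + y) + (- 1) *\<^sub>R x0)" by simp
    also have "\<dots> \<le> P (x0 + y) + P ((- 1) *\<^sub>R x0)" by (rule tri)
    also have "P ((- 1) *\<^sub>R x0) = P x0" unfolding scale by simp
    also have "P (x0 + y) + P x0 \<le> of_nat n + of_nat n"
      using e that by (intro add_mono) (auto simp: subset_iff dist_norm)
    also have "\<dots> = ennreal (2 * real n)"
      by (simp add: ennreal_of_nat_eq_real_of_nat flip: ennreal_plus)
    finally show ?thesis .
  qed
  \<comment> \<open>Each vector is scaled to norm e / 2, strictly inside the ball; this doubles the
    constant \<open>2 * n\<close> once more.\<close>
  define C where "C = 4 * real n / e"
  have "P x \<le> ennreal (C * norm x)" for x
  proof (cases "x = 0")
    case True
    have "P x = P (0 *\<^sub>R x)" using True by simp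
    also have "\<dots> = 0" unfolding scale by simp
    finally show ?thesis by simp
  next
    case False
    define r where "r = 2 * norm x / e"
    have r: "r > 0" using False e by (simp add: r_def)
    have "norm ((1 / r) *\<^sub>R x) < e" using False e by (simp add: r_def field_simps)
    from le[OF this] have *: "P ((1 / r) *\<^sub>R x) \<le> ennreal (2 * real n)" .
    have "P x = P (r *\<^sub>R ((1 / r) *\<^sub>R x))" using r by simp
    also have "\<dots> = ennreal r * P ((1 / r) *\<^sub>R x)" unfolding scale[of r] using r by simp
    also have "\<dots> \<le> ennreal r * ennreal (2 * real n)" by (intro mult_left_mono *) simp
    also have "\<dots> = ennreal (r * (2 * real n))" using r by (intro ennreal_mult[symmetric]) auto
    also have "r * (2 * real n) = C * norm x" by (simp add: C_def r_def)
    finally show ?thesis .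
  qed
  thus ?thesis using e by (intro exI[of _ C]) (auto simp: C_def)
qed

section \<open>Resolvents on the right half-plane\<close>

lemma open_rhp: "open rhp" and convex_rhp: "convex rhp"
  unfolding rhp_def by (auto intro: open_halfspace_Re_gt convex_halfspace_Re_gt)

text \<open>\<open>R z\<close> stands for the inverse of z + A rather than z - A, hence the sign of
  \<open>w - z\<close>. The operator and its domain enter only when the locale is
  instantiated.\<close>

locale resolvent_family =
  fixes R :: "complex \<Rightarrow> 'a::complex_banach \<Rightarrow> 'a"
  assumes bounded_linear_R: "0 < Re z \<Longrightarrow> bounded_linear (R z)"
    and R_cscale: "0 < Re z \<Longrightarrow> R z (cscale c x) = cscale c (R z x)"
    and resolvent_identity:
      "0 < Re z \<Longrightarrow> 0 < Re w \<Longrightarrow> R z x - R w x = cscale (w - z) (R z (R w x))"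
begin

abbreviation (input) RR :: "complex \<Rightarrow> 'a \<Rightarrow> 'a" where
  "RR z x \<equiv> R z (R z x)"

lemma R_add: "0 < Re z \<Longrightarrow> R z (x + y) = R z x + R z y"
  and R_diff: "0 < Re z \<Longrightarrow> R z (x - y) = R z x - R z y"
  and R_scaleR: "0 < Re z \<Longrightarrow> R z (r *\<^sub>R x) = r *\<^sub>R R z x"
  using bounded_linear_R[of z]
  by (auto simp: bounded_linear.linear linear_add linear_diff linear_scale)

text \<open>Exchanging \<open>z\<close> and \<open>w\<close> in the resolvent identity changes the
  sign of both the difference and the scalar factor.\<close>

lemma R_commute:
  assumes "0 < Re z" "0 < Re w"
  shows "R z (R w x) = R w (R z x)"
proof (cases "z = w")
  case False
  have "cscale (w - z) (R z (R w x)) = - cscale (z - w) (R w (R z x))"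
    using assms by (metis resolvent_identity minus_diff_eq)
  hence "cscale (w - z) (R z (R w x)) = cscale (w - z) (R w (R z x))"
    by (metis cscale_minus_left minus_diff_eq)
  hence "cscale (w - z) (R z (R w x) - R w (R z x)) = 0" by (simp add: cscale_diff_right)
  hence "cmod (w - z) * norm (R z (R w x) - R w (R z x)) = 0" by (metis norm_cscale norm_zero)
  thus ?thesis using False by simp
qed simp

lemma R_R_eq:
  assumes "0 < Re z" "0 < Re w" "z \<noteq> w"
  shows "R z (R w x) = cscale (1 / (w - z)) (R z x - R w x)"
  using assms by (intro cscale_inverse_eq resolvent_identity) auto

text \<open>In R w = R z + (z - w) R z R w the last term is at most half of the left-hand side when
  \<open>w\<close> is close to \<open>z\<close>, so it can be absorbed.\<close>

lemma R_locally_bounded: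
  assumes z: "0 < Re z"
  shows "\<exists>e>0. \<exists>K\<ge>0. \<forall>w. dist w z < e \<longrightarrow> 0 < Re w \<and> (\<forall>x. norm (R w x) \<le> K * norm x)"
proof -
  define N where "N = onorm (R z)"
  have N0: "0 \<le> N" unfolding N_def by (rule onorm_pos_le[OF bounded_linear_R[OF z]])
  \<comment> \<open>The first entry keeps \<open>w\<close> in the half-plane, the second gives |z -
    w| N \<le> 1 / 2; N + 1 covers the case N = 0.\<close>
  define e where "e = min (Re z) (1 / (2 * (N + 1)))"
  have e: "e > 0" using z N0 by (simp add: e_def)
  have "0 < Re w \<and> (\<forall>x. norm (R w x) \<le> (2 * N) * norm x)" if w: "dist w z < e" for w
  proof -
    have "\<bar>Re (w - z)\<bar> < Re z" using w abs_Re_le_cmod[of "w - z"] by (simp add: e_def dist_norm)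
    hence rw: "0 < Re w" by simp
    have small: "cmod (z - w) * N \<le> 1 / 2"
    proof -
      have "cmod (z - w) * N \<le> (1 / (2 * (N + 1))) * (N + 1)"
        using w N0 by (intro mult_mono) (auto simp: e_def dist_norm norm_minus_commute)
      also have "\<dots> = 1 / 2" using N0 by (simp add: field_simps)
      finally show ?thesis .
    qed
    have "norm (R w x) \<le> (2 * N) * norm x" for x
    proof -
      have "R w x = R z x + cscale (z - w) (R z (R w x))"
        using resolvent_identity[OF rw z, of x] R_commute[OF z rw, of x] by (simp add: algebra_simps)
      hence "norm (R w x) \<le> norm (R z x) + cmod (z - w) * norm (R z (R w x))"
        by (metis norm_triangle_ineq norm_cscale)
      also have "\<dots> \<le> N * norm x + cmod (z - w) * (N * norm (R w x))"
        unfolding N_def using onorm[OF bounded_linear_R[OF z]]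
        by (intro add_mono mult_left_mono) auto
      also have "cmod (z - w) * (N * norm (R w x)) \<le> 1 / 2 * norm (R w x)"
        using small by (metis mult.assoc mult_right_mono norm_ge_zero)
      finally show ?thesis by simp
    qed
    thus ?thesis using rw by blast
  qed
  thus ?thesis using e N0 by (intro exI[of _ e] conjI exI[of _ "2 * N"]) auto
qed

text \<open>The argument may move together with the point, so continuity of the squared resolvent
  follows by applying the lemma twice.\<close>

lemma tendsto_R:
  assumes z: "0 < Re z" and v: "(v \<longlongrightarrow> y) (at z within S)"
  shows "((\<lambda>w. R w (v w)) \<longlongrightarrow> R z y) (at z within S)"
proof -
  obtain e K where e: "e > 0" "K \<ge> 0"
    and K: "\<And>w. dist w z < e \<Longrightarrow> 0 < Re w \<and> (\<forall>x. norm (R w x) \<le> K * norm x)"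
    using R_locally_bounded[OF z] by blast
  have ev: "\<forall>\<^sub>F w in at z within S. dist w z < e"
    using e(1) by (auto simp: eventually_at)
  have "((\<lambda>w. R w (v w) - R z y) \<longlongrightarrow> 0) (at z within S)"
  proof (rule Lim_null_comparison)
    show "\<forall>\<^sub>F w in at z within S.
        norm (R w (v w) - R z y) \<le> K * norm (v w - y) + cmod (z - w) * (K * norm (R z y))"
      using ev
    proof eventually_elim
      case (elim w)
      note w = K[OF elim]
      have "R w (v w) - R z y = R w (v w - y) + cscale (z - w) (R w (R z y))"
        using w resolvent_identity[OF conjunct1[OF w] z, of y] R_diff[OF conjunct1[OF w], of "v w" y]
        by (metis add_diff_eq diff_add_cancel)
      hence "norm (R w (v w) - R z y) \<le> norm (R w (v w - y)) + cmod (z - w) * norm (R w (R z y))"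
        by (metis norm_triangle_ineq norm_cscale)
      also have "\<dots> \<le> K * norm (v w - y) + cmod (z - w) * (K * norm (R z y))"
        using w by (intro add_mono mult_left_mono) auto
      finally show ?case .
    qed
    have "((\<lambda>w. K * norm (v w - y) + cmod (z - w) * (K * norm (R z y))) \<longlongrightarrow>
        K * norm (y - y) + cmod (z - z) * (K * norm (R z y))) (at z within S)"
      by (intro tendsto_intros v)
    thus "((\<lambda>w. K * norm (v w - y) + cmod (z - w) * (K * norm (R z y))) \<longlongrightarrow> 0) (at z within S)"
      by simp
  qed
  thus ?thesis by (simp add: LIM_zero_iff)
qed

lemma continuous_on_R: "continuous_on rhp v \<Longrightarrow> continuous_on rhp (\<lambda>z. R z (v z))"
  unfolding continuous_on_def by (auto simp: rhp_def intro: tendsto_R)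

lemma continuous_on_R_R: "continuous_on rhp (\<lambda>z. R z (R z x))"
  by (intro continuous_on_R continuous_on_const)

text \<open>By the resolvent identity the difference quotient equals
  \<open>- \<phi> (R w (R z x))\<close> exactly; only continuity of the resolvent is left.\<close>

lemma R_dual_has_derivative:
  assumes z: "0 < Re z" and \<phi>: "\<phi> \<in> dual_space"
  shows "((\<lambda>w. \<phi> (R w x)) has_field_derivative - \<phi> (R z (R z x))) (at z)"
  unfolding has_field_derivative_iff
proof (rule Lim_transform_eventually)
  have "((\<lambda>w. \<phi> (R w (R z x))) \<longlongrightarrow> \<phi> (R z (R z x))) (at z)"
    by (intro bounded_linear.tendsto[OF dual_bounded_linear[OF \<phi>]] tendsto_R z tendsto_const)
  thus "((\<lambda>w. - \<phi> (R w (R z x))) \<longlongrightarrow> - \<phi> (R z (R z x))) (at z)" by (rule tendsto_minus)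
  have "\<forall>\<^sub>F w in at z. w \<in> rhp - {z}"
    using z by (intro eventually_at_in_open open_rhp) (simp add: rhp_def)
  thus "\<forall>\<^sub>F w in at z. - \<phi> (R w (R z x)) = (\<phi> (R w x) - \<phi> (R z x)) / (w - z)"
  proof eventually_elim
    case (elim w)
    hence w: "0 < Re w" "w \<noteq> z" by (auto simp: rhp_def)
    have "\<phi> (R w x) - \<phi> (R z x) = (z - w) * \<phi> (R w (R z x))"
      using resolvent_identity[OF w(1) z, of x] \<phi> by (metis dual_diff dual_cscale)
    thus ?case using w by (simp add: field_simps)
  qed
qed

lemma holomorphic_R_dual: "\<phi> \<in> dual_space \<Longrightarrow> (\<lambda>w. \<phi> (R w x)) holomorphic_on rhp"
  by (rule holomorphic_onI)
    (auto simp: rhp_def field_differentiable_def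
      intro!: exI DERIV_subset[OF R_dual_has_derivative])

lemma holomorphic_R_R_dual:
  assumes "\<phi> \<in> dual_space"
  shows "(\<lambda>w. \<phi> (R w (R w x))) holomorphic_on rhp"
proof -
  have "(\<lambda>w. - deriv (\<lambda>w. \<phi> (R w x)) w) holomorphic_on rhp"
    by (intro holomorphic_intros holomorphic_deriv holomorphic_R_dual open_rhp assms)
  thus ?thesis
    by (rule holomorphic_transform)
      (use DERIV_imp_deriv[OF R_dual_has_derivative[OF _ assms]] in \<open>auto simp: rhp_def\<close>)
qed

lemma dual_comp_R:
  assumes "0 < Re z" "\<phi> \<in> dual_space"
  shows "(\<lambda>x. \<phi> (R z x)) \<in> dual_space"
  using assms bounded_linear_compose[OF dual_bounded_linear bounded_linear_R]
  by (auto simp: dual_space_def R_cscale)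

lemma continuous_on_R_R_line:
  assumes "0 < \<alpha>"
  shows "continuous_on UNIV (\<lambda>\<beta>. RR (Complex \<alpha> \<beta>) x)"
  by (rule continuous_on_compose2[OF continuous_on_R_R])
    (auto intro!: continuous_intros simp: rhp_def assms Complex_eq)

lemma measurable_R_R_line:
  assumes "0 < \<alpha>" "\<phi> \<in> dual_space"
  shows "(\<lambda>\<beta>. \<phi> (RR (Complex \<alpha> \<beta>) x)) \<in> borel_measurable borel"
  by (intro borel_measurable_continuous_onI bounded_linear.continuous_on[OF dual_bounded_linear]
      continuous_on_R_R_line assms)

section \<open>The supremum in the hypothesis as a seminorm in the vector and in the
  functional\<close>

definition gsf_sup :: "('a \<Rightarrow> complex) \<Rightarrow> 'a \<Rightarrow> ennreal" where
  "gsf_sup \<phi> x = (SUP \<alpha>\<in>{0<..}. ennreal (\<alpha> + 1) *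
     (\<integral>\<^sup>+ \<beta>. ennreal (cmod (\<phi> (RR (Complex \<alpha> \<beta>) x))) \<partial>lborel))"

text \<open>Functional and vector are both free, so one statement serves subadditivity in the vector
  for a fixed functional and in the functional for a fixed vector. The next two lemmas have this
  form for the same reason.\<close>

lemma gsf_sup_subadditive:
  assumes \<phi>: "\<phi> \<in> dual_space" "\<psi> \<in> dual_space" "\<eta> \<in> dual_space"
    and eq: "\<And>z. 0 < Re z \<Longrightarrow>
      cmod (\<eta> (R z (R z v))) \<le> cmod (\<phi> (R z (R z x))) + cmod (\<psi> (R z (R z y)))"
  shows "gsf_sup \<eta> v \<le> gsf_sup \<phi> x + gsf_sup \<psi> y"
  unfolding gsf_sup_def[of \<eta>]
proof (rule SUP_least)
  fix \<alpha> :: real assume "\<alpha> \<in> {0<..}"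
  hence \<alpha>: "\<alpha> > 0" by simp
  let ?I = "\<lambda>\<phi> x. \<integral>\<^sup>+ \<beta>. ennreal (cmod (\<phi> (RR (Complex \<alpha> \<beta>) x))) \<partial>lborel"
  have le: "ennreal (\<alpha> + 1) * ?I \<phi> x \<le> gsf_sup \<phi> x" for \<phi> x
    unfolding gsf_sup_def using \<alpha> by (intro SUP_upper) auto
  note m = measurable_R_R_line[OF \<alpha> \<phi>(1), of x] measurable_R_R_line[OF \<alpha> \<phi>(2), of y]
  have "?I \<eta> v \<le> (\<integral>\<^sup>+ \<beta>. ennreal (cmod (\<phi> (RR (Complex \<alpha> \<beta>) x))) +
      ennreal (cmod (\<psi> (RR (Complex \<alpha> \<beta>) y))) \<partial>lborel)"
    using \<alpha> eq by (intro nn_integral_mono) (simp flip: ennreal_plus)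
  also have "\<dots> = ?I \<phi> x + ?I \<psi> y"
    using m by (intro nn_integral_add) auto
  finally have "ennreal (\<alpha> + 1) * ?I \<eta> v \<le> ennreal (\<alpha> + 1) * (?I \<phi> x + ?I \<psi> y)"
    by (intro mult_left_mono) auto
  also have "\<dots> \<le> gsf_sup \<phi> x + gsf_sup \<psi> y"
    unfolding distrib_left by (intro add_mono le)
  finally show "ennreal (\<alpha> + 1) * ?I \<eta> v \<le> gsf_sup \<phi> x + gsf_sup \<psi> y" .
qed

lemma gsf_sup_homogeneous:
  assumes \<phi>: "\<phi> \<in> dual_space"
    and eq: "\<And>z. 0 < Re z \<Longrightarrow> cmod (\<eta> (R z (R z v))) = \<bar>c\<bar> * cmod (\<phi> (R z (R z x)))"
  shows "gsf_sup \<eta> v = ennreal \<bar>c\<bar> * gsf_sup \<phi> x"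
proof -
  have "gsf_sup \<eta> v = (SUP \<alpha>\<in>{0<..}. ennreal \<bar>c\<bar> * (ennreal (\<alpha> + 1) *
     (\<integral>\<^sup>+ \<beta>. ennreal (cmod (\<phi> (RR (Complex \<alpha> \<beta>) x))) \<partial>lborel)))"
    unfolding gsf_sup_def
  proof (intro SUP_cong refl)
    fix \<alpha> :: real assume "\<alpha> \<in> {0<..}"
    hence \<alpha>: "\<alpha> > 0" by simp
    note m = measurable_R_R_line[OF \<alpha> \<phi>, of x]
    have "(\<integral>\<^sup>+ \<beta>. ennreal (cmod (\<eta> (RR (Complex \<alpha> \<beta>) v))) \<partial>lborel) =
      (\<integral>\<^sup>+ \<beta>. ennreal \<bar>c\<bar> * ennreal (cmod (\<phi> (RR (Complex \<alpha> \<beta>) x))) \<partial>lborel)"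
      using \<alpha> eq by (intro nn_integral_cong) (simp add: ennreal_mult)
    also have "\<dots> = ennreal \<bar>c\<bar> *
        (\<integral>\<^sup>+ \<beta>. ennreal (cmod (\<phi> (RR (Complex \<alpha> \<beta>) x))) \<partial>lborel)"
      using m by (intro nn_integral_cmult) auto
    finally show "ennreal (\<alpha> + 1) *
      (\<integral>\<^sup>+ \<beta>. ennreal (cmod (\<eta> (RR (Complex \<alpha> \<beta>) v))) \<partial>lborel) =
      ennreal \<bar>c\<bar> * (ennreal (\<alpha> + 1) *
     (\<integral>\<^sup>+ \<beta>. ennreal (cmod (\<phi> (RR (Complex \<alpha> \<beta>) x))) \<partial>lborel))"
      by (simp add: mult_ac)
  qed
  also have "\<dots> = ennreal \<bar>c\<bar> * gsf_sup \<phi> x"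
    unfolding gsf_sup_def by (rule SUP_mult_left_ennreal[symmetric])
  finally show ?thesis .
qed

text \<open>Fatou's lemma on each vertical line separately, so pointwise convergence at every point
  of the half-plane suffices.\<close>

lemma gsf_sup_lsc:
  assumes \<phi>: "\<And>k. \<phi> k \<in> dual_space"
    and lim: "\<And>z. 0 < Re z \<Longrightarrow> (\<lambda>k. \<phi> k (R z (R z (x k)))) \<longlonglongrightarrow> \<psi> (R z (R z y))"
    and le: "\<And>k::nat. gsf_sup (\<phi> k) (x k) \<le> B"
  shows "gsf_sup \<psi> y \<le> B"
  unfolding gsf_sup_def[of \<psi>]
proof (rule SUP_least)
  fix \<alpha> :: real assume "\<alpha> \<in> {0<..}"
  hence \<alpha>: "\<alpha> > 0" by simp
  let ?f = "\<lambda>k \<beta>. ennreal (\<alpha> + 1) * ennreal (cmod (\<phi> k (RR (Complex \<alpha> \<beta>) (x k))))"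
  have [measurable]: "(\<lambda>\<beta>. \<phi> k (RR (Complex \<alpha> \<beta>) (x k))) \<in> borel_measurable borel" for k
    by (rule measurable_R_R_line[OF \<alpha> \<phi>])
  have lim': "(\<lambda>k. \<phi> k (RR (Complex \<alpha> \<beta>) (x k)))
      \<longlonglongrightarrow> \<psi> (RR (Complex \<alpha> \<beta>) y)" for \<beta>
    using \<alpha> by (intro lim) simp
  have mpsi [measurable]: "(\<lambda>\<beta>. \<psi> (RR (Complex \<alpha> \<beta>) y)) \<in> borel_measurable borel"
    by (rule borel_measurable_LIMSEQ_metric[OF _ lim']) auto
  have "ennreal (\<alpha> + 1) * (\<integral>\<^sup>+ \<beta>. ennreal (cmod (\<psi> (RR (Complex \<alpha> \<beta>) y))) \<partial>lborel)
    = (\<integral>\<^sup>+ \<beta>. ennreal (\<alpha> + 1) * ennreal (cmod (\<psi> (RR (Complex \<alpha> \<beta>) y))) \<partial>lborel)"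
    by (rule nn_integral_cmult[symmetric]) simp
  also have "\<dots> = (\<integral>\<^sup>+ \<beta>. liminf (\<lambda>k. ?f k \<beta>) \<partial>lborel)"
  proof (rule nn_integral_cong)
    fix \<beta> :: real
    have "(\<lambda>k. ?f k \<beta>) \<longlonglongrightarrow> ennreal (\<alpha> + 1) * ennreal (cmod (\<psi> (RR (Complex \<alpha> \<beta>) y)))"
      using lim' by (intro ennreal_tendsto_cmult tendsto_ennrealI tendsto_norm) auto
    thus "ennreal (\<alpha> + 1) * ennreal (cmod (\<psi> (RR (Complex \<alpha> \<beta>) y))) = liminf (\<lambda>k. ?f k \<beta>)"
      by (metis lim_imp_Liminf trivial_limit_sequentially)
  qed
  also have "\<dots> \<le> liminf (\<lambda>k. \<integral>\<^sup>+ \<beta>. ?f k \<beta> \<partial>lborel)"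
    by (intro nn_integral_liminf) auto
  also have "\<dots> \<le> B"
  proof (rule Liminf_le)
    show "\<forall>\<^sub>F k in sequentially. (\<integral>\<^sup>+ \<beta>. ?f k \<beta> \<partial>lborel) \<le> B"
    proof (rule always_eventually, rule allI)
      fix k
      have "(\<integral>\<^sup>+ \<beta>. ?f k \<beta> \<partial>lborel) = ennreal (\<alpha> + 1) *
          (\<integral>\<^sup>+ \<beta>. ennreal (cmod (\<phi> k (RR (Complex \<alpha> \<beta>) (x k)))) \<partial>lborel)"
        by (rule nn_integral_cmult) simp
      also have "\<dots> \<le> gsf_sup (\<phi> k) (x k)"
        unfolding gsf_sup_def using \<alpha> by (intro SUP_upper) auto
      finally show "(\<integral>\<^sup>+ \<beta>. ?f k \<beta> \<partial>lborel) \<le> B" using le[of k] by simp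
    qed
  qed simp
  finally show "ennreal (\<alpha> + 1) *
    (\<integral>\<^sup>+ \<beta>. ennreal (cmod (\<psi> (RR (Complex \<alpha> \<beta>) y))) \<partial>lborel) \<le> B" .
qed

lemma gsf_sup_bounded_right:
  assumes \<phi>: "\<phi> \<in> dual_space" and fin: "\<And>x. gsf_sup \<phi> x < \<infinity>"
  shows "\<exists>C\<ge>0. \<forall>x. gsf_sup \<phi> x \<le> ennreal (C * norm x)"
proof (rule lsc_seminorm_bounded[OF fin])
  fix n :: nat
  show "closed {x. gsf_sup \<phi> x \<le> of_nat n}"
    unfolding closed_sequential_limits
  proof clarify
    fix X l assume X: "\<forall>k. X k \<in> {x. gsf_sup \<phi> x \<le> of_nat n}" "X \<longlonglongrightarrow> l"
    show "gsf_sup \<phi> l \<le> of_nat n"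
    proof (rule gsf_sup_lsc)
      fix z :: complex assume "0 < Re z"
      thus "(\<lambda>k. \<phi> (R z (R z (X k)))) \<longlonglongrightarrow> \<phi> (R z (R z l))"
        by (intro bounded_linear.tendsto[OF dual_bounded_linear[OF \<phi>]]
            bounded_linear.tendsto[OF bounded_linear_R] X(2))
    qed (use X \<phi> in auto)
  qed
next
  show "gsf_sup \<phi> (x + y) \<le> gsf_sup \<phi> x + gsf_sup \<phi> y" for x y
    by (rule gsf_sup_subadditive[OF \<phi> \<phi> \<phi>])
      (use \<phi> in \<open>simp add: R_add dual_add norm_triangle_ineq\<close>)
  show "gsf_sup \<phi> (c *\<^sub>R x) = ennreal \<bar>c\<bar> * gsf_sup \<phi> x" for c x
    by (rule gsf_sup_homogeneous[OF \<phi>]) (use \<phi> in \<open>simp add: R_scaleR dual_scaleR\<close>)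
qed

text \<open>Uniform boundedness is used twice. For a fixed functional it makes the supremum over the
  unit ball finite; that supremum is then a lower semicontinuous seminorm in the functional.\<close>

lemma gsf_sup_bounded:
  assumes fin: "\<And>\<phi> x. \<phi> \<in> dual_space \<Longrightarrow> gsf_sup \<phi> x < \<infinity>"
  shows "\<exists>C\<ge>0. \<forall>\<phi>\<in>dual_space. \<forall>x. gsf_sup \<phi> x \<le> ennreal (C * onorm \<phi> * norm x)"
proof -
  \<comment> \<open>Functionals are parametrized by their real parts, which form the Banach space of
    bounded real linear functionals, so that completeness is available.\<close>
  define \<Phi> where "\<Phi> = (\<lambda>u :: 'a \<Rightarrow>\<^sub>L real. complexify (blinfun_apply u))"
  have \<Phi>: "\<Phi> u \<in> dual_space" for u
    unfolding \<Phi>_def by (rule complexify_dual[OF blinfun.bounded_linear_right])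
  define P where "P = (\<lambda>u. SUP x\<in>cball 0 1. gsf_sup (\<Phi> u) x)"
  have "\<exists>C\<ge>0. \<forall>u. P u \<le> ennreal (C * norm u)"
  proof (rule lsc_seminorm_bounded)
    fix u
    obtain C where C: "C \<ge> 0" "\<And>x. gsf_sup (\<Phi> u) x \<le> ennreal (C * norm x)"
      using gsf_sup_bounded_right[OF \<Phi> fin[OF \<Phi>], of u] by blast
    have "P u \<le> ennreal C" unfolding P_def
    proof (rule SUP_least)
      fix x :: 'a assume "x \<in> cball 0 1"
      hence "C * norm x \<le> C" using C by (simp add: mult_left_le)
      thus "gsf_sup (\<Phi> u) x \<le> ennreal C" using C(2)[of x] by (meson ennreal_leI order_trans)
    qed
    thus "P u < \<infinity>" by (simp add: le_less_trans)
  next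
    fix n :: nat
    have "{u. P u \<le> of_nat n} = (\<Inter>x\<in>cball 0 1. {u. gsf_sup (\<Phi> u) x \<le> of_nat n})"
      by (auto simp: P_def SUP_le_iff)
    moreover have "closed {u. gsf_sup (\<Phi> u) x \<le> of_nat n}" for x
      unfolding closed_sequential_limits
    proof clarify
      fix X l assume X: "\<forall>k. X k \<in> {u. gsf_sup (\<Phi> u) x \<le> of_nat n}" "X \<longlonglongrightarrow> l"
      show "gsf_sup (\<Phi> l) x \<le> of_nat n"
      proof (rule gsf_sup_lsc)
        show "(\<lambda>k. \<Phi> (X k) (R z (R z x))) \<longlonglongrightarrow> \<Phi> l (R z (R z x))" for z
          unfolding \<Phi>_def complexify_def by (intro tendsto_intros X(2))
      qed (use X \<Phi> in auto)
    qed
    ultimately show "closed {u. P u \<le> of_nat n}" by auto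
  next
    fix u v
    show "P (u + v) \<le> P u + P v" unfolding P_def[THEN fun_cong, of "u + v"]
    proof (rule SUP_least)
      fix x :: 'a assume x: "x \<in> cball 0 1"
      have "\<Phi> (u + v) y = \<Phi> u y + \<Phi> v y" for y
        by (simp add: \<Phi>_def complexify_def blinfun.add_left complex_eq_iff)
      hence "gsf_sup (\<Phi> (u + v)) x \<le> gsf_sup (\<Phi> u) x + gsf_sup (\<Phi> v) x"
        by (intro gsf_sup_subadditive \<Phi>) (simp add: norm_triangle_ineq)
      also have "\<dots> \<le> P u + P v" unfolding P_def using x by (intro add_mono SUP_upper)
      finally show "gsf_sup (\<Phi> (u + v)) x \<le> P u + P v" .
    qed
  next
    fix c :: real and u
    have "\<Phi> (c *\<^sub>R u) y = c *\<^sub>R \<Phi> u y" for y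
      by (simp add: \<Phi>_def complexify_def blinfun.scaleR_left complex_eq_iff)
    hence "gsf_sup (\<Phi> (c *\<^sub>R u)) x = ennreal \<bar>c\<bar> * gsf_sup (\<Phi> u) x" for x
      by (intro gsf_sup_homogeneous \<Phi>) simp
    thus "P (c *\<^sub>R u) = ennreal \<bar>c\<bar> * P u"
      unfolding P_def by (simp add: SUP_mult_left_ennreal)
  qed
  then obtain C where C: "C \<ge> 0" "\<And>u. P u \<le> ennreal (C * norm u)" by blast
  have "gsf_sup \<phi> x \<le> ennreal (C * onorm \<phi> * norm x)" if \<phi>: "\<phi> \<in> dual_space" for \<phi> x
  proof -
    have bl: "bounded_linear (\<lambda>x. Re (\<phi> x))"
      by (rule bounded_linear_compose[OF bounded_linear_Re dual_bounded_linear[OF \<phi>]])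
    define u where "u = Blinfun (\<lambda>x. Re (\<phi> x))"
    have app: "blinfun_apply u = (\<lambda>x. Re (\<phi> x))"
      unfolding u_def by (rule bounded_linear_Blinfun_apply[OF bl])
    hence \<Phi>u: "\<Phi> u = \<phi>" by (simp add: \<Phi>_def complexify_Re[OF \<phi>])
    have nu: "norm u \<le> onorm \<phi>"
    proof (rule norm_blinfun_bound)
      show "norm (blinfun_apply u x) \<le> onorm \<phi> * norm x" for x
        unfolding app using abs_Re_le_cmod[of "\<phi> x"] dual_bound[OF \<phi>, of x] by simp
    qed (rule dual_onorm_nonneg[OF \<phi>])
    show ?thesis
    proof (cases "x = 0")
      case True
      have "gsf_sup \<phi> x = ennreal \<bar>0\<bar> * gsf_sup \<phi> x"
        by (rule gsf_sup_homogeneous[OF \<phi>])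
          (use True \<phi> in \<open>simp add: dual_zero linear_simps(3)[OF bounded_linear_R]\<close>)
      thus ?thesis by simp
    next
      case False
      define y where "y = (1 / norm x) *\<^sub>R x"
      have x: "x = norm x *\<^sub>R y" using False by (simp add: y_def)
      have "gsf_sup \<phi> x = ennreal \<bar>norm x\<bar> * gsf_sup \<phi> y"
        by (rule gsf_sup_homogeneous[OF \<phi>]) (subst x, use \<phi> in \<open>simp add: R_scaleR dual_scaleR\<close>)
      also have "gsf_sup \<phi> y \<le> P u"
        unfolding P_def \<Phi>u using False by (intro SUP_upper) (simp add: y_def)
      also have "P u \<le> ennreal (C * onorm \<phi>)"
        using C nu by (meson ennreal_leI mult_left_mono order_trans)
      also have "ennreal \<bar>norm x\<bar> * ennreal (C * onorm \<phi>) = ennreal (C * onorm \<phi> * norm x)"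
        using C dual_onorm_nonneg[OF \<phi>] by (simp add: ennreal_mult[symmetric] mult_ac)
      finally show ?thesis by (simp add: mult_left_mono)
    qed
  qed
  thus ?thesis using C by blast
qed

end

section \<open>Uniform resolvent bounds\<close>

lemma integral_bound_of_nn_integral:
  fixes f :: "'b \<Rightarrow> complex"
  assumes f: "f \<in> borel_measurable M" and le: "(\<integral>\<^sup>+ x. ennreal (cmod (f x)) \<partial>M) \<le> ennreal B"
    and B: "0 \<le> B"
  shows "integrable M f" and "(LINT x|M. cmod (f x)) \<le> B" and "cmod (LINT x|M. f x) \<le> B"
proof -
  show i: "integrable M f"
    using le by (intro integrableI_bounded f) (simp add: le_less_trans)
  have "ennreal (LINT x|M. cmod (f x)) = (\<integral>\<^sup>+ x. ennreal (cmod (f x)) \<partial>M)"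
    using i by (intro nn_integral_eq_integral[symmetric] integrable_norm) auto
  thus *: "(LINT x|M. cmod (f x)) \<le> B" using le B by (simp flip: ennreal_le_iff)
  show "cmod (LINT x|M. f x) \<le> B" by (rule order.trans[OF integral_norm_bound *])
qed

text \<open>The bound does not depend on the end points, which allows one of them to tend to
  infinity in the resolvent estimate.\<close>

lemma variation_le_nn_integral_deriv:
  fixes f f' :: "real \<Rightarrow> complex"
  assumes der: "\<And>x. (f has_vector_derivative f' x) (at x)" and cont: "continuous_on UNIV f'"
    and le: "(\<integral>\<^sup>+ x. ennreal (cmod (f' x)) \<partial>lborel) \<le> ennreal B" and B: "0 \<le> B"
  shows "cmod (f b - f a) \<le> B"
proof -
  have meas: "f' \<in> borel_measurable lborel"
    using borel_measurable_continuous_onI[OF cont] by simp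
  note bd = integral_bound_of_nn_integral[OF meas le B]
  have *: "cmod (f b - f a) \<le> B" if "a \<le> b" for a b
  proof -
    have hi: "(f' has_integral (f b - f a)) {a..b}"
      by (rule fundamental_theorem_of_calculus[OF that has_vector_derivative_at_within[OF der]])
    have si: "set_integrable lborel {a..b} f'"
      unfolding set_integrable_def using bd(1) by (intro integrable_mult_indicator) auto
    have "f b - f a = (LINT x:{a..b}|lborel. f' x)"
      using hi set_borel_integral_eq_integral(2)[OF si] by (simp add: integral_unique)
    also have "cmod \<dots> \<le> (LINT x|lborel. cmod (indicator {a..b} x *\<^sub>R f' x))"
      unfolding set_lebesgue_integral_def by (rule integral_norm_bound)
    also have "\<dots> \<le> (LINT x|lborel. cmod (f' x))"
      using bd(1) si unfolding set_integrable_def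
      by (intro integral_mono integrable_norm) (auto simp: indicator_def)
    finally show ?thesis using bd(2) by simp
  qed
  show ?thesis
    using *[of a b] *[of b a] by (cases "a \<le> b") (auto simp: norm_minus_commute)
qed

lemma has_vector_derivative_vertical_line:
  assumes "(F has_field_derivative D) (at (Complex a b))"
  shows "((\<lambda>b. F (Complex a b)) has_vector_derivative \<i> * D) (at b)"
proof -
  have "((\<lambda>b. of_real a + \<i> * of_real b) has_vector_derivative \<i>) (at b)"
    by (auto intro!: derivative_eq_intros simp: has_vector_derivative_def fun_eq_iff scaleR_conv_of_real mult.commute)
  moreover have "(F has_field_derivative D) (at (of_real a + \<i> * of_real b))"
    using assms by (simp add: Complex_eq)
  ultimately have "((F \<circ> (\<lambda>b. of_real a + \<i> * of_real b)) has_vector_derivative \<i> * D) (at b)"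
    by (rule field_vector_diff_chain_at)
  thus ?thesis by (simp add: o_def Complex_eq)
qed

text \<open>\<open>gsf\<close> is the integral condition after uniform boundedness, divided by
  \<alpha> + 1. The range of \<open>R 1\<close> plays the role of the domain of A.\<close>

locale gsf_family = resolvent_family R for R :: "complex \<Rightarrow> 'a::complex_banach \<Rightarrow> 'a" +
  fixes C :: real
  assumes C_nonneg: "0 \<le> C"
    and dense_range: "closure (range (R 1)) = UNIV"
    and gsf: "0 < \<alpha> \<Longrightarrow> \<phi> \<in> dual_space \<Longrightarrow>
      (\<integral>\<^sup>+ \<beta>. ennreal (cmod (\<phi> (RR (Complex \<alpha> \<beta>) x))) \<partial>lborel)
        \<le> ennreal (C * onorm \<phi> * norm x / (\<alpha> + 1))"
begin

lemma gsf_const_nonneg: "0 < \<alpha> \<Longrightarrow> \<phi> \<in> dual_space \<Longrightarrow> 0 \<le> C * onorm \<phi> * norm x / (\<alpha> + 1)"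
  using C_nonneg dual_onorm_nonneg[of \<phi>] by (intro divide_nonneg_nonneg mult_nonneg_nonneg) auto

lemma R_vertical_variation:
  assumes \<alpha>: "0 < \<alpha>" and \<phi>: "\<phi> \<in> dual_space"
  shows "cmod (\<phi> (R (Complex \<alpha> b) x) - \<phi> (R (Complex \<alpha> a) x)) \<le> C * onorm \<phi> * norm x / (\<alpha> + 1)"
proof (rule variation_le_nn_integral_deriv[where f = "\<lambda>\<beta>. \<phi> (R (Complex \<alpha> \<beta>) x)"])
  show "((\<lambda>\<beta>. \<phi> (R (Complex \<alpha> \<beta>) x)) has_vector_derivative
      \<i> * - \<phi> (RR (Complex \<alpha> \<beta>) x)) (at \<beta>)" for \<beta>
    using \<alpha> by (intro has_vector_derivative_vertical_line R_dual_has_derivative \<phi>) simp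
  show "continuous_on UNIV (\<lambda>\<beta>. \<i> * - \<phi> (RR (Complex \<alpha> \<beta>) x))"
    by (intro continuous_intros bounded_linear.continuous_on[OF dual_bounded_linear[OF \<phi>]]
        continuous_on_R_R_line \<alpha>)
  show "(\<integral>\<^sup>+ \<beta>. ennreal (cmod (\<i> * - \<phi> (RR (Complex \<alpha> \<beta>) x))) \<partial>lborel)
      \<le> ennreal (C * onorm \<phi> * norm x / (\<alpha> + 1))"
    using gsf[OF \<alpha> \<phi>, of x] by (simp add: norm_mult)
qed (rule gsf_const_nonneg[OF \<alpha> \<phi>])

text \<open>The variation bound compares with the real point of the line. The constant still depends
  on \<alpha>, which is enough for limits along one fixed line.\<close>

lemma R_bounded_on_line:
  assumes \<alpha>: "0 < \<alpha>"
  shows "norm (R (Complex \<alpha> \<beta>) x) \<le> 2 * (norm (R (Complex \<alpha> 0) x) + C * norm x)"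
proof (rule norm_le_by_dual)
  fix \<phi> :: "'a \<Rightarrow> complex" assume \<phi>: "\<phi> \<in> dual_space"
  have "C * onorm \<phi> * norm x / (\<alpha> + 1) \<le> C * onorm \<phi> * norm x / 1"
    using \<alpha> C_nonneg dual_onorm_nonneg[OF \<phi>] by (intro divide_left_mono) auto
  hence "cmod (\<phi> (R (Complex \<alpha> \<beta>) x)) \<le> cmod (\<phi> (R (Complex \<alpha> 0) x)) + C * onorm \<phi> * norm x"
    using R_vertical_variation[OF \<alpha> \<phi>, of \<beta> x 0]
      norm_triangle_ineq2[of "\<phi> (R (Complex \<alpha> \<beta>) x)" "\<phi> (R (Complex \<alpha> 0) x)"] by simp
  also have "\<dots> \<le> onorm \<phi> * norm (R (Complex \<alpha> 0) x) + C * onorm \<phi> * norm x"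
    using dual_bound[OF \<phi>] by simp
  finally show "cmod (\<phi> (R (Complex \<alpha> \<beta>) x)) \<le> onorm \<phi> * (norm (R (Complex \<alpha> 0) x) + C * norm x)"
    by (simp add: algebra_simps)
qed (use C_nonneg in simp)

text \<open>On the range of \<open>R 1\<close> the resolvent tends to zero along vertical lines, so
  sending one end point of the variation bound to infinity leaves a bound for the resolvent alone,
  with the factor 1 / (\<alpha> + 1). Density extends it to all vectors.\<close>

lemma R_bound:
  assumes z: "0 < Re z"
  shows "norm (R z x) \<le> 2 * C / (Re z + 1) * norm x"
proof -
  define \<alpha> \<beta> where ab: "\<alpha> = Re z" "\<beta> = Im z"
  have \<alpha>: "\<alpha> > 0" and zab: "z = Complex \<alpha> \<beta>" using z by (auto simp: ab)
  have ran: "norm (R z (R 1 y)) \<le> 2 * (C * norm (R 1 y) / (\<alpha> + 1))" for y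
  proof (rule norm_le_by_dual)
    fix \<phi> :: "'a \<Rightarrow> complex" assume \<phi>: "\<phi> \<in> dual_space"
    \<comment> \<open>A bound for R z y - R 1 y on the line, the numerator of the resolvent
      identity; it disappears in the limit.\<close>
    define K where "K = 2 * (norm (R (Complex \<alpha> 0) y) + C * norm y) + norm (R 1 y)"
    have K0: "K \<ge> 0" using C_nonneg by (simp add: K_def)
    have lim: "((\<lambda>\<gamma>. \<phi> (R (Complex \<alpha> \<gamma>) (R 1 y))) \<longlongrightarrow> 0) at_top"
    proof (rule Lim_null_comparison)
      show "\<forall>\<^sub>F \<gamma> in at_top. cmod (\<phi> (R (Complex \<alpha> \<gamma>) (R 1 y))) \<le> onorm \<phi> * (K / \<gamma>)"
        using eventually_gt_at_top[of 0]
      proof eventually_elim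
        case (elim \<gamma>)
        hence ne: "Complex \<alpha> \<gamma> \<noteq> 1" by (auto simp: complex_eq_iff)
        have g: "\<gamma> \<le> cmod (1 - Complex \<alpha> \<gamma>)"
          using abs_Im_le_cmod[of "1 - Complex \<alpha> \<gamma>"] elim by simp
        have "norm (R (Complex \<alpha> \<gamma>) (R 1 y)) =
            norm (R (Complex \<alpha> \<gamma>) y - R 1 y) / cmod (1 - Complex \<alpha> \<gamma>)"
          using \<alpha> ne by (subst R_R_eq) (auto simp: norm_cscale norm_divide)
        also have "\<dots> \<le> K / \<gamma>"
        proof (rule frac_le)
          show "norm (R (Complex \<alpha> \<gamma>) y - R 1 y) \<le> K"
            unfolding K_def using R_bounded_on_line[OF \<alpha>, of \<gamma> y]
            by (meson add_mono norm_triangle_ineq4 order.trans order_refl)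
        qed (use g elim K0 in auto)
        finally show ?case
          using dual_bound[OF \<phi>, of "R (Complex \<alpha> \<gamma>) (R 1 y)"] dual_onorm_nonneg[OF \<phi>]
          by (meson mult_left_mono order.trans)
      qed
      have "((\<lambda>\<gamma>. onorm \<phi> * (K / \<gamma>)) \<longlongrightarrow> onorm \<phi> * 0) at_top"
        by (intro tendsto_intros tendsto_divide_0[OF tendsto_const] filterlim_at_top_imp_at_infinity filterlim_ident)
      thus "((\<lambda>\<gamma>. onorm \<phi> * (K / \<gamma>)) \<longlongrightarrow> 0) at_top" by simp
    qed
    have "cmod (\<phi> (R (Complex \<alpha> \<beta>) (R 1 y)) - 0) \<le> C * onorm \<phi> * norm (R 1 y) / (\<alpha> + 1)"
      by (rule tendsto_upperbound[OF tendsto_norm[OF tendsto_diff[OF tendsto_const lim]]])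
        (auto intro!: always_eventually R_vertical_variation \<alpha> \<phi>)
    thus "cmod (\<phi> (R z (R 1 y))) \<le> onorm \<phi> * (C * norm (R 1 y) / (\<alpha> + 1))"
      by (simp add: zab mult_ac)
  qed (use \<alpha> C_nonneg in simp)
  have "closure (range (R 1)) \<subseteq> {x. norm (R z x) \<le> 2 * C / (\<alpha> + 1) * norm x}"
  proof (rule closure_minimal)
    show "closed {x. norm (R z x) \<le> 2 * C / (\<alpha> + 1) * norm x}"
      by (intro closed_Collect_le continuous_intros bounded_linear.continuous_on[OF bounded_linear_R[OF z]])
  qed (use ran in \<open>auto simp: mult.assoc\<close>)
  thus ?thesis using dense_range by (auto simp: ab)
qed

lemma R_uniform_bound:
  assumes z: "0 < Re z"
  shows "norm (R z x) \<le> 2 * C * norm x"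
proof -
  have "2 * C / (Re z + 1) \<le> 2 * C / 1" using z C_nonneg by (intro divide_left_mono) auto
  thus ?thesis using R_bound[OF z, of x] by (smt (verit) div_by_1 mult_right_mono norm_ge_zero)
qed

lemma R_R1_decay: "\<exists>K\<ge>0. \<forall>z x. 0 < Re z \<longrightarrow> norm (R z (R 1 x)) \<le> K / (1 + cmod z) * norm x"
proof -
  \<comment> \<open>For |1 - z| \<ge> 1 one has 1 + |z| \<le> 3 |1 - z|, which turns the bound 4 C
    of the numerator into 12 C. Otherwise 1 + |z| \<le> 3, and the uniform bound (2 C)^2 becomes 12
    C^2.\<close>
  define K where "K = 12 * C + 12 * C\<^sup>2"
  have "norm (R z (R 1 x)) \<le> K / (1 + cmod z) * norm x" if z: "0 < Re z" for z x
  proof (cases "cmod (1 - z) \<ge> 1")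
    case True
    have zz: "1 + cmod z \<le> 3 * cmod (1 - z)"
      using True norm_triangle_ineq2[of z 1] by (simp add: norm_minus_commute)
    have "norm (R z (R 1 x)) = norm (R z x - R 1 x) / cmod (1 - z)"
      using z True by (subst R_R_eq) (auto simp: norm_cscale norm_divide)
    also have "\<dots> \<le> (4 * C * norm x) / cmod (1 - z)"
      using R_uniform_bound[OF z, of x] R_uniform_bound[of 1 x] norm_triangle_ineq4[of "R z x" "R 1 x"]
      by (intro divide_right_mono) auto
    also have "\<dots> \<le> (4 * C * norm x) / ((1 + cmod z) / 3)"
      using zz C_nonneg True by (intro divide_left_mono) (auto intro!: mult_pos_pos add_pos_nonneg)
    also have "\<dots> \<le> K / (1 + cmod z) * norm x"
    proof -
      have "(4 * C * norm x) / ((1 + cmod z) / 3) = (12 * C * norm x) / (1 + cmod z)" by simp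
      also have "\<dots> \<le> (K * norm x) / (1 + cmod z)"
        using C_nonneg by (intro divide_right_mono mult_right_mono) (auto simp: K_def)
      finally show ?thesis by simp
    qed
    finally show ?thesis .
  next
    case False
    have zz: "1 + cmod z \<le> 3"
      using False norm_triangle_ineq2[of z 1] by (simp add: norm_minus_commute)
    have "norm (R z (R 1 x)) \<le> 2 * C * (2 * C * norm x)"
      using R_uniform_bound[OF z, of "R 1 x"] R_uniform_bound[of 1 x] C_nonneg
      by (smt (verit) mult_left_mono one_complex.simps(1))
    also have "\<dots> = (12 * C\<^sup>2 * norm x) / 3" by (simp add: power2_eq_square)
    also have "\<dots> \<le> (K * norm x) / (1 + cmod z)"
      using C_nonneg zz
      by (intro frac_le mult_right_mono) (auto simp: K_def intro: add_pos_nonneg)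
    finally show ?thesis by simp
  qed
  thus ?thesis using C_nonneg by (intro exI[of _ K]) (auto simp: K_def)
qed

text \<open>By commutation each \<open>R z\<close> is paired with one \<open>R 1\<close>, and every
  pair contributes one power of the decay.\<close>

lemma R_R_R1_R1_decay:
  "\<exists>K\<ge>0. \<forall>z x. 0 < Re z \<longrightarrow> norm (R z (R z (R 1 (R 1 x)))) \<le> K / (1 + cmod z)\<^sup>2 * norm x"
proof -
  obtain K where K: "K \<ge> 0" "\<And>z x. 0 < Re z \<Longrightarrow> norm (R z (R 1 x)) \<le> K / (1 + cmod z) * norm x"
    using R_R1_decay by blast
  have "norm (R z (R z (R 1 (R 1 x)))) \<le> K\<^sup>2 / (1 + cmod z)\<^sup>2 * norm x" if z: "0 < Re z" for z x
  proof -
    have "R z (R z (R 1 (R 1 x))) = R z (R 1 (R z (R 1 x)))"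
      using z by (subst R_commute[of z 1 "R 1 x"]) auto
    also have "norm \<dots> \<le> K / (1 + cmod z) * norm (R z (R 1 x))" by (rule K(2)[OF z])
    also have "\<dots> \<le> K / (1 + cmod z) * (K / (1 + cmod z) * norm x)"
      using K(1) by (intro mult_left_mono K(2)[OF z]) simp
    finally show ?thesis by (simp add: power2_eq_square)
  qed
  thus ?thesis by (intro exI[of _ "K\<^sup>2"]) auto
qed

lemma closure_R1_image:
  assumes "closure S = UNIV"
  shows "closure (R 1 ` S) = UNIV"
proof -
  have "R 1 ` closure S \<subseteq> closure (R 1 ` S)"
    by (intro image_closure_subset)
      (auto intro: bounded_linear.continuous_on[OF bounded_linear_R] closure_subset[THEN subsetD])
  hence "range (R 1) \<subseteq> closure (R 1 ` S)" using assms by simp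
  hence "closure (range (R 1)) \<subseteq> closure (R 1 ` S)" by (rule closure_minimal) simp
  thus ?thesis using dense_range by auto
qed

lemma dense_R1_R1: "closure (range (\<lambda>x. R 1 (R 1 x))) = UNIV"
  using closure_R1_image[OF dense_range] by (simp add: image_comp o_def)

end

section \<open>The weak formula and its representing operator\<close>

lemma nn_integral_reflect:
  fixes f :: "real \<Rightarrow> ennreal"
  assumes "f \<in> borel_measurable borel"
  shows "(\<integral>\<^sup>+ x. f (- x) \<partial>lborel) = (\<integral>\<^sup>+ x. f x \<partial>lborel)"
  using nn_integral_real_affine[OF assms, of "- 1" 0] by simp

text \<open>The half-line integral has the primitive arctan (x / a), and reflection gives the other
  half. That the bound is independent of \<open>a\<close> makes the later estimates uniform over all
  vertical lines.\<close>

lemma nn_integral_poisson_kernel: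
  assumes a: "0 < a"
  shows "(\<integral>\<^sup>+ x. ennreal (a / (a\<^sup>2 + x\<^sup>2)) \<partial>lborel) \<le> ennreal pi"
proof -
  let ?f = "\<lambda>x. a / (a\<^sup>2 + x\<^sup>2)" and ?g = "\<lambda>x. ennreal (a / (a\<^sup>2 + x\<^sup>2)) * indicator {0..} x"
  have pos: "a\<^sup>2 + x\<^sup>2 > 0" for x using a by (simp add: add_pos_nonneg)
  have half: "(\<integral>\<^sup>+ x. ?g x \<partial>lborel) = ennreal (pi / 2 - arctan (0 / a))"
  proof (rule nn_integral_FTC_atLeast)
    show "((\<lambda>x. arctan (x / a)) has_real_derivative ?f x) (at x)" for x
      using a pos[of x]
      by (auto intro!: derivative_eq_intros simp: field_simps power2_eq_square)
    have "LIM x at_top. x / a :> at_top"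
      using a by (simp add: filterlim_at_top_mult_tendsto_pos[OF tendsto_const] divide_inverse mult.commute
          filterlim_tendsto_pos_mult_at_top[OF tendsto_const] filterlim_ident)
    thus "((\<lambda>x. arctan (x / a)) \<longlongrightarrow> pi / 2) at_top"
      by (rule filterlim_compose[OF tendsto_arctan_at_top])
  qed (use a pos in \<open>auto simp: less_imp_le\<close>)
  have "(\<integral>\<^sup>+ x. ennreal (?f x) \<partial>lborel) \<le> (\<integral>\<^sup>+ x. ?g x + ?g (- x) \<partial>lborel)"
    by (intro nn_integral_mono) (auto simp: indicator_def)
  also have "\<dots> = (\<integral>\<^sup>+ x. ?g x \<partial>lborel) + (\<integral>\<^sup>+ x. ?g (- x) \<partial>lborel)"
    by (intro nn_integral_add) auto
  also have "(\<integral>\<^sup>+ x. ?g (- x) \<partial>lborel) = (\<integral>\<^sup>+ x. ?g x \<partial>lborel)"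
    by (rule nn_integral_reflect) auto
  also have "(\<integral>\<^sup>+ x. ?g x \<partial>lborel) + (\<integral>\<^sup>+ x. ?g x \<partial>lborel) = ennreal pi"
    unfolding half by (simp flip: ennreal_plus)
  finally show ?thesis .
qed

text \<open>Boundedness of the form makes representing vectors of a Cauchy sequence again Cauchy, so
  representability passes from a dense set to its closure. Boundedness alone would lead only into
  the bidual.\<close>

lemma weakly_represented_operator:
  fixes J :: "('a::complex_banach \<Rightarrow> complex) \<Rightarrow> 'a \<Rightarrow> complex"
  assumes diff: "\<And>\<phi> x y. \<phi> \<in> dual_space \<Longrightarrow> J \<phi> (x - y) = J \<phi> x - J \<phi> y"
    and scale: "\<And>\<phi> r x. \<phi> \<in> dual_space \<Longrightarrow> J \<phi> (r *\<^sub>R x) = r *\<^sub>R J \<phi> x"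
    and bound: "\<And>\<phi> x. \<phi> \<in> dual_space \<Longrightarrow> cmod (J \<phi> x) \<le> onorm \<phi> * (K * norm x)"
    and K: "0 \<le> K"
    and dense: "closure S = UNIV"
    and repr: "\<And>x. x \<in> S \<Longrightarrow> \<exists>v. \<forall>\<phi>\<in>dual_space. \<phi> v = J \<phi> x"
  shows "\<exists>T. bounded_linear T \<and> (\<forall>x. \<forall>\<phi>\<in>dual_space. \<phi> (T x) = J \<phi> x) \<and> onorm T \<le> 2 * K"
proof -
  have "\<exists>v. \<forall>\<phi>\<in>dual_space. \<phi> v = J \<phi> x" for x
  proof -
    obtain s where s: "\<And>k. s k \<in> S" "s \<longlonglongrightarrow> x"
      using dense by (metis UNIV_I closure_sequential)
    obtain v where v: "\<And>k \<phi>. \<phi> \<in> dual_space \<Longrightarrow> \<phi> (v k) = J \<phi> (s k)"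
      using repr[OF s(1)] by metis
    have dv: "norm (v k - v l) \<le> 2 * (K * norm (s k - s l))" for k l
      using v bound[of _ "s k - s l"] K by (intro norm_le_by_dual) (auto simp: dual_diff diff)
    have "Cauchy v"
    proof (rule metric_CauchyI)
      fix e :: real assume e: "e > 0"
      have "Cauchy s" using s(2) by (rule LIMSEQ_imp_Cauchy)
      \<comment> \<open>The summand 1 in \<open>2 * K + 1\<close> excludes division by zero.\<close>
      then obtain M where M: "\<And>m n. m \<ge> M \<Longrightarrow> n \<ge> M \<Longrightarrow> norm (s m - s n) < e / (2 * K + 1)"
        using e K unfolding Cauchy_def dist_norm
        by (metis add_nonneg_pos divide_pos_pos mult_nonneg_nonneg zero_le_numeral zero_less_one)
      have "norm (v m - v n) < e" if "m \<ge> M" "n \<ge> M" for m n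
      proof -
        have "2 * (K * norm (s m - s n)) \<le> (2 * K + 1) * norm (s m - s n)" by (simp add: algebra_simps)
        also have "\<dots> < e" using M[OF that] K by (simp add: field_simps)
        finally show ?thesis using dv[of m n] by simp
      qed
      thus "\<exists>M. \<forall>m\<ge>M. \<forall>n\<ge>M. dist (v m) (v n) < e" by (auto simp: dist_norm)
    qed
    then obtain w where w: "v \<longlonglongrightarrow> w" using Cauchy_convergent convergent_def by blast
    have "\<phi> w = J \<phi> x" if \<phi>: "\<phi> \<in> dual_space" for \<phi>
    proof (rule LIMSEQ_unique)
      show "(\<lambda>k. \<phi> (v k)) \<longlonglongrightarrow> \<phi> w"
        by (rule bounded_linear.tendsto[OF dual_bounded_linear[OF \<phi>] w])
      have "(\<lambda>k. \<phi> (v k) - J \<phi> x) \<longlonglongrightarrow> 0"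
      proof (rule Lim_null_comparison)
        show "\<forall>\<^sub>F k in sequentially. cmod (\<phi> (v k) - J \<phi> x) \<le> onorm \<phi> * (K * norm (s k - x))"
          using bound[OF \<phi>] by (simp add: v[OF \<phi>] diff[OF \<phi>, symmetric])
        have "(\<lambda>k. onorm \<phi> * (K * norm (s k - x))) \<longlonglongrightarrow> onorm \<phi> * (K * norm (x - x))"
          by (intro tendsto_intros s(2))
        thus "(\<lambda>k. onorm \<phi> * (K * norm (s k - x))) \<longlonglongrightarrow> 0" by simp
      qed
      thus "(\<lambda>k. \<phi> (v k)) \<longlonglongrightarrow> J \<phi> x" by (simp add: LIM_zero_iff)
    qed
    thus ?thesis by blast
  qed
  then obtain T where T: "\<And>x \<phi>. \<phi> \<in> dual_space \<Longrightarrow> \<phi> (T x) = J \<phi> x" by metis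
  have nT: "norm (T x) \<le> 2 * (K * norm x)" for x
    using T bound K by (intro norm_le_by_dual) auto
  have d: "T (x - y) = T x - T y" for x y
    by (rule dual_separates) (simp add: T dual_diff diff)
  have sc: "T (r *\<^sub>R x) = r *\<^sub>R T x" for r x
    by (rule dual_separates) (simp add: T dual_scaleR scale)
  have "T (x + y) = T x + T y" for x y
    using d[of x "- y"] sc[of "- 1" y] by simp
  hence "bounded_linear T" using sc nT
    by (intro bounded_linear_intro[of T "2 * K"]) (auto simp: mult_ac)
  moreover have "onorm T \<le> 2 * K" using nT K by (intro onorm_bound) (auto simp: mult.assoc)
  ultimately show ?thesis using T by blast
qed

section \<open>Suprema of the derivative on vertical lines\<close>

definition deriv_sup :: "(complex \<Rightarrow> complex) \<Rightarrow> real \<Rightarrow> ennreal" where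
  "deriv_sup f \<alpha> = (SUP \<beta>. ennreal (cmod (deriv f (Complex \<alpha> \<beta>))))"

abbreviation (input) B0_norm :: "(complex \<Rightarrow> complex) \<Rightarrow> ennreal" where
  "B0_norm f \<equiv> \<integral>\<^sup>+ \<alpha>. indicator {0<..} \<alpha> * deriv_sup f \<alpha> \<partial>lborel"

text \<open>The weight is the product of the factor \<alpha> in the weak formula and the factor 1 /
  (\<alpha> + 1) from the integral condition. It is what makes dilated functions small.\<close>

abbreviation (input) weighted_B0_norm :: "(complex \<Rightarrow> complex) \<Rightarrow> ennreal" where
  "weighted_B0_norm f \<equiv> \<integral>\<^sup>+ \<alpha>. ennreal (\<alpha> / (\<alpha> + 1)) * (indicator {0<..} \<alpha> * deriv_sup f \<alpha>) \<partial>lborel"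

lemma deriv_sup_upper: "ennreal (cmod (deriv f (Complex \<alpha> \<beta>))) \<le> deriv_sup f \<alpha>"
  unfolding deriv_sup_def by (rule SUP_upper) simp

lemma continuous_on_deriv_rhp: "f holomorphic_on rhp \<Longrightarrow> continuous_on rhp (deriv f)"
  by (intro holomorphic_on_imp_continuous_on holomorphic_deriv open_rhp)

text \<open>By continuity in \<beta> the supremum over the line equals the supremum over rational
  \<beta>, which is countable.\<close>

lemma measurable_deriv_sup:
  assumes f: "f holomorphic_on rhp"
  shows "(\<lambda>\<alpha>. indicator {0<..} \<alpha> * deriv_sup f \<alpha>) \<in> borel_measurable borel"
proof -
  have eq: "indicator {0<..} \<alpha> * deriv_sup f \<alpha> =
      (SUP \<beta>\<in>\<rat>. ennreal (cmod (indicator {0<..} \<alpha> *\<^sub>R deriv f (Complex \<alpha> \<beta>))))" for \<alpha>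
  proof (cases "\<alpha> > 0")
    case True
    let ?c = "SUP \<beta>\<in>\<rat>. ennreal (cmod (deriv f (Complex \<alpha> \<beta>)))"
    have cont: "continuous_on UNIV (\<lambda>\<beta>. ennreal (cmod (deriv f (Complex \<alpha> \<beta>))))"
      by (intro continuous_on_ennreal continuous_on_norm
          continuous_on_compose2[OF continuous_on_deriv_rhp[OF f]])
        (auto intro!: continuous_intros simp: rhp_def True Complex_eq)
    have "closure \<rat> \<subseteq> {\<beta>. ennreal (cmod (deriv f (Complex \<alpha> \<beta>))) \<le> ?c}"
      by (intro closure_minimal closed_Collect_le cont continuous_on_const) (auto intro: SUP_upper)
    hence "deriv_sup f \<alpha> \<le> ?c"
      unfolding deriv_sup_def Rats_closure_real by (intro SUP_least) auto
    moreover have "?c \<le> deriv_sup f \<alpha>" by (intro SUP_least deriv_sup_upper)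
    ultimately show ?thesis using True by simp
  qed (simp add: Rats_def)
  have m: "(\<lambda>\<alpha>. indicator {0<..} \<alpha> *\<^sub>R deriv f (Complex \<alpha> \<beta>)) \<in> borel_measurable borel" for \<beta>
    by (rule borel_measurable_continuous_on_indicator)
      (auto intro!: continuous_on_compose2[OF continuous_on_deriv_rhp[OF f]] continuous_intros
        simp: rhp_def Complex_eq)
  show ?thesis unfolding eq
    by (intro borel_measurable_SUP countable_rat
        measurable_compose[OF measurable_compose[OF m borel_measurable_norm] measurable_ennreal])
qed

context gsf_family
begin

text \<open>The integrand of the iterated integral as one function on the plane, extended by zero,
  so that Tonelli and Fubini apply to the product measure.\<close>

definition B_kernel :: "(complex \<Rightarrow> complex) \<Rightarrow> ('a \<Rightarrow> complex) \<Rightarrow> 'a \<Rightarrow> real \<times> real \<Rightarrow> complex" where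
  "B_kernel f \<phi> x = (\<lambda>p. indicator ({0<..} \<times> UNIV) p *\<^sub>R (of_real (fst p) *
     (\<phi> (RR (Complex (fst p) (- snd p)) x) * deriv f (Complex (fst p) (snd p)))))"

lemma continuous_on_R_R_pair:
  "continuous_on ({0<..} \<times> UNIV) (\<lambda>p. RR (Complex (fst p) (- snd p)) x)"
  by (rule continuous_on_compose2[OF continuous_on_R_R])
    (auto intro!: continuous_intros simp: rhp_def Complex_eq)

lemma continuous_on_deriv_pair:
  "f holomorphic_on rhp \<Longrightarrow> continuous_on ({0<..} \<times> UNIV) (\<lambda>p. deriv f (Complex (fst p) (snd p)))"
  by (rule continuous_on_compose2[OF continuous_on_deriv_rhp])
    (auto intro!: continuous_intros simp: rhp_def Complex_eq)

lemma measurable_B_kernel: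
  assumes "f holomorphic_on rhp" "\<phi> \<in> dual_space"
  shows "B_kernel f \<phi> x \<in> borel_measurable borel"
  unfolding B_kernel_def
proof (rule borel_measurable_continuous_on_indicator)
  show "{0<..} \<times> UNIV \<in> sets (borel :: (real \<times> real) measure)"
    by (intro borel_open open_Times) auto
  show "continuous_on ({0<..} \<times> UNIV) (\<lambda>p. complex_of_real (fst p) *
     (\<phi> (RR (Complex (fst p) (- snd p)) x) * deriv f (Complex (fst p) (snd p))))"
    by (intro continuous_intros continuous_on_deriv_pair assms
        bounded_linear.continuous_on[OF dual_bounded_linear] continuous_on_R_R_pair)
qed

text \<open>In the inner integral f' is replaced by its supremum on the line. What remains is the
  integral condition after the reflection \<beta> to -\<beta>, because the resolvent is taken at
  \<alpha> - i \<beta>.\<close>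

lemma nn_integral_B_kernel:
  assumes f: "f holomorphic_on rhp" and \<phi>: "\<phi> \<in> dual_space"
    and W: "weighted_B0_norm f \<le> ennreal W"
    and W0: "0 \<le> W"
  shows "(\<integral>\<^sup>+ p. ennreal (cmod (B_kernel f \<phi> x p)) \<partial>lborel) \<le> ennreal (onorm \<phi> * (C * W * norm x))"
proof -
  define c where "c = C * onorm \<phi> * norm x"
  have c: "c \<ge> 0" using C_nonneg dual_onorm_nonneg[OF \<phi>] by (simp add: c_def)
  have inner: "(\<integral>\<^sup>+ \<beta>. ennreal (cmod (B_kernel f \<phi> x (\<alpha>, \<beta>))) \<partial>lborel)
      \<le> ennreal c * (ennreal (\<alpha> / (\<alpha> + 1)) * (indicator {0<..} \<alpha> * deriv_sup f \<alpha>))" for \<alpha>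
  proof (cases "\<alpha> > 0")
    case True
    let ?g = "\<lambda>\<beta>. ennreal (cmod (\<phi> (RR (Complex \<alpha> \<beta>) x)))"
    have gm: "?g \<in> borel_measurable borel"
      by (rule measurable_compose[OF measurable_compose[OF measurable_R_R_line[OF True \<phi>]
              borel_measurable_norm] measurable_ennreal])
    have gr: "(\<lambda>\<beta>. ?g (- \<beta>)) \<in> borel_measurable lborel"
      by (rule measurable_compose[OF _ gm]) simp
    have "(\<integral>\<^sup>+ \<beta>. ennreal (cmod (B_kernel f \<phi> x (\<alpha>, \<beta>))) \<partial>lborel)
      \<le> (\<integral>\<^sup>+ \<beta>. (ennreal \<alpha> * deriv_sup f \<alpha>) * ?g (- \<beta>) \<partial>lborel)"
    proof (rule nn_integral_mono)
      fix \<beta> :: real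
      have "ennreal (cmod (B_kernel f \<phi> x (\<alpha>, \<beta>)))
          = (ennreal \<alpha> * ennreal (cmod (deriv f (Complex \<alpha> \<beta>)))) * ?g (- \<beta>)"
        using True by (simp add: B_kernel_def norm_mult ennreal_mult mult_ac)
      also have "\<dots> \<le> (ennreal \<alpha> * deriv_sup f \<alpha>) * ?g (- \<beta>)"
        by (intro mult_right_mono mult_left_mono deriv_sup_upper) auto
      finally show "ennreal (cmod (B_kernel f \<phi> x (\<alpha>, \<beta>))) \<le> (ennreal \<alpha> * deriv_sup f \<alpha>) * ?g (- \<beta>)" .
    qed
    also have "\<dots> = (ennreal \<alpha> * deriv_sup f \<alpha>) * (\<integral>\<^sup>+ \<beta>. ?g (- \<beta>) \<partial>lborel)"
      by (rule nn_integral_cmult[OF gr])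
    also have "(\<integral>\<^sup>+ \<beta>. ?g (- \<beta>) \<partial>lborel) = (\<integral>\<^sup>+ \<beta>. ?g \<beta> \<partial>lborel)"
      by (rule nn_integral_reflect[OF gm])
    also have "\<dots> \<le> ennreal (c / (\<alpha> + 1))"
      unfolding c_def by (rule gsf[OF True \<phi>])
    also have "(ennreal \<alpha> * deriv_sup f \<alpha>) * ennreal (c / (\<alpha> + 1))
      = (ennreal \<alpha> * ennreal (c / (\<alpha> + 1))) * deriv_sup f \<alpha>" by (simp only: mult_ac)
    also have "ennreal \<alpha> * ennreal (c / (\<alpha> + 1)) = ennreal c * ennreal (\<alpha> / (\<alpha> + 1))"
      using True c by (simp flip: ennreal_mult)
    finally show ?thesis using True by (simp add: mult.assoc mult_left_mono)
  qed (simp add: B_kernel_def)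
  have md: "(\<lambda>\<alpha>. indicator {0<..} \<alpha> * deriv_sup f \<alpha>) \<in> borel_measurable lborel"
    using measurable_deriv_sup[OF f] by simp
  have [measurable]: "B_kernel f \<phi> x \<in> borel_measurable (lborel \<Otimes>\<^sub>M lborel)"
    using measurable_B_kernel[OF f \<phi>] by (simp add: lborel_prod)
  have "(\<integral>\<^sup>+ p. ennreal (cmod (B_kernel f \<phi> x p)) \<partial>lborel)
    = (\<integral>\<^sup>+ p. ennreal (cmod (B_kernel f \<phi> x p)) \<partial>(lborel \<Otimes>\<^sub>M lborel))" by (simp add: lborel_prod)
  also have "\<dots> = (\<integral>\<^sup>+ \<alpha>. \<integral>\<^sup>+ \<beta>. ennreal (cmod (B_kernel f \<phi> x (\<alpha>, \<beta>))) \<partial>lborel \<partial>lborel)"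
    by (rule lborel.nn_integral_fst[symmetric]) measurable
  also have "\<dots> \<le> (\<integral>\<^sup>+ \<alpha>. ennreal c * (ennreal (\<alpha> / (\<alpha> + 1)) * (indicator {0<..} \<alpha> * deriv_sup f \<alpha>)) \<partial>lborel)"
    by (intro nn_integral_mono inner)
  also have "\<dots> = ennreal c * (weighted_B0_norm f)"
    by (rule nn_integral_cmult[OF borel_measurable_times_ennreal[OF _ md]]) simp
  also have "\<dots> \<le> ennreal c * ennreal W" by (intro mult_left_mono W) simp
  also have "\<dots> = ennreal (onorm \<phi> * (C * W * norm x))"
    using c W0 by (simp add: c_def mult_ac flip: ennreal_mult)
  finally show ?thesis .
qed

definition B_form :: "(complex \<Rightarrow> complex) \<Rightarrow> ('a \<Rightarrow> complex) \<Rightarrow> 'a \<Rightarrow> complex" where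
  "B_form f \<phi> x = (LINT \<alpha>:{0<..}|lborel. of_real \<alpha> *
     (LINT \<beta>|lborel. \<phi> (RR (Complex \<alpha> (- \<beta>)) x) * deriv f (Complex \<alpha> \<beta>)))"

lemma B_form_eq_kernel:
  assumes "integrable lborel (B_kernel f \<phi> x)"
  shows "B_form f \<phi> x = (LINT p|lborel. B_kernel f \<phi> x p)"
proof -
  have i: "integrable (lborel \<Otimes>\<^sub>M lborel) (B_kernel f \<phi> x)" using assms by (simp add: lborel_prod)
  have "(LINT p|lborel. B_kernel f \<phi> x p) = (LINT \<alpha>|lborel. LINT \<beta>|lborel. B_kernel f \<phi> x (\<alpha>, \<beta>))"
    using lborel_pair.integral_fst'[OF i] by (simp add: lborel_prod)
  also have "\<dots> = B_form f \<phi> x"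
    unfolding B_form_def set_lebesgue_integral_def B_kernel_def
    by (intro Bochner_Integration.integral_cong refl) (simp add: indicator_def)
  finally show ?thesis by simp
qed

text \<open>This is the kernel with the functional replaced by the norm. Quadratic decay and the
  factor \<alpha> give \<alpha> / (\<alpha>^2 + \<beta>^2), whose mass is bounded independently of
  \<alpha>, so integrability of the supremum of |f'| is enough.\<close>

lemma B_kernel_dominated:
  assumes f: "f holomorphic_on rhp" and fin: "B0_norm f < \<infinity>"
  shows "integrable lborel (\<lambda>p. indicator ({0<..} \<times> UNIV) p *\<^sub>R (fst p *
     (norm (RR (Complex (fst p) (- snd p)) (R 1 (R 1 y))) *
       cmod (deriv f (Complex (fst p) (snd p))))))" (is "integrable lborel ?M")
proof (rule integrableI_bounded)
  have "?M \<in> borel_measurable borel"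
  proof (rule borel_measurable_continuous_on_indicator)
    show "{0<..} \<times> UNIV \<in> sets (borel :: (real \<times> real) measure)"
      by (intro borel_open open_Times) auto
  qed (intro continuous_intros continuous_on_deriv_pair f continuous_on_R_R_pair)
  thus m: "?M \<in> borel_measurable lborel" by simp
  obtain K where K: "K \<ge> 0"
    "\<And>z x. 0 < Re z \<Longrightarrow> norm (R z (R z (R 1 (R 1 x)))) \<le> K / (1 + cmod z)\<^sup>2 * norm x"
    using R_R_R1_R1_decay by blast
  define c where "c = K * norm y"
  have c: "c \<ge> 0" using K by (simp add: c_def)
  have inner: "(\<integral>\<^sup>+ \<beta>. ennreal (norm (?M (\<alpha>, \<beta>))) \<partial>lborel)
     \<le> ennreal (c * pi) * (indicator {0<..} \<alpha> * deriv_sup f \<alpha>)" for \<alpha>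
  proof (cases "\<alpha> > 0")
    case True
    have "(\<integral>\<^sup>+ \<beta>. ennreal (norm (?M (\<alpha>, \<beta>))) \<partial>lborel)
      \<le> (\<integral>\<^sup>+ \<beta>. (ennreal c * deriv_sup f \<alpha>) * ennreal (\<alpha> / (\<alpha>\<^sup>2 + \<beta>\<^sup>2)) \<partial>lborel)"
    proof (rule nn_integral_mono)
      fix \<beta> :: real
      let ?z = "Complex \<alpha> (- \<beta>)"
      have sq: "\<alpha>\<^sup>2 + \<beta>\<^sup>2 \<le> (1 + cmod ?z)\<^sup>2"
      proof -
        have "\<alpha>\<^sup>2 + \<beta>\<^sup>2 = (cmod ?z)\<^sup>2" by (simp add: cmod_def)
        also have "\<dots> \<le> (1 + cmod ?z)\<^sup>2" by (intro power_mono) auto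
        finally show ?thesis .
      qed
      have "norm (R ?z (R ?z (R 1 (R 1 y)))) \<le> c / (1 + cmod ?z)\<^sup>2"
        using K(2)[of ?z y] True by (simp add: c_def)
      also have "\<dots> \<le> c / (\<alpha>\<^sup>2 + \<beta>\<^sup>2)"
        using sq c True by (intro divide_left_mono mult_pos_pos zero_less_power add_pos_nonneg) auto
      finally have "\<alpha> * norm (R ?z (R ?z (R 1 (R 1 y)))) \<le> \<alpha> * (c / (\<alpha>\<^sup>2 + \<beta>\<^sup>2))"
        using True by (intro mult_left_mono) auto
      also have "\<dots> = c * (\<alpha> / (\<alpha>\<^sup>2 + \<beta>\<^sup>2))" by simp
      finally have le: "\<alpha> * norm (R ?z (R ?z (R 1 (R 1 y)))) \<le> c * (\<alpha> / (\<alpha>\<^sup>2 + \<beta>\<^sup>2))" .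
      have "ennreal (\<alpha> * norm (R ?z (R ?z (R 1 (R 1 y))))) * ennreal (cmod (deriv f (Complex \<alpha> \<beta>)))
          \<le> ennreal (c * (\<alpha> / (\<alpha>\<^sup>2 + \<beta>\<^sup>2))) * deriv_sup f \<alpha>"
        by (rule mult_mono[OF ennreal_leI[OF le] deriv_sup_upper]) auto
      moreover have "ennreal (norm (?M (\<alpha>, \<beta>)))
          = ennreal (\<alpha> * norm (R ?z (R ?z (R 1 (R 1 y))))) * ennreal (cmod (deriv f (Complex \<alpha> \<beta>)))"
        using True by (simp add: ennreal_mult mult_ac)
      moreover have "ennreal (c * (\<alpha> / (\<alpha>\<^sup>2 + \<beta>\<^sup>2))) = ennreal c * ennreal (\<alpha> / (\<alpha>\<^sup>2 + \<beta>\<^sup>2))"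
        using c True by (intro ennreal_mult) auto
      ultimately show "ennreal (norm (?M (\<alpha>, \<beta>)))
          \<le> (ennreal c * deriv_sup f \<alpha>) * ennreal (\<alpha> / (\<alpha>\<^sup>2 + \<beta>\<^sup>2))"
        by (simp only: mult_ac)
    qed
    also have "\<dots> = (ennreal c * deriv_sup f \<alpha>) * (\<integral>\<^sup>+ \<beta>. ennreal (\<alpha> / (\<alpha>\<^sup>2 + \<beta>\<^sup>2)) \<partial>lborel)"
      by (rule nn_integral_cmult) simp
    also have "\<dots> \<le> (ennreal c * deriv_sup f \<alpha>) * ennreal pi"
      by (intro mult_left_mono nn_integral_poisson_kernel True) simp
    also have "\<dots> = ennreal (c * pi) * deriv_sup f \<alpha>"
      using c by (simp add: ennreal_mult mult_ac)
    finally show ?thesis using True by simp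
  qed simp
  have m': "?M \<in> borel_measurable (lborel \<Otimes>\<^sub>M lborel)" using m by (simp add: lborel_prod)
  have "(\<integral>\<^sup>+ p. ennreal (norm (?M p)) \<partial>lborel) = (\<integral>\<^sup>+ p. ennreal (norm (?M p)) \<partial>(lborel \<Otimes>\<^sub>M lborel))"
    by (simp only: lborel_prod)
  also have "\<dots> = (\<integral>\<^sup>+ \<alpha>. \<integral>\<^sup>+ \<beta>. ennreal (norm (?M (\<alpha>, \<beta>))) \<partial>lborel \<partial>lborel)"
    by (rule lborel.nn_integral_fst[symmetric,
          OF measurable_compose[OF measurable_compose[OF m' borel_measurable_norm] measurable_ennreal]])
  also have "\<dots> \<le> (\<integral>\<^sup>+ \<alpha>. ennreal (c * pi) * (indicator {0<..} \<alpha> * deriv_sup f \<alpha>) \<partial>lborel)"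
    by (intro nn_integral_mono inner)
  also have "\<dots> = ennreal (c * pi) * (B0_norm f)"
    using measurable_deriv_sup[OF f] by (intro nn_integral_cmult) simp
  also have "\<dots> < \<infinity>" using fin by (simp add: ennreal_mult_less_top)
  finally show "(\<integral>\<^sup>+ p. ennreal (norm (?M p)) \<partial>lborel) < \<infinity>" .
qed

end

context gsf_family
begin

text \<open>On the dense range of \<open>(1 + A)\<^sup>-\<^sup>2\<close> the kernel is dominated uniformly in \<open>\<phi>\<close>, so
  vector-valued integrals over growing boxes converge in norm. They are gauge integrals because the
  Bochner integral of the library needs a separable range.\<close>

lemma B_form_represented_on_core:
  assumes f: "f holomorphic_on rhp" and fin: "B0_norm f < \<infinity>"
    and int: "\<And>\<phi>. \<phi> \<in> dual_space \<Longrightarrow> integrable lborel (B_kernel f \<phi> (R 1 (R 1 y)))"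
  shows "\<exists>v. \<forall>\<phi>\<in>dual_space. \<phi> v = B_form f \<phi> (R 1 (R 1 y))"
proof -
  define x where "x = R 1 (R 1 y)"
  \<comment> \<open>Compact boxes inside the open half-plane that exhaust it; the left edge tends to
    0, and \<open>Suc n\<close> keeps it defined for n = 0.\<close>
  define Q where "Q n = cbox (1 / real (Suc n), - real (Suc n)) (real (Suc n), real (Suc n))" for n
  define H where "H p = cscale (of_real (fst p) * deriv f (Complex (fst p) (snd p)))
     (RR (Complex (fst p) (- snd p)) x)" for p :: "real \<times> real"
  define M where "M p = indicator ({0<..} \<times> UNIV) p *\<^sub>R (fst p *
     (norm (RR (Complex (fst p) (- snd p)) x) *
       cmod (deriv f (Complex (fst p) (snd p)))))" for p :: "real \<times> real"
  have M: "integrable lborel M"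
    unfolding M_def x_def by (rule B_kernel_dominated[OF f fin])
  have QS: "Q n \<subseteq> {0<..} \<times> UNIV" for n
    by (auto simp: Q_def cbox_Pair_eq) (smt (verit) divide_pos_pos of_nat_0_le_iff)
  have Qm: "Q n \<in> sets lborel" for n by (simp add: Q_def)
  have "continuous_on ({0<..} \<times> UNIV) H"
    unfolding H_def
    by (intro cscale.continuous_on continuous_intros continuous_on_deriv_pair f continuous_on_R_R_pair)
  hence Hint: "H integrable_on Q n" for n
    unfolding Q_def by (intro integrable_continuous) (use QS[of n] in \<open>auto simp: Q_def intro: continuous_on_subset\<close>)
  define V where "V n = integral (Q n) H" for n
  \<comment> \<open>The mass of the dominating function outside the box; it will bound the error up
    to the factor \<open>onorm \<phi>\<close>.\<close>
  define \<epsilon> where "\<epsilon> n = (LINT p|lborel. indicator (- Q n) p * M p)" for n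
  have M0: "M p \<ge> 0" for p by (auto simp: M_def indicator_def)
  have ev: "\<forall>\<^sub>F n in sequentially. p \<in> Q n" if p: "p \<in> {0<..} \<times> UNIV" for p :: "real \<times> real"
  proof -
    have pos: "fst p > 0" using p by auto
    obtain N :: nat where N: "real N \<ge> max (fst p) (max \<bar>snd p\<bar> (1 / fst p))"
      using real_arch_simple by blast
    have "p \<in> Q n" if "n \<ge> N" for n
    proof -
      have n: "real (Suc n) \<ge> max (fst p) (max \<bar>snd p\<bar> (1 / fst p))" using N that by linarith
      hence "1 / fst p \<le> real (Suc n)" by simp
      hence "1 / real (Suc n) \<le> fst p" using pos by (simp add: field_simps)
      thus ?thesis using n by (cases p) (auto simp: Q_def cbox_Pair_eq)
    qed
    thus ?thesis by (auto simp: eventually_sequentially)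
  qed
  have eps: "\<epsilon> \<longlonglongrightarrow> 0"
  proof -
    have "\<epsilon> \<longlonglongrightarrow> (LINT p::real \<times> real|lborel. (0::real))"
      unfolding \<epsilon>_def
    proof (rule integral_dominated_convergence[where w = M])
      show "AE p in lborel. (\<lambda>n. indicator (- Q n) p * M p) \<longlonglongrightarrow> 0"
      proof (rule AE_I2)
        fix p :: "real \<times> real"
        show "(\<lambda>n. indicator (- Q n) p * M p) \<longlonglongrightarrow> 0"
        proof (cases "p \<in> {0<..} \<times> UNIV")
          case True
          have "\<forall>\<^sub>F n in sequentially. indicator (- Q n) p * M p = 0"
            using ev[OF True] by eventually_elim (simp add: indicator_def)
          thus ?thesis by (rule tendsto_eventually)
        qed (simp add: M_def)
      qed
      show "AE p in lborel. norm (indicator (- Q n) p * M p) \<le> M p" for n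
        using M0 by (intro AE_I2) (auto simp: indicator_def)
      show "(\<lambda>p. indicator (- Q n) p * M p) \<in> borel_measurable lborel" for n
        using M Qm[of n] by (intro borel_measurable_times borel_measurable_indicator) auto
    qed (use M in auto)
    thus ?thesis by simp
  qed
  have eps0: "\<epsilon> n \<ge> 0" for n
    unfolding \<epsilon>_def using M0 by (intro Bochner_Integration.integral_nonneg) auto
  have approx: "cmod (\<phi> (V n) - B_form f \<phi> x) \<le> onorm \<phi> * \<epsilon> n" if \<phi>: "\<phi> \<in> dual_space" for \<phi> n
  proof -
    let ?k = "B_kernel f \<phi> x"
    have ki: "integrable lborel ?k" unfolding x_def by (rule int[OF \<phi>])
    have kH: "?k p = \<phi> (H p)" if "p \<in> Q n" for p
      using QS[of n] that \<phi> by (auto simp: B_kernel_def H_def dual_cscale mult_ac)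
    have si: "set_integrable lborel (Q n) ?k"
      unfolding set_integrable_def using ki Qm by (intro integrable_mult_indicator)
    have "\<phi> (V n) = integral (Q n) (\<phi> \<circ> H)"
      unfolding V_def by (rule integral_linear[OF Hint dual_bounded_linear[OF \<phi>], symmetric])
    also have "\<dots> = integral (Q n) ?k"
      by (intro Henstock_Kurzweil_Integration.integral_cong) (simp add: kH)
    also have "\<dots> = (LINT p:Q n|lborel. ?k p)"
      by (rule set_borel_integral_eq_integral(2)[OF si, symmetric])
    finally have "\<phi> (V n) - B_form f \<phi> x = (LINT p|lborel. indicator (Q n) p *\<^sub>R ?k p - ?k p)"
      using si ki unfolding set_integrable_def
      by (simp add: set_lebesgue_integral_def B_form_eq_kernel[OF ki])
    also have "cmod \<dots> \<le> (LINT p|lborel. cmod (indicator (Q n) p *\<^sub>R ?k p - ?k p))"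
      by (rule integral_norm_bound)
    also have "\<dots> \<le> (LINT p|lborel. onorm \<phi> * (indicator (- Q n) p * M p))"
    proof (rule integral_mono)
      show "integrable lborel (\<lambda>p. cmod (indicator (Q n) p *\<^sub>R ?k p - ?k p))"
        using si ki unfolding set_integrable_def by auto
      show "integrable lborel (\<lambda>p. onorm \<phi> * (indicator (- Q n) p * M p))"
        using integrable_mult_indicator[OF _ M, of "- Q n"] Qm[of n] by auto
      show "cmod (indicator (Q n) p *\<^sub>R ?k p - ?k p) \<le> onorm \<phi> * (indicator (- Q n) p * M p)" for p
      proof (cases "p \<in> {0<..} \<times> UNIV - Q n")
        case True
        let ?v = "RR (Complex (fst p) (- snd p)) x"
        have "cmod (?k p) = fst p * cmod (deriv f (Complex (fst p) (snd p))) * cmod (\<phi> ?v)"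
          using True by (auto simp: B_kernel_def norm_mult)
        also have "\<dots> \<le> fst p * cmod (deriv f (Complex (fst p) (snd p))) * (onorm \<phi> * norm ?v)"
          using True by (intro mult_left_mono dual_bound \<phi>) auto
        also have "\<dots> = onorm \<phi> * M p" using True by (auto simp: M_def mult_ac)
        finally show ?thesis using True by simp
      next
        case False
        hence "p \<in> Q n \<or> p \<notin> {0<..} \<times> UNIV" by auto
        thus ?thesis by (auto simp: B_kernel_def M_def indicator_def)
      qed
    qed
    also have "\<dots> = onorm \<phi> * \<epsilon> n" by (simp add: \<epsilon>_def)
    finally show ?thesis .
  qed
  have dV: "norm (V m - V n) \<le> 2 * (\<epsilon> m + \<epsilon> n)" for m n
  proof (rule norm_le_by_dual)
    fix \<phi> :: "'a \<Rightarrow> complex" assume \<phi>: "\<phi> \<in> dual_space"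
    have "cmod (\<phi> (V m - V n)) = cmod ((\<phi> (V m) - B_form f \<phi> x) - (\<phi> (V n) - B_form f \<phi> x))"
      by (simp add: dual_diff[OF \<phi>])
    also have "\<dots> \<le> cmod (\<phi> (V m) - B_form f \<phi> x) + cmod (\<phi> (V n) - B_form f \<phi> x)"
      by (rule norm_triangle_ineq4)
    also have "\<dots> \<le> onorm \<phi> * \<epsilon> m + onorm \<phi> * \<epsilon> n" by (intro add_mono approx \<phi>)
    finally show "cmod (\<phi> (V m - V n)) \<le> onorm \<phi> * (\<epsilon> m + \<epsilon> n)" by (simp add: distrib_left)
  qed (simp add: eps0)
  have "Cauchy V"
  proof (rule metric_CauchyI)
    fix e :: real assume e: "e > 0"
    have "\<forall>\<^sub>F n in sequentially. \<epsilon> n < e / 4" using eps e by (intro order_tendstoD) auto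
    then obtain N where N: "\<And>n. n \<ge> N \<Longrightarrow> \<epsilon> n < e / 4" by (auto simp: eventually_sequentially)
    have "dist (V m) (V n) < e" if "m \<ge> N" "n \<ge> N" for m n
      using dV[of m n] N[OF that(1)] N[OF that(2)] by (simp add: dist_norm)
    thus "\<exists>M. \<forall>m\<ge>M. \<forall>n\<ge>M. dist (V m) (V n) < e" by blast
  qed
  then obtain v where v: "V \<longlonglongrightarrow> v" using Cauchy_convergent convergent_def by blast
  have "\<phi> v = B_form f \<phi> x" if \<phi>: "\<phi> \<in> dual_space" for \<phi>
  proof (rule LIMSEQ_unique)
    show "(\<lambda>n. \<phi> (V n)) \<longlonglongrightarrow> \<phi> v"
      by (rule bounded_linear.tendsto[OF dual_bounded_linear[OF \<phi>] v])
    have "(\<lambda>n. \<phi> (V n) - B_form f \<phi> x) \<longlonglongrightarrow> 0"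
    proof (rule Lim_null_comparison)
      show "\<forall>\<^sub>F n in sequentially. cmod (\<phi> (V n) - B_form f \<phi> x) \<le> onorm \<phi> * \<epsilon> n"
        using approx[OF \<phi>] by simp
      show "(\<lambda>n. onorm \<phi> * \<epsilon> n) \<longlonglongrightarrow> 0" using tendsto_mult_right_zero[OF eps] by simp
    qed
    thus "(\<lambda>n. \<phi> (V n)) \<longlonglongrightarrow> B_form f \<phi> x" by (simp add: LIM_zero_iff)
  qed
  thus ?thesis unfolding x_def by blast
qed

text \<open>The weighted norm controls the size of the operator, while finiteness of the unweighted
  norm yields the representation on the core.\<close>

lemma B_form_operator:
  assumes f: "f holomorphic_on rhp" and fin: "B0_norm f < \<infinity>"
    and W: "weighted_B0_norm f \<le> ennreal W"
    and W0: "0 \<le> W"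
  shows "\<exists>T. bounded_linear T \<and> (\<forall>x. \<forall>\<phi>\<in>dual_space. \<phi> (T x) = B_form f \<phi> x) \<and> onorm T \<le> 2 * (C * W)"
proof (rule weakly_represented_operator[where S = "range (\<lambda>x. R 1 (R 1 x))"])
  note bd = integral_bound_of_nn_integral[OF _ nn_integral_B_kernel[OF f _ W W0]]
  have nn: "0 \<le> onorm \<phi> * (C * W * norm x)" if "\<phi> \<in> dual_space" for \<phi> and x :: 'a
    using that C_nonneg W0 by (intro mult_nonneg_nonneg dual_onorm_nonneg) auto
  have m: "B_kernel f \<phi> x \<in> borel_measurable lborel" if "\<phi> \<in> dual_space" for \<phi> x
    using measurable_B_kernel[OF f that] by simp
  have int: "integrable lborel (B_kernel f \<phi> x)" if "\<phi> \<in> dual_space" for \<phi> x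
    using that by (intro bd(1) m nn)
  show "B_form f \<phi> (x - y) = B_form f \<phi> x - B_form f \<phi> y" if \<phi>: "\<phi> \<in> dual_space" for \<phi> x y
  proof -
    have "B_kernel f \<phi> (x - y) p = B_kernel f \<phi> x p - B_kernel f \<phi> y p" for p
      using \<phi> by (auto simp: B_kernel_def indicator_def R_diff dual_diff algebra_simps)
    thus ?thesis by (simp add: B_form_eq_kernel int \<phi>)
  qed
  show "B_form f \<phi> (r *\<^sub>R x) = r *\<^sub>R B_form f \<phi> x" if \<phi>: "\<phi> \<in> dual_space" for \<phi> r x
  proof -
    have "B_kernel f \<phi> (r *\<^sub>R x) p = r *\<^sub>R B_kernel f \<phi> x p" for p
      using \<phi> by (auto simp: B_kernel_def indicator_def R_scaleR dual_scaleR)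
    thus ?thesis by (simp add: B_form_eq_kernel int \<phi>)
  qed
  show "cmod (B_form f \<phi> x) \<le> onorm \<phi> * (C * W * norm x)" if \<phi>: "\<phi> \<in> dual_space" for \<phi> x
    using \<phi> by (subst B_form_eq_kernel[OF int[OF \<phi>]]) (intro bd(3) m nn)
  show "\<exists>v. \<forall>\<phi>\<in>dual_space. \<phi> v = B_form f \<phi> x" if "x \<in> range (\<lambda>x. R 1 (R 1 x))" for x
    using that B_form_represented_on_core[OF f fin int] by auto
qed (use C_nonneg W0 dense_R1_R1 in auto)

end

section \<open>Integrals along vertical lines\<close>

definition vline :: "real \<Rightarrow> (complex \<Rightarrow> complex) \<Rightarrow> complex" where
  "vline a F = (LINT \<beta>|lborel. F (Complex a \<beta>))"

text \<open>Links Lebesgue integrals over a whole line with gauge integrals over intervals, to which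
  the fundamental theorem of calculus applies.\<close>

lemma truncated_integral_tendsto:
  fixes g :: "real \<Rightarrow> complex"
  assumes g: "integrable lborel g"
  shows "(\<lambda>n. integral {- real n..real n} g) \<longlonglongrightarrow> (LINT x|lborel. g x)"
proof -
  have si: "set_integrable lborel {- real n..real n} g" for n
    unfolding set_integrable_def using g by (intro integrable_mult_indicator) auto
  have "(\<lambda>n. LINT x|lborel. indicator {- real n..real n} x *\<^sub>R g x) \<longlonglongrightarrow> (LINT x|lborel. g x)"
  proof (rule integral_dominated_convergence[where w = "\<lambda>x. cmod (g x)"])
    show "AE x in lborel. (\<lambda>n. indicator {- real n..real n} x *\<^sub>R g x) \<longlonglongrightarrow> g x"
    proof (rule AE_I2)
      fix x :: real
      obtain N :: nat where N: "\<bar>x\<bar> \<le> real N" using real_arch_simple by blast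
      have "indicator {- real n..real n} x *\<^sub>R g x = g x" if "n \<ge> N" for n
        using N that by (auto simp: indicator_def)
      hence "\<forall>\<^sub>F n in sequentially. indicator {- real n..real n} x *\<^sub>R g x = g x"
        by (auto simp: eventually_sequentially)
      thus "(\<lambda>n. indicator {- real n..real n} x *\<^sub>R g x) \<longlonglongrightarrow> g x" by (rule tendsto_eventually)
    qed
    show "AE x in lborel. norm (indicator {- real n..real n} x *\<^sub>R g x) \<le> cmod (g x)" for n
      by (intro AE_I2) (auto simp: indicator_def)
    show "(\<lambda>x. indicator {- real n..real n} x *\<^sub>R g x) \<in> borel_measurable lborel" for n
      using si[of n] unfolding set_integrable_def by auto
  qed (use g in auto)
  thus ?thesis
    using set_borel_integral_eq_integral(2)[OF si] by (simp add: set_lebesgue_integral_def)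
qed

text \<open>A primitive on the convex domain takes the place of Cauchy's theorem for rectangles: the
  two vertical integrals differ by increments of the primitive along the horizontal sides, each of
  length \<open>b - a\<close>.\<close>

lemma truncated_line_shift:
  assumes U: "open U" "convex U" and F: "F holomorphic_on U" and ab: "a \<le> b"
    and strip: "\<And>z. a \<le> Re z \<Longrightarrow> Re z \<le> b \<Longrightarrow> z \<in> U"
    and N: "0 \<le> N"
    and bound: "\<And>z. a \<le> Re z \<Longrightarrow> Re z \<le> b \<Longrightarrow> \<bar>Im z\<bar> = N \<Longrightarrow> cmod (F z) \<le> e"
  shows "cmod (integral {- N..N} (\<lambda>\<beta>. F (Complex b \<beta>)) - integral {- N..N} (\<lambda>\<beta>. F (Complex a \<beta>)))
    \<le> 2 * e * (b - a)"
proof -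
  obtain P where P: "\<And>z. z \<in> U \<Longrightarrow> (P has_field_derivative F z) (at z)"
    using holomorphic_convex_primitive'[OF U(2,1) F] at_within_open[OF _ U(1)] by metis
  have int: "integral {- N..N} (\<lambda>\<beta>. F (Complex c \<beta>)) = (P (Complex c N) - P (Complex c (- N))) / \<i>"
    if c: "a \<le> c" "c \<le> b" for c
  proof -
    have "((\<lambda>\<beta>. \<i> * F (Complex c \<beta>)) has_integral (P (Complex c N) - P (Complex c (- N)))) {- N..N}"
    proof (rule fundamental_theorem_of_calculus)
      fix \<beta> :: real
      have "((\<lambda>\<beta>. P (Complex c \<beta>)) has_vector_derivative \<i> * F (Complex c \<beta>)) (at \<beta>)"
        using c by (intro has_vector_derivative_vertical_line P strip) auto
      thus "((\<lambda>\<beta>. P (Complex c \<beta>)) has_vector_derivative \<i> * F (Complex c \<beta>)) (at \<beta> within {- N..N})"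
        by (rule has_vector_derivative_at_within)
    qed (use N in simp)
    from has_integral_mult_right[OF this, of "1 / \<i>"]
    show ?thesis by (simp add: integral_unique)
  qed
  have hor: "cmod (P (Complex b y) - P (Complex a y)) \<le> e * (b - a)" if y: "\<bar>y\<bar> = N" for y
  proof -
    let ?S = "closed_segment (Complex a y) (Complex b y)"
    have S: "a \<le> Re z \<and> Re z \<le> b \<and> Im z = y" if z: "z \<in> ?S" for z
    proof -
      obtain u where u: "0 \<le> u" "u \<le> 1" "z = (1 - u) *\<^sub>R Complex a y + u *\<^sub>R Complex b y"
        using z by (auto simp: closed_segment_def)
      have "Im z = y" unfolding u(3) by (simp add: algebra_simps)
      moreover have "Re z = a + u * (b - a)" unfolding u(3) by (simp add: algebra_simps)
      moreover have "u * (b - a) \<le> 1 * (b - a)" using u ab by (intro mult_right_mono) auto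
      moreover have "u * (b - a) \<ge> 0" using u ab by simp
      ultimately show ?thesis by simp
    qed
    have "cmod (P (Complex b y) - P (Complex a y)) \<le> e * cmod (Complex b y - Complex a y)"
    proof (rule field_differentiable_bound[where S = ?S])
      show "(P has_field_derivative F z) (at z within ?S)" if "z \<in> ?S" for z
        using S[OF that] by (intro has_field_derivative_at_within[OF P] strip) auto
      show "cmod (F z) \<le> e" if "z \<in> ?S" for z
        using S[OF that] y by (intro bound) auto
    qed auto
    also have "cmod (Complex b y - Complex a y) = b - a"
      using ab by (simp add: cmod_def)
    finally show ?thesis .
  qed
  have "integral {- N..N} (\<lambda>\<beta>. F (Complex b \<beta>)) - integral {- N..N} (\<lambda>\<beta>. F (Complex a \<beta>)) =
    ((P (Complex b N) - P (Complex a N)) - (P (Complex b (- N)) - P (Complex a (- N)))) / \<i>"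
    using ab by (simp add: int field_simps)
  also have "cmod \<dots> \<le> cmod (P (Complex b N) - P (Complex a N)) + cmod (P (Complex b (- N)) - P (Complex a (- N)))"
    by (simp only: norm_divide norm_ii div_by_1 norm_triangle_ineq4)
  also have "\<dots> \<le> e * (b - a) + e * (b - a)" using N by (intro add_mono hor) auto
  finally show ?thesis by simp
qed

lemma continuous_on_vertical_line:
  assumes "continuous_on U F" "\<And>\<beta>. Complex a \<beta> \<in> U"
  shows "continuous_on UNIV (\<lambda>\<beta>. F (Complex a \<beta>))"
proof -
  have "continuous_on UNIV (Complex a)" by (auto intro!: continuous_intros simp: Complex_eq)
  thus ?thesis using assms(2) by (intro continuous_on_compose2[OF assms(1)]) auto
qed

lemma vline_decay:
  assumes F: "continuous_on U F" "\<And>\<beta>. Complex a \<beta> \<in> U"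
    and bound: "\<And>\<beta>. cmod (F (Complex a \<beta>)) \<le> K / (1 + \<beta>\<^sup>2)"
  shows "integrable lborel (\<lambda>\<beta>. F (Complex a \<beta>))" and "cmod (vline a F) \<le> pi * K"
proof -
  have K: "K \<ge> 0" using order.trans[OF norm_ge_zero bound[of 0]] by simp
  have m: "(\<lambda>\<beta>. F (Complex a \<beta>)) \<in> borel_measurable lborel"
    using borel_measurable_continuous_onI[OF continuous_on_vertical_line[OF F]] by simp
  have "(\<integral>\<^sup>+ \<beta>. ennreal (cmod (F (Complex a \<beta>))) \<partial>lborel) \<le> (\<integral>\<^sup>+ \<beta>. ennreal K * ennreal (1 / (1\<^sup>2 + \<beta>\<^sup>2)) \<partial>lborel)"
    using bound K by (intro nn_integral_mono) (simp flip: ennreal_mult)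
  also have "\<dots> = ennreal K * (\<integral>\<^sup>+ \<beta>. ennreal (1 / (1\<^sup>2 + \<beta>\<^sup>2)) \<partial>lborel)"
    by (rule nn_integral_cmult) simp
  also have "\<dots> \<le> ennreal K * ennreal pi" by (intro mult_left_mono nn_integral_poisson_kernel) auto
  also have "\<dots> = ennreal (pi * K)" using K by (simp add: mult.commute flip: ennreal_mult)
  finally have le: "(\<integral>\<^sup>+ \<beta>. ennreal (cmod (F (Complex a \<beta>))) \<partial>lborel) \<le> ennreal (pi * K)" .
  have K': "0 \<le> pi * K" using K by simp
  show "integrable lborel (\<lambda>\<beta>. F (Complex a \<beta>))" "cmod (vline a F) \<le> pi * K"
    unfolding vline_def by (rule integral_bound_of_nn_integral[OF m le K'])+
qed

lemma vline_shift:
  assumes U: "open U" "convex U" and F: "F holomorphic_on U" and ab: "a \<le> b"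
    and strip: "\<And>z. a \<le> Re z \<Longrightarrow> Re z \<le> b \<Longrightarrow> z \<in> U"
    and bound: "\<And>z. a \<le> Re z \<Longrightarrow> Re z \<le> b \<Longrightarrow> cmod (F z) \<le> K / (1 + (Im z)\<^sup>2)"
  shows "vline b F = vline a F"
proof -
  have i: "integrable lborel (\<lambda>\<beta>. F (Complex c \<beta>))" if "a \<le> c" "c \<le> b" for c
  proof (rule vline_decay(1)[OF holomorphic_on_imp_continuous_on[OF F]])
    show "cmod (F (Complex c \<beta>)) \<le> K / (1 + \<beta>\<^sup>2)" for \<beta> using bound[of "Complex c \<beta>"] that by simp
  qed (use strip that in auto)
  define d where "d n = integral {- real n..real n} (\<lambda>\<beta>. F (Complex b \<beta>))
      - integral {- real n..real n} (\<lambda>\<beta>. F (Complex a \<beta>))" for n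
  have "d \<longlonglongrightarrow> vline b F - vline a F"
    unfolding d_def vline_def using ab by (intro tendsto_diff truncated_integral_tendsto i) auto
  moreover have "d \<longlonglongrightarrow> 0"
  proof (rule Lim_null_comparison)
    show "\<forall>\<^sub>F n in sequentially. cmod (d n) \<le> 2 * (K / (1 + (real n)\<^sup>2)) * (b - a)"
    proof (rule always_eventually, rule allI)
      fix n :: nat
      show "cmod (d n) \<le> 2 * (K / (1 + (real n)\<^sup>2)) * (b - a)" unfolding d_def
      proof (rule truncated_line_shift[OF U F ab strip])
        fix z assume z: "a \<le> Re z" "Re z \<le> b" "\<bar>Im z\<bar> = real n"
        have "(Im z)\<^sup>2 = (real n)\<^sup>2" using z(3) by (metis power2_abs)
        thus "cmod (F z) \<le> K / (1 + (real n)\<^sup>2)" using bound[OF z(1,2)] by simp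
      qed auto
    qed
    show "(\<lambda>n. 2 * (K / (1 + (real n)\<^sup>2)) * (b - a)) \<longlonglongrightarrow> 0" by real_asymp
  qed
  ultimately have "vline b F - vline a F = 0" by (rule LIMSEQ_unique)
  thus ?thesis by simp
qed

text \<open>The bound is uniform in the half-plane Re z \<le> a. In the minimum, (1 - a)^2 accounts
  for the distance of the real part from the pole, and 1 keeps the coefficient of (Im z)^2 at most
  one.\<close>

lemma inverse_square_bound:
  assumes "Re z \<le> a" "a < 1"
  shows "1 / (cmod (z - 1))\<^sup>2 \<le> (1 / min 1 ((1 - a)\<^sup>2)) / (1 + (Im z)\<^sup>2)"
proof -
  define m where "m = min 1 ((1 - a)\<^sup>2)"
  have m: "m > 0" "m \<le> 1" "m \<le> (1 - a)\<^sup>2" using assms by (auto simp: m_def)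
  have "(1 - a)\<^sup>2 \<le> (Re z - 1)\<^sup>2" using assms by (subst power2_commute, intro power_mono) auto
  moreover have "m * (Im z)\<^sup>2 \<le> (Im z)\<^sup>2" using m by (simp add: mult_left_le_one_le)
  ultimately have "m * (1 + (Im z)\<^sup>2) \<le> (Re z - 1)\<^sup>2 + (Im z)\<^sup>2"
    using m(3) by (simp add: distrib_left)
  also have "\<dots> = (cmod (z - 1))\<^sup>2" by (simp add: cmod_def)
  finally have "m * (1 + (Im z)\<^sup>2) \<le> (cmod (z - 1))\<^sup>2" .
  moreover have p: "m * (1 + (Im z)\<^sup>2) > 0" using m by (simp add: add_pos_nonneg)
  ultimately have "1 / (cmod (z - 1))\<^sup>2 \<le> 1 / (m * (1 + (Im z)\<^sup>2))"
    by (intro divide_left_mono) (auto intro!: mult_pos_pos)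
  thus ?thesis unfolding m_def by simp
qed

text \<open>Closing the contour to the left, where \<open>exp (t z)\<close> decays.\<close>

lemma vline_exp_eq_zero:
  assumes t: "0 < t" and q: "q holomorphic_on {z. Re z < c}" and ac: "a < c" "c \<le> 1"
    and Q: "\<And>z. Re z \<le> a \<Longrightarrow> cmod (q z) \<le> Q"
  shows "vline a (\<lambda>z. exp (of_real t * z) * q z / (z - 1)\<^sup>2) = 0"
proof -
  let ?U = "{z. Re z < c}" and ?F = "\<lambda>z. exp (of_real t * z) * q z / (z - 1)\<^sup>2"
  define k where "k = 1 / min 1 ((1 - a)\<^sup>2)"
  have k: "k > 0" using ac by (simp add: k_def)
  have Q0: "Q \<ge> 0" using order.trans[OF norm_ge_zero Q[of "of_real a"]] by simp
  have U: "open ?U" "convex ?U" by (auto intro: open_halfspace_Re_lt convex_halfspace_Re_lt)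
  have F: "?F holomorphic_on ?U"
    using ac by (intro holomorphic_intros q) auto
  have b: "cmod (?F z) \<le> (exp (t * a') * Q * k) / (1 + (Im z)\<^sup>2)" if z: "Re z \<le> a'" "a' \<le> a" for z a'
  proof -
    have "cmod (?F z) = exp (t * Re z) * cmod (q z) * (1 / (cmod (z - 1))\<^sup>2)"
      by (simp add: norm_mult norm_divide norm_power)
    also have "\<dots> \<le> exp (t * a') * Q * (k / (1 + (Im z)\<^sup>2))"
      using t z ac Q0 inverse_square_bound[of z a] unfolding k_def
      by (intro mult_mono Q) auto
    finally show ?thesis by simp
  qed
  have "vline a ?F = vline a' ?F" if "a' \<le> a" for a'
    by (rule vline_shift[OF U F that]) (use b[of _ a] ac in auto)
  moreover have "cmod (vline a' ?F) \<le> pi * (exp (t * a') * Q * k)" if "a' \<le> a" for a'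
  proof (rule vline_decay(2)[OF holomorphic_on_imp_continuous_on[OF F]])
    show "cmod (?F (Complex a' \<beta>)) \<le> (exp (t * a') * Q * k) / (1 + \<beta>\<^sup>2)" for \<beta>
      using b[of "Complex a' \<beta>" a'] that by simp
  qed (use that ac in auto)
  ultimately have le: "cmod (vline a ?F) \<le> pi * (exp (t * a') * Q * k)" if "a' \<le> a" for a'
    using that by simp
  have "((\<lambda>a'. pi * (exp (t * a') * Q * k)) \<longlongrightarrow> 0) at_bot"
    using t by real_asymp
  moreover have "\<forall>\<^sub>F a' in at_bot. cmod (vline a ?F) \<le> pi * (exp (t * a') * Q * k)"
    by (rule eventually_mono[OF eventually_le_at_bot[of a] le])
  ultimately have "cmod (vline a ?F) \<le> 0"
    by (rule tendsto_lowerbound) simp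
  thus ?thesis by simp
qed

section \<open>Cauchy's formula on a vertical line\<close>

lemma line_inverse_truncated:
  assumes d: "d \<noteq> 0" and N: "0 \<le> N"
  shows "((\<lambda>\<beta>. 1 / Complex d (\<beta> - y)) has_integral
      Complex (arctan ((N - y) / d) - arctan ((- N - y) / d))
        ((ln (d\<^sup>2 + (- N - y)\<^sup>2) - ln (d\<^sup>2 + (N - y)\<^sup>2)) / 2)) {- N..N}"
proof -
  \<comment> \<open>This is -i times a logarithm of Complex d (\<beta> - y) up to a constant,
    written with arctan so that no branch is chosen and either sign of \<open>d\<close> is
    allowed.\<close>
  define G where "G \<beta> = Complex (arctan ((\<beta> - y) / d)) (- (ln (d\<^sup>2 + (\<beta> - y)\<^sup>2) / 2))" for \<beta>
  have "((\<lambda>\<beta>. 1 / Complex d (\<beta> - y)) has_integral (G N - G (- N))) {- N..N}"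
  proof (rule fundamental_theorem_of_calculus)
    fix \<beta> :: real
    have p: "d\<^sup>2 + (\<beta> - y)\<^sup>2 > 0" using d by (simp add: add_pos_nonneg)
    have 1: "((\<lambda>\<beta>. arctan ((\<beta> - y) / d)) has_vector_derivative d / (d\<^sup>2 + (\<beta> - y)\<^sup>2)) (at \<beta> within {- N..N})"
      unfolding has_real_derivative_iff_has_vector_derivative[symmetric]
      using d p by (auto intro!: derivative_eq_intros simp: field_simps power2_eq_square)
    have D1: "((\<lambda>\<beta>. d\<^sup>2 + (\<beta> - y)\<^sup>2) has_real_derivative 2 * (\<beta> - y)) (at \<beta> within {- N..N})"
      by (auto intro!: derivative_eq_intros)
    have gen: "- (1 / X * (2 * u) / 2) = - u / X" for X u :: real by simp
    note D = DERIV_minus[OF DERIV_cdivide[OF DERIV_chain2[OF DERIV_ln_divide[OF p] D1], of 2]]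
    have 2: "((\<lambda>\<beta>. - (ln (d\<^sup>2 + (\<beta> - y)\<^sup>2) / 2)) has_vector_derivative - (\<beta> - y) / (d\<^sup>2 + (\<beta> - y)\<^sup>2)) (at \<beta> within {- N..N})"
      unfolding has_real_derivative_iff_has_vector_derivative[symmetric]
      by (rule DERIV_cong[OF D gen])
    have "1 / Complex d (\<beta> - y) = Complex (d / (d\<^sup>2 + (\<beta> - y)\<^sup>2)) (- (\<beta> - y) / (d\<^sup>2 + (\<beta> - y)\<^sup>2))"
      by (simp add: complex_eq_iff Re_divide Im_divide)
    thus "(G has_vector_derivative 1 / Complex d (\<beta> - y)) (at \<beta> within {- N..N})"
      unfolding G_def using 1 2
      by (simp add: has_vector_derivative_complex_iff has_real_derivative_iff_has_vector_derivative)
  qed (use N in simp)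
  moreover have "G N - G (- N) = Complex (arctan ((N - y) / d) - arctan ((- N - y) / d))
        ((ln (d\<^sup>2 + (- N - y)\<^sup>2) - ln (d\<^sup>2 + (N - y)\<^sup>2)) / 2)"
    by (simp add: G_def complex_eq_iff diff_divide_distrib)
  ultimately show ?thesis by (simp only:)
qed

text \<open>The integral does not converge absolutely. Under symmetric truncation the logarithms
  cancel and the arctan part tends to plus or minus pi, depending on the side of the line on which
  \<open>z\<close> lies.\<close>

lemma line_inverse_tendsto:
  assumes "c \<noteq> Re z"
  shows "(\<lambda>n. integral {- real n..real n} (\<lambda>\<beta>. 1 / (Complex c \<beta> - z))) \<longlonglongrightarrow> of_real (sgn (c - Re z) * pi)"
proof -
  define d y where "d = c - Re z" and "y = Im z"
  have d: "d \<noteq> 0" using assms by (simp add: d_def)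
  have e: "Complex c \<beta> - z = Complex d (\<beta> - y)" for \<beta> by (simp add: complex_eq_iff d_def y_def)
  have i: "integral {- real n..real n} (\<lambda>\<beta>. 1 / (Complex c \<beta> - z)) =
    Complex (arctan ((real n - y) / d) - arctan ((- real n - y) / d))
      ((ln (d\<^sup>2 + (- real n - y)\<^sup>2) - ln (d\<^sup>2 + (real n - y)\<^sup>2)) / 2)" for n
    unfolding e by (intro integral_unique line_inverse_truncated d) simp
  have 1: "(\<lambda>n. arctan ((real n - y) / d) - arctan ((- real n - y) / d)) \<longlonglongrightarrow> sgn d * pi"
  proof (cases "d > 0")
    case True
    have "(\<lambda>n. arctan ((real n - y) / d) - arctan ((- real n - y) / d)) \<longlonglongrightarrow> pi"
      using True by real_asymp
    thus ?thesis using True by simp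
  next
    case False
    hence "d < 0" using d by simp
    hence "(\<lambda>n. arctan ((real n - y) / d) - arctan ((- real n - y) / d)) \<longlonglongrightarrow> - pi"
      by real_asymp
    thus ?thesis using \<open>d < 0\<close> by simp
  qed
  have 2: "(\<lambda>n. (ln (d\<^sup>2 + (- real n - y)\<^sup>2) - ln (d\<^sup>2 + (real n - y)\<^sup>2)) / 2) \<longlonglongrightarrow> 0"
    by real_asymp
  show ?thesis unfolding i
    using tendsto_Complex[OF 1 2] by (simp add: d_def complex_of_real_def)
qed

text \<open>The difference quotient of h at \<open>z\<close> has no singularity at \<open>z\<close>
  and can be moved from the line b to a line left of \<open>z\<close>. Splitting it on both lines
  produces truncated integrals of 1 / (w - z) with opposite signs, which together give 2 pi h(z);
  the remaining integral on the left line vanishes.\<close>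

lemma vline_cauchy_exp:
  assumes s: "0 < s" and z: "Re z < b" and b: "b < 1"
  shows "vline b (\<lambda>w. exp (of_real s * w) * (1 / (w - z)) / (w - 1)\<^sup>2) = of_real (2 * pi) * (exp (of_real s * z) / (z - 1)\<^sup>2)"
proof -
  define h where "h w = exp (of_real s * w) / (w - 1)\<^sup>2" for w :: complex
  \<comment> \<open>At distance 1 to the left of \<open>z\<close>, so that |1 / (w - z)| \<le> 1 for
    all Re w \<le> a.\<close>
  define a where "a = Re z - 1"
  define F where "F w = (if w = z then deriv h z else (h w - h z) / (w - z))" for w
  let ?U = "{w. Re w < 1}"
  have U: "open ?U" "convex ?U" by (auto intro: open_halfspace_Re_lt convex_halfspace_Re_lt)
  have h: "h holomorphic_on ?U" unfolding h_def by (intro holomorphic_intros) auto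
  have F: "F holomorphic_on ?U" unfolding F_def by (rule pole_lemma_open[OF h U(1)])
  define k where "k = 1 / min 1 ((1 - b)\<^sup>2)"
  have k: "k > 0" using b by (simp add: k_def)
  have hb: "cmod (h w) \<le> (exp (s * b) * k) / (1 + (Im w)\<^sup>2)" if "Re w \<le> b" for w
  proof -
    have "cmod (h w) = exp (s * Re w) * (1 / (cmod (w - 1))\<^sup>2)"
      by (simp add: h_def norm_divide norm_power)
    also have "\<dots> \<le> exp (s * b) * (k / (1 + (Im w)\<^sup>2))"
      using s that b inverse_square_bound[of w b] unfolding k_def by (intro mult_mono) auto
    finally show ?thesis by simp
  qed
  have hb': "cmod (h w) \<le> exp (s * b) * k" if "Re w \<le> b" for w
  proof -
    have "(exp (s * b) * k) / (1 + (Im w)\<^sup>2) \<le> (exp (s * b) * k) / 1"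
      using k by (intro divide_left_mono) (auto intro: add_pos_nonneg)
    thus ?thesis using hb[OF that] by simp
  qed
  \<comment> \<open>Bounds the numerator of the difference quotient; on the horizontal sides the
    denominator grows like n.\<close>
  define H where "H = exp (s * b) * k + cmod (h z)"
  have H: "H \<ge> 0" using k by (simp add: H_def)
  have Fc: "F (Complex c \<beta>) = h (Complex c \<beta>) / (Complex c \<beta> - z) - h z * (1 / (Complex c \<beta> - z))"
    if "c \<noteq> Re z" for c \<beta>
    using that by (auto simp: F_def diff_divide_distrib)
  have hi: "integrable lborel (\<lambda>\<beta>. h (Complex c \<beta>) / (Complex c \<beta> - z))" if c: "c \<noteq> Re z" "c \<le> b" for c
  proof (rule vline_decay(1)[where F = "\<lambda>w. h w / (w - z)" and U = "{w. Re w = c}"])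
    show "continuous_on {w. Re w = c} (\<lambda>w. h w / (w - z))"
      using c b by (intro continuous_intros continuous_on_subset[OF holomorphic_on_imp_continuous_on[OF h]]) auto
    fix \<beta> :: real
    have "\<bar>c - Re z\<bar> \<le> cmod (Complex c \<beta> - z)" using abs_Re_le_cmod[of "Complex c \<beta> - z"] by simp
    moreover have "cmod (h (Complex c \<beta>)) \<le> (exp (s * b) * k) / (1 + \<beta>\<^sup>2)" using hb[of "Complex c \<beta>"] c by simp
    ultimately have "cmod (h (Complex c \<beta>)) / cmod (Complex c \<beta> - z) \<le> ((exp (s * b) * k) / (1 + \<beta>\<^sup>2)) / \<bar>c - Re z\<bar>"
      using c k by (intro frac_le) auto
    thus "cmod (h (Complex c \<beta>) / (Complex c \<beta> - z)) \<le> (exp (s * b) * k / \<bar>c - Re z\<bar>) / (1 + \<beta>\<^sup>2)"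
      by (simp add: norm_divide mult.commute)
  qed simp
  have lim: "(\<lambda>n. integral {- real n..real n} (\<lambda>\<beta>. F (Complex c \<beta>))) \<longlonglongrightarrow>
      vline c (\<lambda>w. h w / (w - z)) - h z * of_real (sgn (c - Re z) * pi)" if c: "c \<noteq> Re z" "c \<le> b" for c
  proof -
    have "integral {- real n..real n} (\<lambda>\<beta>. F (Complex c \<beta>)) =
      integral {- real n..real n} (\<lambda>\<beta>. h (Complex c \<beta>) / (Complex c \<beta> - z)) -
      h z * integral {- real n..real n} (\<lambda>\<beta>. 1 / (Complex c \<beta> - z))" for n
    proof -
      have cont: "continuous_on UNIV (\<lambda>\<beta>. Complex c \<beta> - z)"
        by (auto intro!: continuous_intros simp: Complex_eq)
      have ne: "Complex c \<beta> - z \<noteq> 0" for \<beta> using c by auto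
      have ch: "continuous_on UNIV (\<lambda>\<beta>. h (Complex c \<beta>))"
        using c b by (intro continuous_on_vertical_line[OF holomorphic_on_imp_continuous_on[OF h]]) auto
      have 1: "(\<lambda>\<beta>. h (Complex c \<beta>) / (Complex c \<beta> - z)) integrable_on {- real n..real n}"
        by (intro integrable_continuous_real continuous_intros continuous_on_subset[OF ch]
            continuous_on_subset[OF cont]) (use ne in auto)
      have 2: "(\<lambda>\<beta>. h z * (1 / (Complex c \<beta> - z))) integrable_on {- real n..real n}"
        by (intro integrable_continuous_real continuous_intros continuous_on_subset[OF cont]) (use ne in auto)
      have "integral {- real n..real n} (\<lambda>\<beta>. F (Complex c \<beta>)) =
        integral {- real n..real n} (\<lambda>\<beta>. h (Complex c \<beta>) / (Complex c \<beta> - z) - h z * (1 / (Complex c \<beta> - z)))"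
        by (simp only: Fc[OF c(1)])
      also have "\<dots> = integral {- real n..real n} (\<lambda>\<beta>. h (Complex c \<beta>) / (Complex c \<beta> - z)) -
        integral {- real n..real n} (\<lambda>\<beta>. h z * (1 / (Complex c \<beta> - z)))"
        by (rule Henstock_Kurzweil_Integration.integral_diff[OF 1 2])
      also have "integral {- real n..real n} (\<lambda>\<beta>. h z * (1 / (Complex c \<beta> - z))) =
        h z * integral {- real n..real n} (\<lambda>\<beta>. 1 / (Complex c \<beta> - z))"
        by (rule integral_mult_right)
      finally show ?thesis .
    qed
    thus ?thesis unfolding vline_def
      by (simp only:) (intro tendsto_diff tendsto_mult_left truncated_integral_tendsto[OF hi[OF c]] line_inverse_tendsto c(1))
  qed
  define D where "D n = integral {- real n..real n} (\<lambda>\<beta>. F (Complex b \<beta>))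
      - integral {- real n..real n} (\<lambda>\<beta>. F (Complex a \<beta>))" for n
  have D0: "D \<longlonglongrightarrow> 0"
  proof (rule Lim_null_comparison)
    obtain n0 :: nat where n0: "real n0 > \<bar>Im z\<bar> + 1" using reals_Archimedean2 by blast
    show "\<forall>\<^sub>F n in sequentially. cmod (D n) \<le> 2 * (H / (real n - \<bar>Im z\<bar>)) * (b - a)"
      using eventually_ge_at_top[of n0]
    proof eventually_elim
      case (elim n)
      hence n: "real n > \<bar>Im z\<bar> + 1" using n0 by linarith
      show ?case unfolding D_def
      proof (rule truncated_line_shift[OF U F])
        fix w assume w: "a \<le> Re w" "Re w \<le> b" "\<bar>Im w\<bar> = real n"
        have "real n - \<bar>Im z\<bar> \<le> cmod (w - z)"
          using abs_Im_le_cmod[of "w - z"] w(3) by (auto simp: abs_if split: if_splits)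
        moreover have "w \<noteq> z" using w n by auto
        moreover have "cmod (h w - h z) \<le> H"
          unfolding H_def using hb'[OF w(2)] norm_triangle_ineq4[of "h w" "h z"] by linarith
        ultimately show "cmod (F w) \<le> H / (real n - \<bar>Im z\<bar>)"
          using n H unfolding F_def by (simp add: norm_divide) (intro frac_le, auto)
      qed (use z b in \<open>auto simp: a_def\<close>)
    qed
    show "(\<lambda>n. 2 * (H / (real n - \<bar>Im z\<bar>)) * (b - a)) \<longlonglongrightarrow> 0" by real_asymp
  qed
  have "D \<longlonglongrightarrow> (vline b (\<lambda>w. h w / (w - z)) - h z * of_real (sgn (b - Re z) * pi)) -
      (vline a (\<lambda>w. h w / (w - z)) - h z * of_real (sgn (a - Re z) * pi))"
    unfolding D_def using z by (intro tendsto_diff lim) (auto simp: a_def)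
  from LIMSEQ_unique[OF this D0]
  have "(vline b (\<lambda>w. h w / (w - z)) - h z * of_real (sgn (b - Re z) * pi)) -
      (vline a (\<lambda>w. h w / (w - z)) - h z * of_real (sgn (a - Re z) * pi)) = 0" .
  moreover have eq: "(\<lambda>w. h w / (w - z)) = (\<lambda>w. exp (of_real s * w) * (1 / (w - z)) / (w - 1)\<^sup>2)"
    by (simp add: h_def fun_eq_iff)
  moreover have "vline a (\<lambda>w. exp (of_real s * w) * (1 / (w - z)) / (w - 1)\<^sup>2) = 0"
  proof (rule vline_exp_eq_zero[OF s])
    show "(\<lambda>w. 1 / (w - z)) holomorphic_on {w. Re w < Re z}" by (intro holomorphic_intros) auto
    show "cmod (1 / (w - z)) \<le> 1" if "Re w \<le> a" for w
      using that abs_Re_le_cmod[of "w - z"] by (simp add: a_def norm_divide divide_le_eq)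
  qed (use z b in \<open>auto simp: a_def\<close>)
  ultimately have "vline b (\<lambda>w. exp (of_real s * w) * (1 / (w - z)) / (w - 1)\<^sup>2)
      - h z * of_real pi - h z * of_real pi = 0"
    using z by (simp add: a_def)
  hence "vline b (\<lambda>w. exp (of_real s * w) * (1 / (w - z)) / (w - 1)\<^sup>2) = of_real (2 * pi) * h z"
    by (simp add: algebra_simps)
  thus ?thesis unfolding h_def .
qed

section \<open>Line integrals with an exponential factor and a double pole at 1\<close>

definition exp_line :: "real \<Rightarrow> real \<Rightarrow> (complex \<Rightarrow> complex) \<Rightarrow> complex" where
  "exp_line a t q = vline a (\<lambda>z. exp (of_real t * z) * q z / (z - 1)\<^sup>2)"

text \<open>Since |exp (t z)| is constant on a vertical line, the factor (z - 1)^-2 then gives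
  absolute convergence of \<open>exp_line\<close>.\<close>

definition bounded_on_line :: "real \<Rightarrow> (complex \<Rightarrow> complex) \<Rightarrow> bool" where
  "bounded_on_line a q \<longleftrightarrow> continuous_on {z. Re z = a} q \<and> (\<exists>Q. \<forall>z. Re z = a \<longrightarrow> cmod (q z) \<le> Q)"

lemma bounded_on_lineI:
  assumes "continuous_on {z. Re z = a} q" "\<And>z. Re z = a \<Longrightarrow> cmod (q z) \<le> Q"
  shows "bounded_on_line a q"
  unfolding bounded_on_line_def using assms(1) by (intro conjI exI[of _ Q] allI impI assms(2))

lemma bounded_on_line_const: "bounded_on_line a (\<lambda>_. c)"
  by (rule bounded_on_lineI[where Q = "cmod c"]) auto

lemma bounded_on_line_diff:
  assumes "bounded_on_line a p" "bounded_on_line a q"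
  shows "bounded_on_line a (\<lambda>z. p z - q z)"
proof -
  obtain P Q where b: "\<And>z. Re z = a \<Longrightarrow> cmod (p z) \<le> P" "\<And>z. Re z = a \<Longrightarrow> cmod (q z) \<le> Q"
    using assms unfolding bounded_on_line_def by blast
  have "cmod (p z - q z) \<le> P + Q" if "Re z = a" for z
    by (rule order.trans[OF norm_triangle_ineq4 add_mono[OF b(1)[OF that] b(2)[OF that]]])
  thus ?thesis using assms unfolding bounded_on_line_def
    by (auto intro!: continuous_intros)
qed

lemma bounded_on_line_mult:
  assumes "bounded_on_line a p" "bounded_on_line a q"
  shows "bounded_on_line a (\<lambda>z. p z * q z)"
proof -
  obtain P Q where b: "\<And>z. Re z = a \<Longrightarrow> cmod (p z) \<le> P" "\<And>z. Re z = a \<Longrightarrow> cmod (q z) \<le> Q"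
    using assms unfolding bounded_on_line_def by blast
  have "P \<ge> 0" using order.trans[OF norm_ge_zero b(1)[of "of_real a"]] by simp
  hence "cmod (p z * q z) \<le> P * Q" if "Re z = a" for z
    using that b unfolding norm_mult by (intro mult_mono) auto
  thus ?thesis using assms unfolding bounded_on_line_def
    by (auto intro!: continuous_intros)
qed

lemma bounded_on_line_inverse:
  assumes "Re w \<noteq> a"
  shows "bounded_on_line a (\<lambda>z. 1 / (z - w))" and "bounded_on_line a (\<lambda>z. 1 / (w - z))"
proof -
  have "1 / cmod (z - w) \<le> 1 / \<bar>a - Re w\<bar>" if "Re z = a" for z
    using that assms abs_Re_le_cmod[of "z - w"] by (intro divide_left_mono) (auto intro!: mult_pos_pos)
  thus "bounded_on_line a (\<lambda>z. 1 / (z - w))" "bounded_on_line a (\<lambda>z. 1 / (w - z))"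
    using assms
    by (auto intro!: bounded_on_lineI[where Q = "1 / \<bar>a - Re w\<bar>"] continuous_intros
        simp: norm_divide norm_minus_commute)
qed

lemma exp_kernel_bound:
  assumes t: "0 \<le> t" and a: "a < 1" and q: "bounded_on_line a q"
  shows "\<exists>K\<ge>0. \<forall>\<beta>. cmod (exp (of_real t * Complex a \<beta>) * q (Complex a \<beta>) / (Complex a \<beta> - 1)\<^sup>2) \<le> K / (1 + \<beta>\<^sup>2)"
proof -
  obtain Q where Q: "\<And>z. Re z = a \<Longrightarrow> cmod (q z) \<le> Q"
    using q unfolding bounded_on_line_def by blast
  have Q0: "Q \<ge> 0" using order.trans[OF norm_ge_zero Q[of "of_real a"]] by simp
  define k where "k = 1 / min 1 ((1 - a)\<^sup>2)"
  have k: "k > 0" using a by (simp add: k_def)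
  have "cmod (exp (of_real t * z) * q z / (z - 1)\<^sup>2) \<le> (exp (t * a) * Q * k) / (1 + (Im z)\<^sup>2)"
    if z: "Re z = a" for z
  proof -
    have "cmod (exp (of_real t * z) * q z / (z - 1)\<^sup>2) = exp (t * a) * cmod (q z) * (1 / (cmod (z - 1))\<^sup>2)"
      using z by (simp add: norm_mult norm_divide norm_power)
    also have "\<dots> \<le> exp (t * a) * Q * (k / (1 + (Im z)\<^sup>2))"
      using z a Q0 inverse_square_bound[of z a] unfolding k_def by (intro mult_mono Q) auto
    finally show ?thesis by simp
  qed
  from this[of "Complex a _"] show ?thesis
    using Q0 k by (intro exI[of _ "exp (t * a) * Q * k"]) auto
qed

lemma exp_kernel_continuous:
  assumes a: "a < 1" and q: "bounded_on_line a q"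
  shows "continuous_on {z. Re z = a} (\<lambda>z. exp (of_real t * z) * q z / (z - 1)\<^sup>2)"
proof -
  have "continuous_on {z. Re z = a} q" using q unfolding bounded_on_line_def by blast
  thus ?thesis by (intro continuous_intros) (use a in auto)
qed

lemma exp_line_integrable:
  assumes t: "0 \<le> t" and a: "a < 1" and q: "bounded_on_line a q"
  shows "integrable lborel (\<lambda>\<beta>. exp (of_real t * Complex a \<beta>) * q (Complex a \<beta>) / (Complex a \<beta> - 1)\<^sup>2)"
proof -
  obtain K where K: "\<And>\<beta>. cmod (exp (of_real t * Complex a \<beta>) * q (Complex a \<beta>) / (Complex a \<beta> - 1)\<^sup>2) \<le> K / (1 + \<beta>\<^sup>2)"
    using exp_kernel_bound[OF assms] by blast
  show ?thesis
    by (rule vline_decay(1)[where F = "\<lambda>z. exp (of_real t * z) * q z / (z - 1)\<^sup>2",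
          OF exp_kernel_continuous[OF a q] _ K]) simp
qed

lemma exp_line_cong:
  assumes "\<And>z. Re z = a \<Longrightarrow> p z = q z"
  shows "exp_line a t p = exp_line a t q"
  unfolding exp_line_def vline_def by (simp only: assms[of "Complex a _", OF complex.sel(1)])

lemma exp_line_diff:
  assumes "0 \<le> t" "a < 1" "bounded_on_line a p" "bounded_on_line a q"
  shows "exp_line a t (\<lambda>z. p z - q z) = exp_line a t p - exp_line a t q"
  unfolding exp_line_def vline_def right_diff_distrib diff_divide_distrib
  by (rule Bochner_Integration.integral_diff[OF exp_line_integrable exp_line_integrable]) (fact assms)+

lemma exp_line_cmult: "exp_line a t (\<lambda>z. c * q z) = c * exp_line a t q"
proof -
  have e: "exp (of_real t * z) * (c * q z) / (z - 1)\<^sup>2 = c * (exp (of_real t * z) * q z / (z - 1)\<^sup>2)" for z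
    by simp
  show ?thesis unfolding exp_line_def vline_def e by (rule integral_mult_right_zero)
qed

lemma exp_line_holomorphic_left:
  assumes "0 < t" "q holomorphic_on {z. Re z < c}" "a < c" "c \<le> 1" "\<And>z. Re z \<le> a \<Longrightarrow> cmod (q z) \<le> Q"
  shows "exp_line a t q = 0"
  unfolding exp_line_def by (rule vline_exp_eq_zero[OF assms])

lemma exp_line_const: "0 < t \<Longrightarrow> a < 1 \<Longrightarrow> exp_line a t (\<lambda>_. c) = 0"
  by (rule exp_line_holomorphic_left[where c = 1 and Q = "cmod c"]) auto

text \<open>The integrand contains no resolvent and therefore continues holomorphically to the far
  left.\<close>

lemma exp_line_inverse_power:
  assumes "0 < t" "a < 1"
  shows "exp_line a t (\<lambda>z. (1 / (z - 1)) ^ n) = 0"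
proof (rule exp_line_holomorphic_left[where c = 1 and Q = "(1 / (1 - a)) ^ n"])
  show "(\<lambda>z. (1 / (z - 1)) ^ n) holomorphic_on {z. Re z < 1}" by (intro holomorphic_intros) auto
  show "cmod ((1 / (z - 1)) ^ n) \<le> (1 / (1 - a)) ^ n" if "Re z \<le> a" for z
  proof -
    have "1 - a \<le> cmod (z - 1)" using that assms abs_Re_le_cmod[of "z - 1"] by simp
    thus ?thesis unfolding norm_power norm_divide norm_one
      using assms by (intro power_mono divide_left_mono) (auto intro!: mult_pos_pos)
  qed
qed (use assms in auto)

text \<open>The basis of integration by parts: truncated integrals equal differences of boundary
  values, which vanish in the limit.\<close>

lemma vline_deriv_eq_zero:
  assumes der: "\<And>\<beta>. (F has_field_derivative F' (Complex a \<beta>)) (at (Complex a \<beta>))"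
    and bound: "\<And>\<beta>. cmod (F (Complex a \<beta>)) \<le> K / (1 + \<beta>\<^sup>2)"
    and int: "integrable lborel (\<lambda>\<beta>. F' (Complex a \<beta>))"
  shows "vline a F' = 0"
proof -
  have i: "integral {- real n..real n} (\<lambda>\<beta>. F' (Complex a \<beta>)) =
      (F (Complex a (real n)) - F (Complex a (- real n))) / \<i>" for n
  proof -
    have "((\<lambda>\<beta>. \<i> * F' (Complex a \<beta>)) has_integral (F (Complex a (real n)) - F (Complex a (- real n))))
        {- real n..real n}"
      by (rule fundamental_theorem_of_calculus[OF _
          has_vector_derivative_at_within[OF has_vector_derivative_vertical_line[OF der]]]) simp
    from has_integral_mult_right[OF this, of "1 / \<i>"]
    show ?thesis by (simp add: integral_unique)
  qed
  have "(\<lambda>n. (F (Complex a (real n)) - F (Complex a (- real n))) / \<i>) \<longlonglongrightarrow> 0"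
  proof (rule Lim_null_comparison)
    show "\<forall>\<^sub>F n in sequentially. cmod ((F (Complex a (real n)) - F (Complex a (- real n))) / \<i>)
        \<le> K / (1 + (real n)\<^sup>2) + K / (1 + (real n)\<^sup>2)"
    proof (rule always_eventually, rule allI)
      fix n :: nat
      have "cmod (F (Complex a (real n)) - F (Complex a (- real n)))
          \<le> cmod (F (Complex a (real n))) + cmod (F (Complex a (- real n)))"
        by (rule norm_triangle_ineq4)
      also have "\<dots> \<le> K / (1 + (real n)\<^sup>2) + K / (1 + (real n)\<^sup>2)"
        using bound[of "real n"] bound[of "- real n"] by (intro add_mono) auto
      finally show "cmod ((F (Complex a (real n)) - F (Complex a (- real n))) / \<i>)
        \<le> K / (1 + (real n)\<^sup>2) + K / (1 + (real n)\<^sup>2)" by (simp only: norm_divide norm_ii div_by_1)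
    qed
    show "(\<lambda>n. K / (1 + (real n)\<^sup>2) + K / (1 + (real n)\<^sup>2)) \<longlonglongrightarrow> 0" by real_asymp
  qed
  moreover have "(\<lambda>n. (F (Complex a (real n)) - F (Complex a (- real n))) / \<i>) \<longlonglongrightarrow> vline a F'"
    using truncated_integral_tendsto[OF int] unfolding i vline_def .
  ultimately show ?thesis using LIMSEQ_unique by blast
qed

text \<open>Used with c = 2 t for the outer integral of the weak formula of the exponential.\<close>

lemma integral_t_exp:
  fixes c :: real
  assumes c: "0 < c"
  shows "(LINT \<alpha>:{0<..}|lborel. \<alpha> * exp (- c * \<alpha>)) = 1 / c\<^sup>2"
proof -
  let ?f = "\<lambda>\<alpha>::real. \<alpha> * exp (- c * \<alpha>)"
  define F where "F \<alpha> = - (\<alpha> / c + 1 / c\<^sup>2) * exp (- c * \<alpha>)" for \<alpha> :: real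
  have "(\<integral>\<^sup>+ \<alpha>. ennreal (?f \<alpha>) * indicator {0..} \<alpha> \<partial>lborel) = ennreal (0 - F 0)"
  proof (rule nn_integral_FTC_atLeast)
    show "(F has_real_derivative ?f \<alpha>) (at \<alpha>)" for \<alpha>
      unfolding F_def using c by (auto intro!: derivative_eq_intros simp: field_simps power2_eq_square)
    show "(F \<longlongrightarrow> 0) at_top" unfolding F_def using c by real_asymp
  qed auto
  hence "(\<integral>\<^sup>+ \<alpha>. ennreal (indicator {0<..} \<alpha> *\<^sub>R ?f \<alpha>) \<partial>lborel) = ennreal (1 / c\<^sup>2)"
    by (auto simp: F_def indicator_def intro!: nn_integral_cong elim!: trans[rotated])
  thus ?thesis unfolding set_lebesgue_integral_def
    using c by (subst integral_eq_nn_integral) (auto simp: indicator_def)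
qed

section \<open>The semigroup law\<close>

abbreviation (input) exp_neg :: "real \<Rightarrow> complex \<Rightarrow> complex" where
  "exp_neg t \<equiv> \<lambda>z. exp (- (of_real t * z))"

lemma deriv_exp_neg: "deriv (exp_neg t) z = - of_real t * exp (- (of_real t * z :: complex))"
  by (rule DERIV_imp_deriv) (auto intro!: derivative_eq_intros)

context gsf_family
begin

text \<open>The resolvent identity between \<open>z\<close> and 1 trades each \<open>R 1\<close> for
  a factor 1 / (z - 1) and a remainder. Terms without \<open>R z\<close> are constants or powers of
  1 / (z - 1) and contribute nothing to \<open>exp_line\<close>; explicit exponents such as
  \<open>^ 1\<close> match the lemma that shows this.\<close>

lemma R_R_R1_R1_expansion:
  assumes z: "0 < Re z" "z \<noteq> 1" and \<phi>: "\<phi> \<in> dual_space"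
  shows "\<phi> (R z (R z (R 1 (R 1 x)))) = (\<phi> (R z (R z x)) + 2 * \<phi> (R z x) * (1 / (z - 1))
     - 2 * \<phi> (R 1 x) * (1 / (z - 1)) + \<phi> (R 1 (R 1 x))) / (z - 1)\<^sup>2" (is ?A)
    and "\<phi> (R z (R 1 (R 1 x))) = (\<phi> (R z x) * (1 / (z - 1)) ^ 2 - \<phi> (R 1 x) * (1 / (z - 1)) ^ 2)
     - (- \<phi> (R 1 (R 1 x))) * (1 / (z - 1)) ^ 1" (is ?B)
proof -
  have e: "\<phi> (R z (R 1 v)) = (\<phi> (R z v) - \<phi> (R 1 v)) / (1 - z)" for v
    using z \<phi> R_R_eq[of z 1 v] by (simp add: dual_cscale dual_diff)
  have 1: "\<phi> (R z (R 1 x)) = (\<phi> (R z x) - \<phi> (R 1 x)) / (1 - z)" by (rule e)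
  have 2: "\<phi> (R z (R 1 (R 1 x))) = ((\<phi> (R z x) - \<phi> (R 1 x)) / (1 - z) - \<phi> (R 1 (R 1 x))) / (1 - z)"
    unfolding e[of "R 1 x"] 1 ..
  have c: "R 1 (R z v) = R z (R 1 v)" for v using z by (intro R_commute) auto
  have "R z (R z (R 1 (R 1 x))) = R z (R 1 (R z (R 1 x)))" by (simp add: c)
  hence "\<phi> (R z (R z (R 1 (R 1 x)))) = (\<phi> (R z (R z (R 1 x))) - \<phi> (R 1 (R z (R 1 x)))) / (1 - z)"
    using e[of "R z (R 1 x)"] by simp
  also have "R 1 (R z (R 1 x)) = R z (R 1 (R 1 x))" by (rule c)
  also have "R z (R z (R 1 x)) = R z (R 1 (R z x))" by (simp add: c)
  also have "\<phi> (R z (R 1 (R z x))) = (\<phi> (R z (R z x)) - \<phi> (R 1 (R z x))) / (1 - z)" by (rule e)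
  also have "R 1 (R z x) = R z (R 1 x)" by (rule c)
  finally have 3: "\<phi> (R z (R z (R 1 (R 1 x)))) =
    ((\<phi> (R z (R z x)) - (\<phi> (R z x) - \<phi> (R 1 x)) / (1 - z)) / (1 - z) -
     ((\<phi> (R z x) - \<phi> (R 1 x)) / (1 - z) - \<phi> (R 1 (R 1 x))) / (1 - z)) / (1 - z)"
    unfolding 1 2 .
  \<comment> \<open>In terms of \<open>u\<close> both claims become polynomial identities.\<close>
  define u where "u = 1 / (z - 1)"
  have u: "1 / (1 - z) = - u" using z by (simp add: u_def divide_simps)
  have d: "a / (1 - z) = - (a * u)" for a
    using u by (metis mult_minus_right times_divide_eq_right mult.right_neutral)
  have d2: "a / (z - 1)\<^sup>2 = a * u\<^sup>2" for a by (simp add: u_def power_divide)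
  show ?A unfolding 3 d d2 u_def[symmetric] by (simp add: algebra_simps power2_eq_square)
  show ?B unfolding 2 d u_def[symmetric] by (simp add: algebra_simps power2_eq_square)
qed

lemma bounded_on_line_R:
  assumes "0 < a" "\<phi> \<in> dual_space"
  shows "bounded_on_line a (\<lambda>z. \<phi> (R z x))"
proof (rule bounded_on_lineI)
  show "continuous_on {z. Re z = a} (\<lambda>z. \<phi> (R z x))"
    by (rule continuous_on_subset[OF holomorphic_on_imp_continuous_on[OF holomorphic_R_dual[OF assms(2)]]])
      (use assms in \<open>auto simp: rhp_def\<close>)
  show "cmod (\<phi> (R z x)) \<le> onorm \<phi> * (2 * C * norm x)" if "Re z = a" for z
    using that assms
    by (intro order.trans[OF dual_bound[OF assms(2)]] mult_left_mono R_uniform_bound dual_onorm_nonneg) auto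
qed

lemma bounded_on_line_R_R:
  assumes "0 < a" "\<phi> \<in> dual_space"
  shows "bounded_on_line a (\<lambda>z. \<phi> (R z (R z x)))"
proof (rule bounded_on_lineI)
  show "continuous_on {z. Re z = a} (\<lambda>z. \<phi> (R z (R z x)))"
    by (rule continuous_on_subset[OF holomorphic_on_imp_continuous_on[OF holomorphic_R_R_dual[OF assms(2)]]])
      (use assms in \<open>auto simp: rhp_def\<close>)
  show "cmod (\<phi> (R z (R z x))) \<le> onorm \<phi> * (2 * C * (2 * C * norm x))" if z: "Re z = a" for z
  proof -
    have "norm (R z (R z x)) \<le> 2 * C * norm (R z x)" using z assms by (intro R_uniform_bound) simp
    also have "\<dots> \<le> 2 * C * (2 * C * norm x)"
      using z assms C_nonneg by (intro mult_left_mono R_uniform_bound) auto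
    finally have "onorm \<phi> * norm (R z (R z x)) \<le> onorm \<phi> * (2 * C * (2 * C * norm x))"
      by (intro mult_left_mono dual_onorm_nonneg assms)
    thus ?thesis using dual_bound[OF assms(2), of "R z (R z x)"] by simp
  qed
qed

text \<open>Integration by parts; the terms of the expansion without \<open>R z\<close> integrate to zero.\<close>

lemma vline_exp_R_R_core:
  assumes t: "0 < t" and a: "0 < a" "a < 1" and \<phi>: "\<phi> \<in> dual_space"
  shows "vline a (\<lambda>z. exp (of_real t * z) * \<phi> (R z (R z (R 1 (R 1 x)))))
    = of_real t * exp_line a t (\<lambda>z. \<phi> (R z x))"
proof -
  let ?p = "\<lambda>z. \<phi> (R z x)" and ?r = "\<lambda>z. 1 / (z - 1) :: complex"
  \<comment> \<open>Chosen so that exp (t z) q(z) / (z - 1)^2 is the derivative of exp (t z) \<phi>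
    (R z x) / (z - 1)^2.\<close>
  define q where "q z = (of_real t * ?p z - 2 * ?p z * ?r z) - \<phi> (R z (R z x))" for z
  define F where "F z = exp (of_real t * z) * ?p z / (z - 1)\<^sup>2" for z
  have t0: "0 \<le> t" using t by simp
  have b1: "bounded_on_line a ?p" by (rule bounded_on_line_R[OF a(1) \<phi>])
  have br: "bounded_on_line a ?r" using a by (intro bounded_on_line_inverse) simp
  have bt: "bounded_on_line a (\<lambda>z. of_real t * ?p z)"
    by (intro bounded_on_line_mult bounded_on_line_const b1)
  have bq: "bounded_on_line a q" unfolding q_def
    by (intro bounded_on_line_diff bounded_on_line_mult bounded_on_line_const b1 br
        bounded_on_line_R_R a \<phi>)
  have "exp_line a t q = 0"
  proof -
    have "vline a (\<lambda>z. exp (of_real t * z) * q z / (z - 1)\<^sup>2) = 0"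
    proof -
      obtain K where K: "\<And>\<beta>. cmod (F (Complex a \<beta>)) \<le> K / (1 + \<beta>\<^sup>2)"
        using exp_kernel_bound[OF t0 a(2) b1] unfolding F_def by blast
      have der: "(F has_field_derivative exp (of_real t * z) * q z / (z - 1)\<^sup>2) (at z)"
        if z: "0 < Re z" "z \<noteq> 1" for z
      proof -
        define u where "u = 1 / (z - 1)"
        have "((\<lambda>z. 1 / (z - 1)) has_field_derivative (0 * (z - 1) - 1 * (1 - 0)) / ((z - 1) * (z - 1))) (at z)"
          using z(2) by (intro DERIV_divide DERIV_diff DERIV_const DERIV_ident) auto
        hence r: "(?r has_field_derivative - (u * u)) (at z)" by (simp add: u_def)
        have e: "((\<lambda>z. exp (of_real t * z)) has_field_derivative of_real t * exp (of_real t * z)) (at z)"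
          by (auto intro!: derivative_eq_intros)
        note D = DERIV_mult[OF DERIV_mult[OF e R_dual_has_derivative[OF z(1) \<phi>, of x]] DERIV_mult[OF r r]]
        have d2: "v / (z - 1)\<^sup>2 = v * (u * u)" for v by (simp add: u_def power2_eq_square)
        have "((\<lambda>z. exp (of_real t * z) * ?p z * (?r z * ?r z)) has_field_derivative
          exp (of_real t * z) * q z / (z - 1)\<^sup>2) (at z)"
          by (rule DERIV_cong[OF D])
            (simp only: d2 u_def[symmetric] q_def, simp add: algebra_simps)
        thus ?thesis unfolding F_def by (simp add: power2_eq_square)
      qed
      show ?thesis
        by (rule vline_deriv_eq_zero[OF der K exp_line_integrable[OF t0 a(2) bq]])
          (use a in \<open>auto simp: complex_eq_iff\<close>)
    qed
    thus ?thesis by (simp add: exp_line_def)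
  qed
  \<comment> \<open>This is (z - 1)^2 times \<open>\<phi> (R z (R z (R 1 (R 1 x))))\<close>,
    arranged so that only the term with the factor t survives integration.\<close>
  define w where "w z = (of_real t * ?p z - q z) - (2 * \<phi> (R 1 x) * ?r z ^ 1 - \<phi> (R 1 (R 1 x)))" for z
  have b4: "bounded_on_line a (\<lambda>z. 2 * \<phi> (R 1 x) * ?r z ^ 1)"
    unfolding power_one_right by (intro bounded_on_line_mult bounded_on_line_const br)
  have b2: "bounded_on_line a (\<lambda>z. of_real t * ?p z - q z)"
    by (intro bounded_on_line_diff bt bq)
  have b3: "bounded_on_line a (\<lambda>z. 2 * \<phi> (R 1 x) * ?r z ^ 1 - \<phi> (R 1 (R 1 x)))"
    by (intro bounded_on_line_diff bounded_on_line_const b4)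
  have "exp_line a t w = (exp_line a t (\<lambda>z. of_real t * ?p z) - exp_line a t q)
      - (exp_line a t (\<lambda>z. 2 * \<phi> (R 1 x) * ?r z ^ 1) - exp_line a t (\<lambda>_. \<phi> (R 1 (R 1 x))))"
    unfolding w_def exp_line_diff[OF t0 a(2) b2 b3] exp_line_diff[OF t0 a(2) bt bq]
      exp_line_diff[OF t0 a(2) b4 bounded_on_line_const] ..
  also have "\<dots> = of_real t * exp_line a t ?p"
    unfolding exp_line_cmult
    using \<open>exp_line a t q = 0\<close> exp_line_const[OF t a(2)] exp_line_inverse_power[OF t a(2), of 1]
    by simp
  finally have "exp_line a t w = of_real t * exp_line a t ?p" .
  moreover have "exp (of_real t * z) * \<phi> (R z (R z (R 1 (R 1 x)))) = exp (of_real t * z) * w z / (z - 1)\<^sup>2"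
    if "Re z = a" for z
    using that a by (subst R_R_R1_R1_expansion(1)[OF _ _ \<phi>]) (auto simp: w_def q_def algebra_simps)
  hence "vline a (\<lambda>z. exp (of_real t * z) * \<phi> (R z (R z (R 1 (R 1 x))))) = exp_line a t w"
    unfolding exp_line_def vline_def by simp
  ultimately show ?thesis by simp
qed

text \<open>After reflecting \<beta>, the derivative of the exponential is -t exp (-2 t \<alpha>)
  exp (t z), so the inner integral is exp (-2 t \<alpha>) times a line integral that a contour shift
  shows to be independent of \<alpha>. The outer integral gives 1 / (2 t)^2 and integration by parts
  another t, so the powers of t cancel and 2 / pi becomes 1 / (2 pi).\<close>

lemma B_form_exp_core:
  assumes t: "0 < t" and b: "0 < b" "b < 1" and \<phi>: "\<phi> \<in> dual_space"
  shows "- of_real (2 / pi) * B_form (exp_neg t) \<phi> (R 1 (R 1 x))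
    = exp_line b t (\<lambda>z. \<phi> (R z x)) / of_real (2 * pi)"
proof -
  define y where "y = R 1 (R 1 x)"
  define g where "g z = \<phi> (R z (R z y))" for z
  define E where "E z = exp (of_real t * z) * g z" for z
  obtain K where K: "K \<ge> 0"
    "\<And>z x. 0 < Re z \<Longrightarrow> norm (R z (R z (R 1 (R 1 x)))) \<le> K / (1 + cmod z)\<^sup>2 * norm x"
    using R_R_R1_R1_decay by blast
  define k where "k = onorm \<phi> * (K * norm x)"
  have k: "k \<ge> 0" unfolding k_def using K by (intro mult_nonneg_nonneg dual_onorm_nonneg \<phi>) auto
  have gb: "cmod (g z) \<le> k / (1 + (Im z)\<^sup>2)" if z: "0 < Re z" for z
  proof -
    have "1 + (Im z)\<^sup>2 \<le> (1 + cmod z)\<^sup>2"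
    proof -
      have "(Im z)\<^sup>2 \<le> (cmod z)\<^sup>2" using abs_Im_le_cmod[of z] by (metis abs_norm_cancel abs_le_square_iff)
      moreover have "(1 + cmod z)\<^sup>2 = 1 + 2 * cmod z + (cmod z)\<^sup>2" by (simp add: power2_sum)
      moreover have "cmod z \<ge> 0" by simp
      ultimately show ?thesis by linarith
    qed
    hence "K * norm x / (1 + cmod z)\<^sup>2 \<le> K * norm x / (1 + (Im z)\<^sup>2)"
      using K by (intro divide_left_mono mult_pos_pos zero_less_power add_pos_nonneg) auto
    hence "onorm \<phi> * norm (R z (R z y)) \<le> onorm \<phi> * (K * norm x / (1 + (Im z)\<^sup>2))"
      using K(2)[OF z, of x] unfolding y_def by (intro mult_left_mono dual_onorm_nonneg \<phi>) auto
    thus ?thesis using dual_bound[OF \<phi>, of "R z (R z y)"] by (simp add: g_def k_def)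
  qed
  have E: "E holomorphic_on rhp" unfolding E_def g_def
    by (intro holomorphic_intros holomorphic_R_R_dual \<phi>)
  have shift: "vline a2 E = vline a1 E" if a: "0 < a1" "a1 \<le> a2" for a1 a2
  proof (rule vline_shift[OF open_rhp convex_rhp E a(2)])
    show "cmod (E z) \<le> (exp (t * a2) * k) / (1 + (Im z)\<^sup>2)" if "a1 \<le> Re z" "Re z \<le> a2" for z
    proof -
      have "cmod (E z) = exp (t * Re z) * cmod (g z)" by (simp add: E_def norm_mult)
      also have "\<dots> \<le> exp (t * a2) * (k / (1 + (Im z)\<^sup>2))"
        using that a t by (intro mult_mono gb) auto
      finally show ?thesis by simp
    qed
  qed (use a in \<open>auto simp: rhp_def\<close>)
  have const: "vline \<alpha> E = vline b E" if "\<alpha> > 0" for \<alpha>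
    using shift[of \<alpha> b] shift[of b \<alpha>] that b by (cases "\<alpha> \<le> b") auto
  have inner: "(LINT \<beta>|lborel. \<phi> (RR (Complex \<alpha> (- \<beta>)) y) *
      deriv (exp_neg t) (Complex \<alpha> \<beta>)) = of_real (- t * exp (- (2 * t) * \<alpha>)) * vline b E"
    if \<alpha>: "\<alpha> > 0" for \<alpha>
  proof -
    have "(LINT \<beta>|lborel. \<phi> (RR (Complex \<alpha> (- \<beta>)) y) *
      deriv (exp_neg t) (Complex \<alpha> \<beta>)) =
      (LINT \<beta>|lborel. g (Complex \<alpha> \<beta>) * (- of_real t * exp (- (of_real t * Complex \<alpha> (- \<beta>)))))"
      unfolding deriv_exp_neg g_def
      by (subst lborel_integral_real_affine[where c = "- 1" and t = 0]) simp_all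
    also have "\<dots> = (LINT \<beta>|lborel. of_real (- t * exp (- (2 * t) * \<alpha>)) * E (Complex \<alpha> \<beta>))"
    proof (intro Bochner_Integration.integral_cong refl)
      fix \<beta> :: real
      have "- (of_real t * Complex \<alpha> (- \<beta>)) = of_real (- (2 * t) * \<alpha>) + of_real t * Complex \<alpha> \<beta>"
        by (simp add: complex_eq_iff)
      hence "exp (- (of_real t * Complex \<alpha> (- \<beta>))) =
          of_real (exp (- (2 * t) * \<alpha>)) * exp (of_real t * Complex \<alpha> \<beta>)"
        by (metis exp_add exp_of_real)
      thus "g (Complex \<alpha> \<beta>) * (- of_real t * exp (- (of_real t * Complex \<alpha> (- \<beta>)))) =
        of_real (- t * exp (- (2 * t) * \<alpha>)) * E (Complex \<alpha> \<beta>)"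
        unfolding E_def by simp
    qed
    also have "\<dots> = of_real (- t * exp (- (2 * t) * \<alpha>)) * vline \<alpha> E"
      unfolding vline_def by (rule integral_mult_right_zero)
    finally show ?thesis unfolding const[OF \<alpha>] .
  qed
  have "B_form (exp_neg t) \<phi> y =
    (LINT \<alpha>|lborel. (- of_real t * vline b E) * of_real (indicator {0<..} \<alpha> *\<^sub>R (\<alpha> * exp (- (2 * t) * \<alpha>))))"
    unfolding B_form_def set_lebesgue_integral_def
    by (intro Bochner_Integration.integral_cong refl)
      (auto simp: inner indicator_def)
  also have "\<dots> = (- of_real t * vline b E) * of_real (LINT \<alpha>:{0<..}|lborel. \<alpha> * exp (- (2 * t) * \<alpha>))"
    unfolding set_lebesgue_integral_def by (simp only: integral_mult_right_zero integral_complex_of_real)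
  also have "(LINT \<alpha>:{0<..}|lborel. \<alpha> * exp (- (2 * t) * \<alpha>)) = 1 / (2 * t)\<^sup>2"
    using t by (intro integral_t_exp) simp
  finally have 1: "B_form (exp_neg t) \<phi> y = - of_real t * vline b E * of_real (1 / (2 * t)\<^sup>2)" .
  have 2: "vline b E = of_real t * exp_line b t (\<lambda>z. \<phi> (R z x))"
    unfolding E_def g_def y_def by (rule vline_exp_R_R_core[OF t b \<phi>])
  show ?thesis unfolding y_def[symmetric] 1 2 using t by (simp add: field_simps power2_eq_square)
qed

end

section \<open>Norm and value at infinity of the exponential\<close>

lemma deriv_sup_exp_neg:
  assumes "0 < t"
  shows "deriv_sup (exp_neg t) \<alpha> \<le> ennreal (t * exp (- t * \<alpha>))"
  unfolding deriv_sup_def deriv_exp_neg using assms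
  by (intro SUP_least ennreal_leI) (simp add: norm_mult)

lemma nn_integral_deriv_sup_exp_neg:
  assumes t: "0 < t"
  shows "B0_norm (exp_neg t) \<le> 1"
proof -
  have "(\<integral>\<^sup>+ \<alpha>. ennreal (t * exp (- t * \<alpha>)) * indicator {0..} \<alpha> \<partial>lborel) = ennreal (0 - (- exp (- t * 0)))"
  proof (rule nn_integral_FTC_atLeast)
    show "((\<lambda>\<alpha>. - exp (- t * \<alpha>)) has_real_derivative t * exp (- t * \<alpha>)) (at \<alpha>)" for \<alpha>
      by (auto intro!: derivative_eq_intros)
    show "((\<lambda>\<alpha>. - exp (- t * \<alpha>)) \<longlongrightarrow> 0) at_top" using t by real_asymp
  qed (use t in auto)
  moreover have "B0_norm (exp_neg t)
      \<le> (\<integral>\<^sup>+ \<alpha>. ennreal (t * exp (- t * \<alpha>)) * indicator {0..} \<alpha> \<partial>lborel)"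
    using deriv_sup_exp_neg[OF t] by (intro nn_integral_mono) (auto simp: indicator_def)
  ultimately show ?thesis by simp
qed

text \<open>Limits along Re z to infinity are unique because \<open>Re\<close> is onto, which makes
  the filter proper.\<close>

lemma val_infty_eqI: "(f \<longlongrightarrow> l) (filtercomap Re at_top) \<Longrightarrow> val_infty f = l"
proof -
  have "filtercomap Re at_top \<noteq> (bot :: complex filter)"
    by (intro filtercomap_neq_bot_surj) (auto simp: surj_def intro: complex.sel(1)[symmetric])
  thus "(f \<longlongrightarrow> l) (filtercomap Re at_top) \<Longrightarrow> val_infty f = l"
    unfolding val_infty_def by (intro tendsto_Lim)
qed

lemma val_infty_exp_neg:
  assumes t: "0 < t"
  shows "val_infty (exp_neg t) = 0"
proof (rule val_infty_eqI, rule tendsto_norm_zero_cancel)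
  have "((\<lambda>x. exp (- (t * x))) \<longlongrightarrow> 0) at_top" using t by real_asymp
  hence "((\<lambda>z. exp (- (t * Re z))) \<longlongrightarrow> 0) (filtercomap Re at_top)"
    by (rule filterlim_compose[OF _ filterlim_filtercomap])
  thus "((\<lambda>z. cmod (exp (- (of_real t * z)))) \<longlongrightarrow> 0) (filtercomap Re at_top)" by simp
qed

lemma integrable_product_bound:
  fixes f :: "real \<times> real \<Rightarrow> complex"
  assumes f: "continuous_on UNIV f" and K: "0 \<le> K"
    and bound: "\<And>x y. cmod (f (x, y)) \<le> K / (1 + x\<^sup>2) / (1 + y\<^sup>2)"
  shows "integrable (lborel \<Otimes>\<^sub>M lborel) f"
proof (rule integrableI_bounded)
  have m: "f \<in> borel_measurable (lborel \<Otimes>\<^sub>M lborel)"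
    using borel_measurable_continuous_onI[OF f] by (simp add: lborel_prod)
  thus "f \<in> borel_measurable (lborel \<Otimes>\<^sub>M lborel)" .
  let ?u = "\<lambda>x::real. ennreal (1 / (1\<^sup>2 + x\<^sup>2))"
  have u: "(\<integral>\<^sup>+ x. ?u x \<partial>lborel) \<le> ennreal pi" by (rule nn_integral_poisson_kernel) simp
  have "(\<integral>\<^sup>+ p. ennreal (cmod (f p)) \<partial>(lborel \<Otimes>\<^sub>M lborel)) = (\<integral>\<^sup>+ x. \<integral>\<^sup>+ y. ennreal (cmod (f (x, y))) \<partial>lborel \<partial>lborel)"
    by (rule lborel.nn_integral_fst[symmetric,
          OF measurable_compose[OF measurable_compose[OF m borel_measurable_norm] measurable_ennreal]])
  also have "\<dots> \<le> (\<integral>\<^sup>+ x. \<integral>\<^sup>+ y. (ennreal K * ?u x) * ?u y \<partial>lborel \<partial>lborel)"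
  proof (intro nn_integral_mono)
    fix x y :: real
    have "ennreal (cmod (f (x, y))) \<le> ennreal (K / (1 + x\<^sup>2) / (1 + y\<^sup>2))" by (intro ennreal_leI bound)
    also have "\<dots> = (ennreal K * ?u x) * ?u y"
      using K by (simp flip: ennreal_mult)
    finally show "ennreal (cmod (f (x, y))) \<le> (ennreal K * ?u x) * ?u y" .
  qed
  also have "\<dots> = (\<integral>\<^sup>+ x. (ennreal K * ?u x) * (\<integral>\<^sup>+ y. ?u y \<partial>lborel) \<partial>lborel)"
    by (intro nn_integral_cong nn_integral_cmult) simp
  also have "\<dots> = (ennreal K * (\<integral>\<^sup>+ x. ?u x \<partial>lborel)) * (\<integral>\<^sup>+ y. ?u y \<partial>lborel)"
    by (simp add: nn_integral_multc nn_integral_cmult)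
  also have "\<dots> \<le> (ennreal K * ennreal pi) * ennreal pi" by (intro mult_mono mult_left_mono u) auto
  also have "\<dots> < \<infinity>" by (simp add: ennreal_mult_less_top)
  finally show "(\<integral>\<^sup>+ p. ennreal (cmod (f p)) \<partial>(lborel \<Otimes>\<^sub>M lborel)) < \<infinity>" .
qed

section \<open>Operators given by the weak formula, and the product of two exponentials\<close>

context gsf_family
begin

text \<open>The condition inside the definite description of \<open>B_calc\<close>, as a predicate:
  existence, uniqueness and norm bounds can then be treated separately.\<close>

definition calc_rep :: "(complex \<Rightarrow> complex) \<Rightarrow> ('a \<Rightarrow> 'a) \<Rightarrow> bool" where
  "calc_rep f T \<longleftrightarrow> bounded_linear T \<and>
     (\<forall>x. \<forall>\<phi>\<in>dual_space. \<phi> (T x) = val_infty f * \<phi> x - of_real (2 / pi) * B_form f \<phi> x)"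

lemma calc_rep_eq:
  "calc_rep f T \<Longrightarrow> \<phi> \<in> dual_space \<Longrightarrow> \<phi> (T x) = val_infty f * \<phi> x - of_real (2 / pi) * B_form f \<phi> x"
  unfolding calc_rep_def by blast

lemma calc_rep_unique: "calc_rep f S \<Longrightarrow> calc_rep f T \<Longrightarrow> S = T"
  by (intro ext dual_separates) (simp only: calc_rep_eq)

lemma B_form_commute:
  assumes z: "0 < Re z"
  shows "B_form f (\<lambda>x. \<phi> (R z x)) x = B_form f \<phi> (R z x)"
proof -
  have "R z (R w (R w x)) = R w (R w (R z x))" if "0 < Re w" for w
    using z that by (metis R_commute)
  thus ?thesis unfolding B_form_def set_lebesgue_integral_def
    by (intro Bochner_Integration.integral_cong refl) (auto simp: indicator_def)
qed

text \<open>\<open>R z\<close> may be moved from the vector into the functional, since the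
  composition is again in the dual and the form only sees products of commuting resolvents.\<close>

lemma calc_rep_commute:
  assumes T: "calc_rep f T" and z: "0 < Re z"
  shows "R z (T x) = T (R z x)"
proof (rule dual_separates)
  fix \<phi> :: "'a \<Rightarrow> complex" assume \<phi>: "\<phi> \<in> dual_space"
  have "(\<lambda>x. \<phi> (R z x)) (T x) = val_infty f * \<phi> (R z x) - of_real (2 / pi) * B_form f (\<lambda>x. \<phi> (R z x)) x"
    by (rule calc_rep_eq[OF T dual_comp_R[OF z \<phi>]])
  thus "\<phi> (R z (T x)) = \<phi> (T (R z x))"
    unfolding B_form_commute[OF z] calc_rep_eq[OF T \<phi>, of "R z x"] .
qed

lemma calc_rep_exp_core:
  assumes T: "calc_rep (exp_neg t) T" and t: "0 < t" and b: "0 < b" "b < 1"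
    and \<phi>: "\<phi> \<in> dual_space"
  shows "\<phi> (T (R 1 (R 1 x))) = exp_line b t (\<lambda>z. \<phi> (R z x)) / of_real (2 * pi)"
  using T \<phi> unfolding calc_rep_def val_infty_exp_neg[OF t] B_form_exp_core[OF t b \<phi>, of x, symmetric]
  by simp

text \<open>After exchanging the integrals, the inner one runs over Re z = a, and its singularities
  \<open>w\<close> and 1 both lie to the right of that line, so it vanishes. The gap
  \<open>b - a\<close> bounds 1 / (w - z) and so justifies Fubini.\<close>

lemma exp_line_fubini_zero:
  assumes t: "0 < t" and s: "0 < s" and ab: "0 < a" "a < b" "b < 1" and \<phi>: "\<phi> \<in> dual_space"
  shows "exp_line a t (\<lambda>z. exp_line b s (\<lambda>w. \<phi> (R w x) * (1 / (w - z)))) = 0"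
proof -
  have a1: "a < 1" using ab by simp
  define u where "u \<beta> = exp (of_real t * Complex a \<beta>) * 1 / (Complex a \<beta> - 1)\<^sup>2" for \<beta>
  define v where "v \<gamma> = exp (of_real s * Complex b \<gamma>) * \<phi> (R (Complex b \<gamma>) x) / (Complex b \<gamma> - 1)\<^sup>2" for \<gamma>
  define k where "k p = u (fst p) * v (snd p) * (1 / (Complex b (snd p) - Complex a (fst p)))" for p
  obtain Ku where Ku: "Ku \<ge> 0" "\<And>\<beta>. cmod (u \<beta>) \<le> Ku / (1 + \<beta>\<^sup>2)"
    using exp_kernel_bound[OF less_imp_le[OF t] a1 bounded_on_line_const[of a 1]] unfolding u_def by blast
  have bR: "bounded_on_line b (\<lambda>w. \<phi> (R w x))" using ab by (intro bounded_on_line_R \<phi>) simp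
  obtain Kv where Kv: "Kv \<ge> 0" "\<And>\<gamma>. cmod (v \<gamma>) \<le> Kv / (1 + \<gamma>\<^sup>2)"
    using exp_kernel_bound[OF less_imp_le[OF s] ab(3) bR] unfolding v_def by blast
  have cu: "continuous_on UNIV u"
    using continuous_on_vertical_line[OF exp_kernel_continuous[OF a1 bounded_on_line_const[of a 1], of t], of a]
    unfolding u_def by simp
  have cv: "continuous_on UNIV v"
    using continuous_on_vertical_line[OF exp_kernel_continuous[OF ab(3) bR, of s], of b]
    unfolding v_def by simp
  have ne: "Complex b \<gamma> - Complex a \<beta> \<noteq> 0" for \<beta> \<gamma> using ab by (simp add: complex_eq_iff)
  have cc: "continuous_on UNIV (\<lambda>p :: real \<times> real. Complex b (snd p) - Complex a (fst p))"
    unfolding Complex_eq by (intro continuous_intros)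
  have cont: "continuous_on UNIV k"
    unfolding k_def
    by (intro continuous_intros cc continuous_on_compose2[OF cu] continuous_on_compose2[OF cv])
      (use ne in auto)
  have i: "integrable (lborel \<Otimes>\<^sub>M lborel) (\<lambda>(x, y). k (x, y))"
    unfolding case_prod_eta
  proof (rule integrable_product_bound[OF cont, of "Ku * Kv * (1 / (b - a))"])
    fix \<beta> \<gamma> :: real
    have "b - a \<le> cmod (Complex b \<gamma> - Complex a \<beta>)"
      using abs_Re_le_cmod[of "Complex b \<gamma> - Complex a \<beta>"] by simp
    hence "1 / cmod (Complex b \<gamma> - Complex a \<beta>) \<le> 1 / (b - a)"
      using ab by (intro divide_left_mono) (auto intro!: mult_pos_pos)
    hence "cmod (k (\<beta>, \<gamma>)) \<le> (Ku / (1 + \<beta>\<^sup>2)) * (Kv / (1 + \<gamma>\<^sup>2)) * (1 / (b - a))"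
      unfolding k_def norm_mult fst_conv snd_conv norm_divide norm_one using Ku Kv
      by (intro mult_mono) auto
    thus "cmod (k (\<beta>, \<gamma>)) \<le> Ku * Kv * (1 / (b - a)) / (1 + \<beta>\<^sup>2) / (1 + \<gamma>\<^sup>2)"
      by (simp add: mult_ac)
  qed (use Ku Kv ab in auto)
  have "exp_line a t (\<lambda>z. exp_line b s (\<lambda>w. \<phi> (R w x) * (1 / (w - z)))) =
    (LINT \<beta>|lborel. u \<beta> * (LINT \<gamma>|lborel. v \<gamma> * (1 / (Complex b \<gamma> - Complex a \<beta>))))"
    unfolding exp_line_def vline_def u_def v_def by (simp add: mult_ac)
  also have "\<dots> = (LINT \<beta>|lborel. LINT \<gamma>|lborel. k (\<beta>, \<gamma>))"
    unfolding k_def fst_conv snd_conv mult.assoc integral_mult_right_zero ..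
  also have "\<dots> = (LINT \<gamma>|lborel. LINT \<beta>|lborel. k (\<beta>, \<gamma>))"
    by (rule lborel_pair.Fubini_integral[OF i, symmetric])
  also have "\<dots> = (LINT \<gamma>|lborel. v \<gamma> * exp_line a t (\<lambda>z. 1 / (Complex b \<gamma> - z)))"
  proof (intro Bochner_Integration.integral_cong refl)
    fix \<gamma> :: real
    have "k (\<beta>, \<gamma>) = v \<gamma> * (exp (of_real t * Complex a \<beta>) * (1 / (Complex b \<gamma> - Complex a \<beta>)) / (Complex a \<beta> - 1)\<^sup>2)" for \<beta>
      by (simp add: k_def u_def mult_ac)
    thus "(LINT \<beta>|lborel. k (\<beta>, \<gamma>)) = v \<gamma> * exp_line a t (\<lambda>z. 1 / (Complex b \<gamma> - z))"
      unfolding exp_line_def vline_def by (simp only: integral_mult_right_zero)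
  qed
  finally have E: "exp_line a t (\<lambda>z. exp_line b s (\<lambda>w. \<phi> (R w x) * (1 / (w - z)))) =
    (LINT \<gamma>|lborel. v \<gamma> * exp_line a t (\<lambda>z. 1 / (Complex b \<gamma> - z)))" .
  have z0: "exp_line a t (\<lambda>z. 1 / (Complex b \<gamma> - z)) = 0" for \<gamma>
  proof (rule exp_line_holomorphic_left[OF t, where c = b and Q = "1 / (b - a)"])
    show "(\<lambda>z. 1 / (Complex b \<gamma> - z)) holomorphic_on {z. Re z < b}" by (intro holomorphic_intros) auto
    show "cmod (1 / (Complex b \<gamma> - z)) \<le> 1 / (b - a)" if "Re z \<le> a" for z
    proof -
      have "b - a \<le> cmod (Complex b \<gamma> - z)"
        using abs_Re_le_cmod[of "Complex b \<gamma> - z"] that ab by simp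
      thus ?thesis unfolding norm_divide norm_one
        using ab by (intro divide_left_mono) (auto intro!: mult_pos_pos)
    qed
  qed (use ab in auto)
  show ?thesis unfolding E z0 by simp
qed

text \<open>Each of the two operators needs its own (1 + A)^-2 for the contour formula, hence four
  factors \<open>R 1\<close>. With z on the left line and w on the right one, the resolvent identity
  splits the product: the part with \<open>R z\<close> is evaluated by Cauchy's formula in w, the
  part with \<open>R w\<close> integrates to zero.\<close>

lemma calc_rep_exp_semigroup:
  assumes t: "0 < t" and s: "0 < s"
    and T: "calc_rep (exp_neg t) T"
    and S: "calc_rep (exp_neg s) S"
    and U: "calc_rep (exp_neg (t + s)) U"
  shows "T (S x) = U x"
proof -
  have bT: "bounded_linear T" and bS: "bounded_linear S" and bU: "bounded_linear U"
    using T S U by (auto simp: calc_rep_def)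
  \<comment> \<open>Any two numbers 0 < a < b < 1 would serve.\<close>
  define a b :: real where "a = 1 / 3" and "b = 2 / 3"
  have ab: "0 < a" "a < b" "b < 1" "a < 1" "0 < b" by (auto simp: a_def b_def)
  note t0 = less_imp_le[OF t] and s0 = less_imp_le[OF s]
  have core: "T (S (R 1 (R 1 (R 1 (R 1 x))))) = U (R 1 (R 1 (R 1 (R 1 x))))" for x
  proof (rule dual_separates)
    fix \<phi> :: "'a \<Rightarrow> complex" assume \<phi>: "\<phi> \<in> dual_space"
    let ?p = "\<lambda>z. \<phi> (R z x)" and ?c = "of_real (2 * pi) :: complex"
    define y where "y = S (R 1 (R 1 x))"
    have "S (R 1 (R 1 (R 1 (R 1 x)))) = R 1 (R 1 y)"
      unfolding y_def by (simp add: calc_rep_commute[OF S])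
    hence "\<phi> (T (S (R 1 (R 1 (R 1 (R 1 x)))))) = exp_line a t (\<lambda>z. \<phi> (R z y)) / ?c"
      using calc_rep_exp_core[OF T t ab(1,4) \<phi>, of y] by simp
    also have "exp_line a t (\<lambda>z. \<phi> (R z y)) = exp_line a t (\<lambda>z. ?p z * (exp (of_real s * z) / (z - 1)\<^sup>2))"
    proof -
      let ?X = "\<lambda>z. ?p z * (exp (of_real s * z) / (z - 1)\<^sup>2)"
      have bX: "bounded_on_line a ?X"
      proof (intro bounded_on_line_mult bounded_on_line_R ab \<phi>)
        have "bounded_on_line a (\<lambda>z. exp (of_real s * z) * (1 / (z - 1) * (1 / (z - 1))))"
        proof (intro bounded_on_line_mult bounded_on_line_inverse)
          show "bounded_on_line a (\<lambda>z. exp (of_real s * z))"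
            by (rule bounded_on_lineI[where Q = "exp (s * a)"]) (auto intro!: continuous_intros)
        qed (use ab in auto)
        thus "bounded_on_line a (\<lambda>z. exp (of_real s * z) / (z - 1)\<^sup>2)" by (simp add: power2_eq_square)
      qed
      have bY: "bounded_on_line a (\<lambda>z. \<phi> (R z y))" by (intro bounded_on_line_R ab \<phi>)
      have "exp_line a t (\<lambda>z. ?X z - \<phi> (R z y)) =
        exp_line a t (\<lambda>z. (1 / ?c) * exp_line b s (\<lambda>w. ?p w * (1 / (w - z))))"
      proof (rule exp_line_cong)
        fix z :: complex assume z: "Re z = a"
      have "\<phi> (R z y) = exp_line b s (\<lambda>w. \<phi> (R z (R w x))) / ?c"
        unfolding y_def using z ab by (intro calc_rep_exp_core[OF S s ab(5,3)] dual_comp_R \<phi>) simp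
      also have "exp_line b s (\<lambda>w. \<phi> (R z (R w x))) =
          exp_line b s (\<lambda>w. ?p z * (1 / (w - z)) - ?p w * (1 / (w - z)))"
      proof (rule exp_line_cong)
        fix w :: complex assume w: "Re w = b"
        have "R z (R w x) = cscale (1 / (w - z)) (R z x - R w x)"
          using z w ab by (intro R_R_eq) auto
        thus "\<phi> (R z (R w x)) = ?p z * (1 / (w - z)) - ?p w * (1 / (w - z))"
          using \<phi> by (simp add: dual_cscale dual_diff diff_divide_distrib)
      qed
      also have "\<dots> = ?p z * exp_line b s (\<lambda>w. 1 / (w - z)) - exp_line b s (\<lambda>w. ?p w * (1 / (w - z)))"
        using z ab
        by (subst exp_line_diff[OF s0 ab(3)])
          (auto intro!: bounded_on_line_mult bounded_on_line_const bounded_on_line_inverse bounded_on_line_R \<phi>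
            simp: exp_line_cmult simp del: times_divide_eq_right mult_1_right)
      also have "exp_line b s (\<lambda>w. 1 / (w - z)) = ?c * (exp (of_real s * z) / (z - 1)\<^sup>2)"
        unfolding exp_line_def using z ab by (intro vline_cauchy_exp s) auto
        finally show "?X z - \<phi> (R z y) = (1 / ?c) * exp_line b s (\<lambda>w. ?p w * (1 / (w - z)))"
          by (simp add: diff_divide_distrib)
      qed
      also have "\<dots> = 0"
        unfolding exp_line_cmult exp_line_fubini_zero[OF t s ab(1-3) \<phi>] by simp
      finally show ?thesis unfolding exp_line_diff[OF t0 ab(4) bX bY] by simp
    qed
    also have "exp_line a t (\<lambda>z. ?p z * (exp (of_real s * z) / (z - 1)\<^sup>2)) =
        exp_line a (t + s) (\<lambda>z. ?p z * (1 / (z - 1)) ^ 2)"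
    proof -
      have "exp (of_real t * z) * (?p z * (exp (of_real s * z) / (z - 1)\<^sup>2)) / (z - 1)\<^sup>2 =
        exp (of_real (t + s) * z) * (?p z * (1 / (z - 1)) ^ 2) / (z - 1)\<^sup>2" for z
        by (simp add: distrib_right exp_add power_divide)
      thus ?thesis unfolding exp_line_def by presburger
    qed
    finally have lhs: "\<phi> (T (S (R 1 (R 1 (R 1 (R 1 x)))))) = exp_line a (t + s) (\<lambda>z. ?p z * (1 / (z - 1)) ^ 2) / ?c"
      by simp
    have ts: "0 < t + s" "0 \<le> t + s" using t s by auto
    have br: "bounded_on_line a (\<lambda>z. (1 / (z - 1)) ^ n)" for n
    proof (induction n)
      case (Suc n)
      thus ?case unfolding power_Suc using ab by (intro bounded_on_line_mult bounded_on_line_inverse) auto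
    qed (simp add: bounded_on_line_const)
    \<comment> \<open>For \<open>U\<close> the contour formula consumes two of the four factors.
      Expanding the other two produces the same (z - 1)^-4 as the product, up to terms that
      integrate to zero.\<close>
    have "\<phi> (U (R 1 (R 1 (R 1 (R 1 x))))) = exp_line a (t + s) (\<lambda>z. \<phi> (R z (R 1 (R 1 x)))) / ?c"
      by (rule calc_rep_exp_core[OF U ts(1) ab(1,4) \<phi>])
    also have "exp_line a (t + s) (\<lambda>z. \<phi> (R z (R 1 (R 1 x)))) = exp_line a (t + s) (\<lambda>z.
        (?p z * (1 / (z - 1)) ^ 2 - \<phi> (R 1 x) * (1 / (z - 1)) ^ 2) - (- \<phi> (R 1 (R 1 x))) * (1 / (z - 1)) ^ 1)"
      by (rule exp_line_cong, rule R_R_R1_R1_expansion(2)[OF _ _ \<phi>]) (use ab in auto)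
    also have "\<dots> = (exp_line a (t + s) (\<lambda>z. ?p z * (1 / (z - 1)) ^ 2)
        - exp_line a (t + s) (\<lambda>z. \<phi> (R 1 x) * (1 / (z - 1)) ^ 2))
        - exp_line a (t + s) (\<lambda>z. (- \<phi> (R 1 (R 1 x))) * (1 / (z - 1)) ^ 1)"
    proof -
      have b1: "bounded_on_line a (\<lambda>z. ?p z * (1 / (z - 1)) ^ 2)"
        by (intro bounded_on_line_mult bounded_on_line_R br ab \<phi>)
      have b2: "bounded_on_line a (\<lambda>z. c * (1 / (z - 1)) ^ n)" for c n
        by (intro bounded_on_line_mult bounded_on_line_const br)
      show ?thesis
        unfolding exp_line_diff[OF ts(2) ab(4) bounded_on_line_diff[OF b1 b2] b2]
          exp_line_diff[OF ts(2) ab(4) b1 b2] ..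
    qed
    also have "\<dots> = exp_line a (t + s) (\<lambda>z. ?p z * (1 / (z - 1)) ^ 2)"
      unfolding exp_line_cmult exp_line_inverse_power[OF ts(1) ab(4)] by simp
    finally show "\<phi> (T (S (R 1 (R 1 (R 1 (R 1 x)))))) = \<phi> (U (R 1 (R 1 (R 1 (R 1 x)))))"
      unfolding lhs by (rule sym)
  qed
  have dense: "closure (range (\<lambda>x. R 1 (R 1 (R 1 (R 1 x))))) = UNIV"
    using closure_R1_image[OF closure_R1_image[OF dense_R1_R1]] by (simp add: image_comp o_def)
  have "closure (range (\<lambda>x. R 1 (R 1 (R 1 (R 1 x))))) \<subseteq> {x. T (S x) = U x}"
  proof (rule closure_minimal)
    show "closed {x. T (S x) = U x}"
      by (intro closed_Collect_eq bounded_linear.continuous_on[OF bT] bounded_linear.continuous_on[OF bS]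
          bounded_linear.continuous_on[OF bU] continuous_on_id)
  qed (use core in auto)
  thus ?thesis unfolding dense by auto
qed

end

section \<open>Decay\<close>

text \<open>Dilations preserve the filter in both directions, so both functions have exactly the
  same limits. As \<open>Lim\<close> is a definite description, the values agree even when no limit
  exists.\<close>

lemma val_infty_dilate:
  assumes t: "0 < t"
  shows "val_infty (\<lambda>z. f (of_real t * z)) = val_infty f"
proof -
  have scale: "filterlim (\<lambda>z. of_real r * z) (filtercomap Re at_top) (filtercomap Re at_top)"
    if r: "0 < r" for r :: real
  proof -
    have "filterlim (\<lambda>x::real. r * x) at_top at_top" using r by real_asymp
    hence "filterlim (\<lambda>z. r * Re z) at_top (filtercomap Re at_top)"
      by (rule filterlim_compose[OF _ filterlim_filtercomap])
    thus ?thesis by (simp add: filterlim_filtercomap_iff o_def)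
  qed
  have "((\<lambda>z. f (of_real t * z)) \<longlongrightarrow> l) (filtercomap Re at_top) \<longleftrightarrow> (f \<longlongrightarrow> l) (filtercomap Re at_top)" for l
  proof
    assume "((\<lambda>z. f (of_real t * z)) \<longlongrightarrow> l) (filtercomap Re at_top)"
    from filterlim_compose[OF this scale[of "1 / t"]] show "(f \<longlongrightarrow> l) (filtercomap Re at_top)"
      using t by (simp add: mult.assoc[symmetric] flip: of_real_mult)
  next
    assume "(f \<longlongrightarrow> l) (filtercomap Re at_top)"
    from filterlim_compose[OF this scale[OF t]]
    show "((\<lambda>z. f (of_real t * z)) \<longlongrightarrow> l) (filtercomap Re at_top)" .
  qed
  thus ?thesis unfolding val_infty_def Topological_Spaces.Lim_def by simp
qed

lemma holomorphic_dilate: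
  assumes f: "f holomorphic_on rhp" and t: "0 < t"
  shows "(\<lambda>z. f (of_real t * z)) holomorphic_on rhp"
proof -
  have "f \<circ> (\<lambda>z. of_real t * z) holomorphic_on rhp"
    using t by (intro holomorphic_on_compose_gen[OF _ f] holomorphic_intros) (auto simp: rhp_def)
  thus ?thesis by (simp add: o_def)
qed

lemma deriv_dilate:
  assumes f: "f holomorphic_on rhp" and t: "0 < t" and z: "0 < Re z"
  shows "deriv (\<lambda>z. f (of_real t * z)) z = of_real t * deriv f (of_real t * z)"
proof (rule DERIV_imp_deriv)
  have "(f has_field_derivative deriv f (of_real t * z)) (at (of_real t * z))"
    using t z by (intro holomorphic_derivI[OF f open_rhp]) (simp add: rhp_def)
  moreover have "((\<lambda>z. of_real t * z) has_field_derivative of_real t) (at z)"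
    by (auto intro!: derivative_eq_intros)
  ultimately have "(f \<circ> (\<lambda>z. of_real t * z) has_field_derivative deriv f (of_real t * z) * of_real t) (at z)"
    by (rule DERIV_chain)
  thus "((\<lambda>z. f (of_real t * z)) has_field_derivative of_real t * deriv f (of_real t * z)) (at z)"
    by (simp add: o_def mult.commute)
qed

lemma deriv_sup_dilate:
  assumes f: "f holomorphic_on rhp" and t: "0 < t" and \<alpha>: "0 < \<alpha>"
  shows "deriv_sup (\<lambda>z. f (of_real t * z)) \<alpha> \<le> ennreal t * deriv_sup f (t * \<alpha>)"
  unfolding deriv_sup_def[of "\<lambda>z. f (of_real t * z)"]
proof (rule SUP_least)
  fix \<beta> :: real
  have "of_real t * Complex \<alpha> \<beta> = Complex (t * \<alpha>) (t * \<beta>)" by (simp add: complex_eq_iff)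
  hence "cmod (deriv (\<lambda>z. f (of_real t * z)) (Complex \<alpha> \<beta>)) = t * cmod (deriv f (Complex (t * \<alpha>) (t * \<beta>)))"
    using t \<alpha> by (simp add: deriv_dilate[OF f t] norm_mult)
  thus "ennreal (cmod (deriv (\<lambda>z. f (of_real t * z)) (Complex \<alpha> \<beta>))) \<le> ennreal t * deriv_sup f (t * \<alpha>)"
    using t by (simp add: ennreal_mult mult_left_mono deriv_sup_upper)
qed

text \<open>The factor t from the chain rule is the Jacobian of the substitution s = t \<alpha>; the
  only trace of the dilation is the weight, now at s / t.\<close>

lemma nn_integral_deriv_sup_dilate:
  assumes f: "f holomorphic_on rhp" and t: "0 < t" and g: "g \<in> borel_measurable borel"
  shows "(\<integral>\<^sup>+ \<alpha>. g \<alpha> * (indicator {0<..} \<alpha> * deriv_sup (\<lambda>z. f (of_real t * z)) \<alpha>) \<partial>lborel)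
    \<le> (\<integral>\<^sup>+ s. g (s / t) * (indicator {0<..} s * deriv_sup f s) \<partial>lborel)"
proof -
  have m: "(\<lambda>s. g (s / t) * (indicator {0<..} s * deriv_sup f s)) \<in> borel_measurable borel"
    by (rule borel_measurable_times_ennreal[OF measurable_compose[OF _ g] measurable_deriv_sup[OF f]]) simp
  have "(\<integral>\<^sup>+ \<alpha>. g \<alpha> * (indicator {0<..} \<alpha> * deriv_sup (\<lambda>z. f (of_real t * z)) \<alpha>) \<partial>lborel)
    \<le> (\<integral>\<^sup>+ \<alpha>. ennreal t * (g ((0 + t * \<alpha>) / t) * (indicator {0<..} (0 + t * \<alpha>) * deriv_sup f (0 + t * \<alpha>))) \<partial>lborel)"
  proof (rule nn_integral_mono)
    fix \<alpha> :: real
    show "g \<alpha> * (indicator {0<..} \<alpha> * deriv_sup (\<lambda>z. f (of_real t * z)) \<alpha>)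
      \<le> ennreal t * (g ((0 + t * \<alpha>) / t) * (indicator {0<..} (0 + t * \<alpha>) * deriv_sup f (0 + t * \<alpha>)))"
    proof (cases "\<alpha> > 0")
      case True
      have "g \<alpha> * deriv_sup (\<lambda>z. f (of_real t * z)) \<alpha> \<le> g \<alpha> * (ennreal t * deriv_sup f (t * \<alpha>))"
        by (intro mult_left_mono deriv_sup_dilate f t True) simp
      thus ?thesis using True t by (simp add: mult_ac)
    qed simp
  qed
  also have "\<dots> = ennreal t * (\<integral>\<^sup>+ \<alpha>. g ((0 + t * \<alpha>) / t) * (indicator {0<..} (0 + t * \<alpha>) * deriv_sup f (0 + t * \<alpha>)) \<partial>lborel)"
    by (rule nn_integral_cmult, rule measurable_compose[OF _ m]) simp
  also have "\<dots> = (\<integral>\<^sup>+ s. g (s / t) * (indicator {0<..} s * deriv_sup f s) \<partial>lborel)"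
    using nn_integral_real_affine[OF m, of t 0] t by simp
  finally show ?thesis .
qed

text \<open>One value below exp (-1), at \<open>t0\<close>, gives the rate 1 / t0 by iteration. The
  additional factor exp 1 pays for rounding t / t0 down to an integer.\<close>

lemma exp_decay_of_submultiplicative:
  fixes N :: "real \<Rightarrow> real"
  assumes nn: "\<And>t. 0 \<le> t \<Longrightarrow> 0 \<le> N t" and bd: "\<And>t. 0 \<le> t \<Longrightarrow> N t \<le> M"
    and mult: "\<And>t s. 0 \<le> t \<Longrightarrow> 0 \<le> s \<Longrightarrow> N (t + s) \<le> N t * N s"
    and lim: "(N \<longlongrightarrow> 0) at_top"
  shows "\<exists>M \<omega>. \<omega> > 0 \<and> (\<forall>t\<ge>0. N t \<le> M * exp (- \<omega> * t))"
proof -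
  have "\<forall>\<^sub>F t in at_top. N t < exp (- 1)" using lim by (rule order_tendstoD) simp
  hence "\<forall>\<^sub>F t in at_top. N t < exp (- 1) \<and> t > 0" using eventually_gt_at_top[of 0] by (rule eventually_conj)
  then obtain t0 where t0: "N t0 < exp (- 1)" "t0 > 0"
    using eventually_happens'[OF trivial_limit_at_top_linorder] by blast
  have M: "0 \<le> M" using nn[of 0] bd[of 0] by simp
  have pow: "N (real n * t0 + r) \<le> exp (- real n) * M" if r: "0 \<le> r" for n r
  proof (induction n)
    case (Suc n)
    have "N (real (Suc n) * t0 + r) = N (t0 + (real n * t0 + r))" by (simp add: algebra_simps)
    also have "\<dots> \<le> N t0 * N (real n * t0 + r)" using r t0 by (intro mult) auto
    also have "\<dots> \<le> exp (- 1) * (exp (- real n) * M)"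
      using t0 r Suc.IH by (intro mult_mono nn) auto
    also have "\<dots> = exp (- real (Suc n)) * M" by (simp add: exp_add[symmetric] flip: mult.assoc)
    finally show ?case .
  qed (use bd[OF r] in simp)
  have "N t \<le> (M * exp 1) * exp (- (1 / t0) * t)" if t: "0 \<le> t" for t
  proof -
    define n where "n = nat \<lfloor>t / t0\<rfloor>"
    have n: "real n \<le> t / t0" "t / t0 < real n + 1"
      using t t0 unfolding n_def by (auto simp: floor_less_iff of_nat_nat)
    have "N (real n * t0 + (t - real n * t0)) \<le> exp (- real n) * M"
      using n(1) t0 by (intro pow) (simp add: field_simps)
    also have "\<dots> \<le> exp (1 - t / t0) * M" using n(2) M by (intro mult_right_mono) auto
    also have "\<dots> = (M * exp 1) * exp (- (1 / t0) * t)" by (simp add: exp_diff exp_minus field_simps)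
    finally show ?thesis by simp
  qed
  thus ?thesis using t0 by (intro exI[of _ "M * exp 1"] exI[of _ "1 / t0"]) auto
qed

context gsf_family
begin

text \<open>The constant 4 / pi is the 2 / pi of the formula times the 2 of the duality
  estimate.\<close>

lemma calc_rep_exists:
  assumes f: "f holomorphic_on rhp" and fin: "B0_norm f < \<infinity>"
    and v: "val_infty f = 0"
    and W: "weighted_B0_norm f \<le> ennreal W"
    and W0: "0 \<le> W"
  shows "\<exists>T. calc_rep f T \<and> onorm T \<le> 4 / pi * (C * W)"
proof -
  obtain T0 where T0: "bounded_linear T0" "\<And>x \<phi>. \<phi> \<in> dual_space \<Longrightarrow> \<phi> (T0 x) = B_form f \<phi> x"
    "onorm T0 \<le> 2 * (C * W)"
    using B_form_operator[OF f fin W W0] by blast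
  define T where "T = (\<lambda>x. (- (2 / pi)) *\<^sub>R T0 x)"
  have "calc_rep f T"
    unfolding calc_rep_def
  proof (intro conjI allI ballI)
    show "bounded_linear T"
      unfolding T_def by (rule bounded_linear_compose[OF bounded_linear_scaleR_right T0(1)])
    show "\<phi> (T x) = val_infty f * \<phi> x - of_real (2 / pi) * B_form f \<phi> x" if \<phi>: "\<phi> \<in> dual_space" for \<phi> x
      unfolding T_def dual_scaleR[OF \<phi>] T0(2)[OF \<phi>] v by (simp add: scaleR_conv_of_real)
  qed
  moreover have "onorm T = \<bar>- (2 / pi)\<bar> * onorm T0"
    unfolding T_def by (rule onorm_scaleR[OF T0(1)])
  hence "onorm T = 2 / pi * onorm T0" by simp
  moreover have "2 / pi * onorm T0 \<le> 2 / pi * (2 * (C * W))"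
    using T0(3) by (intro mult_left_mono) auto
  ultimately show ?thesis by auto
qed

text \<open>The weight s / (s + t) tends to 0 for every s and stays below 1, so dominated
  convergence applies with the supremum of |f'| as majorant. \<open>T\<close> is tied to the
  calculus only through \<open>calc_rep\<close>, so that \<open>B_calc\<close> can be inserted
  later.\<close>

lemma calc_rep_dilate_tendsto:
  assumes f: "f holomorphic_on rhp" and fin: "B0_norm f < \<infinity>"
    and v: "val_infty f = 0"
    and T: "\<And>t S. 0 < t \<Longrightarrow> calc_rep (\<lambda>z. f (of_real t * z)) S \<Longrightarrow> T t = S"
  shows "((\<lambda>t. onorm (T t)) \<longlongrightarrow> 0) at_top"
proof -
  let ?D = "\<lambda>s. indicator {0<..} s * deriv_sup f s"
  let ?g = "\<lambda>\<alpha>. ennreal (\<alpha> / (\<alpha> + 1))"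
  define w where "w t = (\<integral>\<^sup>+ s. ?g (s / t) * ?D s \<partial>lborel)" for t
  have mD: "?D \<in> borel_measurable lborel" using measurable_deriv_sup[OF f] by simp
  have gD: "?g (s / t) * ?D s \<le> ?D s" if "t > 0" for s t
  proof (cases "s > 0")
    case True
    have gen: "u / (u + 1) \<le> 1" if "u > 0" for u :: real using that by simp
    have "s / t / (s / t + 1) \<le> 1" using True that by (intro gen) simp
    hence "?g (s / t) * ?D s \<le> ennreal 1 * ?D s" by (intro mult_right_mono ennreal_leI) auto
    thus ?thesis by simp
  qed simp
  have w_fin: "w t < \<infinity>" if "t > 0" for t
    unfolding w_def by (rule le_less_trans[OF nn_integral_mono[OF gD[OF that]] fin])
  have wlim: "(w \<longlongrightarrow> 0) at_top"
  \<comment> \<open>Dominated convergence works along sequences; discarding the first N terms makes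
    all parameters positive.\<close>
  proof (rule tendsto_at_topI_sequentially)
    fix X :: "nat \<Rightarrow> real" assume X: "filterlim X at_top sequentially"
    have "\<forall>\<^sub>F n in sequentially. X n > 0" using X by (simp add: filterlim_at_top_dense)
    then obtain N where N: "\<And>n. n \<ge> N \<Longrightarrow> X n > 0" by (auto simp: eventually_sequentially)
    have "(\<lambda>n. \<integral>\<^sup>+ s. ?g (s / X (n + N)) * ?D s \<partial>lborel) \<longlonglongrightarrow> (\<integral>\<^sup>+ s. 0 \<partial>(lborel :: real measure))"
    proof (rule nn_integral_dominated_convergence[where w = ?D])
      show "AE s in lborel. ?g (s / X (n + N)) * ?D s \<le> ?D s" for n
        using N[of "n + N"] gD[of "X (n + N)"] by simp
      show "(\<lambda>s. ?g (s / X (n + N)) * ?D s) \<in> borel_measurable lborel" for n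
        by (rule borel_measurable_times_ennreal[OF _ mD]) simp
      \<comment> \<open>Multiplication in \<open>ennreal\<close> is not continuous at 0 times
        infinity, so the points with infinite supremum have to be excluded.\<close>
      have "AE s in lborel. ?D s \<noteq> \<infinity>" using fin mD by (intro nn_integral_noteq_infinite) auto
      thus "AE s in lborel. (\<lambda>n. ?g (s / X (n + N)) * ?D s) \<longlonglongrightarrow> 0"
      proof eventually_elim
        case (elim s)
        have XN: "filterlim (\<lambda>n. X (n + N)) at_top sequentially"
          using X by (rule filterlim_compose) (rule filterlim_add_const_nat_at_top)
        have "((\<lambda>x. s / x / (s / x + 1)) \<longlongrightarrow> 0) at_top" by real_asymp
        from filterlim_compose[OF this XN]
        have "(\<lambda>n. ?g (s / X (n + N))) \<longlonglongrightarrow> ennreal 0" by (rule tendsto_ennrealI)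
        hence "(\<lambda>n. ?g (s / X (n + N)) * ?D s) \<longlonglongrightarrow> ennreal 0 * ?D s"
          using elim by (intro tendsto_mult_ennreal tendsto_const) auto
        thus ?case by simp
      qed
    qed (use fin mD in auto)
    hence "(\<lambda>n. w (X (n + N))) \<longlonglongrightarrow> 0" unfolding w_def by simp
    thus "(\<lambda>n. w (X n)) \<longlonglongrightarrow> 0" by (rule LIMSEQ_offset)
  qed
  have bound: "norm (onorm (T t)) \<le> 4 / pi * (C * enn2real (w t))" if t: "t > 0" for t
  proof -
    have h: "(\<lambda>z. f (of_real t * z)) holomorphic_on rhp" by (rule holomorphic_dilate[OF f t])
    have "B0_norm (\<lambda>z. f (of_real t * z)) \<le> (\<integral>\<^sup>+ s. ?D s \<partial>lborel)"
      using nn_integral_deriv_sup_dilate[OF f t, of "\<lambda>_. 1"] by simp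
    hence fin': "B0_norm (\<lambda>z. f (of_real t * z)) < \<infinity>"
      using fin by (rule le_less_trans)
    have "(\<integral>\<^sup>+ \<alpha>. ?g \<alpha> * (indicator {0<..} \<alpha> * deriv_sup (\<lambda>z. f (of_real t * z)) \<alpha>) \<partial>lborel) \<le> w t"
      unfolding w_def by (rule nn_integral_deriv_sup_dilate[OF f t]) simp
    also have "w t = ennreal (enn2real (w t))" using w_fin[OF t] by simp
    finally have W: "(\<integral>\<^sup>+ \<alpha>. ?g \<alpha> * (indicator {0<..} \<alpha> * deriv_sup (\<lambda>z. f (of_real t * z)) \<alpha>) \<partial>lborel)
      \<le> ennreal (enn2real (w t))" .
    have v': "val_infty (\<lambda>z. f (of_real t * z)) = 0" unfolding val_infty_dilate[OF t] by (rule v)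
    obtain S where S: "calc_rep (\<lambda>z. f (of_real t * z)) S" "onorm S \<le> 4 / pi * (C * enn2real (w t))"
      using calc_rep_exists[OF h fin' v' W enn2real_nonneg] by blast
    have "T t = S" by (rule T[OF t S(1)])
    moreover have "0 \<le> onorm S" using S(1) by (intro onorm_pos_le) (simp add: calc_rep_def)
    ultimately show ?thesis using S(2) by simp
  qed
  show ?thesis
  proof (rule Lim_null_comparison)
    show "\<forall>\<^sub>F t in at_top. norm (onorm (T t)) \<le> 4 / pi * (C * enn2real (w t))"
      using eventually_gt_at_top[of 0] by eventually_elim (rule bound)
    have "((\<lambda>t. enn2real (w t)) \<longlongrightarrow> 0) at_top"
      by (rule tendsto_enn2real) (use wlim in auto)
    hence "((\<lambda>t. 4 / pi * (C * enn2real (w t))) \<longlongrightarrow> 4 / pi * (C * 0)) at_top"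
      by (intro tendsto_mult_left)
    thus "((\<lambda>t. 4 / pi * (C * enn2real (w t))) \<longlongrightarrow> 0) at_top" by simp
  qed
qed

text \<open>The exponential at t = 0: the derivative vanishes, and the value 1 at infinity gives the
  identity.\<close>

lemma calc_rep_one: "calc_rep (\<lambda>_. 1) (\<lambda>x. x)"
proof -
  have "val_infty (\<lambda>_. 1) = 1" by (rule val_infty_eqI) simp
  thus ?thesis unfolding calc_rep_def B_form_def by simp
qed

lemma calc_rep_exp_exists:
  assumes t: "0 < t"
  shows "\<exists>T. calc_rep (exp_neg t) T \<and> onorm T \<le> 4 / pi * C"
proof -
  let ?e = "\<lambda>z. exp (- (of_real t * z))" and ?D = "\<lambda>\<alpha>. indicator {0<..} \<alpha> * deriv_sup (exp_neg t) \<alpha>"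
  have "(\<integral>\<^sup>+ \<alpha>. ennreal (\<alpha> / (\<alpha> + 1)) * ?D \<alpha> \<partial>lborel) \<le> (\<integral>\<^sup>+ \<alpha>. ?D \<alpha> \<partial>lborel)"
  proof (rule nn_integral_mono)
    fix \<alpha> :: real
    show "ennreal (\<alpha> / (\<alpha> + 1)) * ?D \<alpha> \<le> ?D \<alpha>"
    proof (cases "\<alpha> > 0")
      case True
      have "\<alpha> / (\<alpha> + 1) \<le> 1" using True by simp
      hence "ennreal (\<alpha> / (\<alpha> + 1)) * ?D \<alpha> \<le> ennreal 1 * ?D \<alpha>" by (intro mult_right_mono ennreal_leI) auto
      thus ?thesis by simp
    qed simp
  qed
  also note nn_integral_deriv_sup_exp_neg[OF t]
  finally have W: "(\<integral>\<^sup>+ \<alpha>. ennreal (\<alpha> / (\<alpha> + 1)) * ?D \<alpha> \<partial>lborel) \<le> ennreal 1" by simp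
  have "(\<integral>\<^sup>+ \<alpha>. ?D \<alpha> \<partial>lborel) < \<infinity>"
    using nn_integral_deriv_sup_exp_neg[OF t] by (rule le_less_trans) simp
  moreover have "?e holomorphic_on rhp" by (intro holomorphic_intros)
  ultimately show ?thesis using calc_rep_exists[OF _ _ val_infty_exp_neg[OF t] W] by simp
qed

lemma exp_calculus_decay:
  assumes T: "\<And>t S. 0 \<le> t \<Longrightarrow> calc_rep (exp_neg t) S \<Longrightarrow> T t = S"
    and lim: "((\<lambda>t. onorm (T t)) \<longlongrightarrow> 0) at_top"
  shows "\<exists>M \<omega>. \<omega> > 0 \<and> (\<forall>t\<ge>0. onorm (T t) \<le> M * exp (- \<omega> * t))"
proof -
  \<comment> \<open>At t = 0 the value at infinity is 1 rather than 0, so this case is separate; it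
    is the source of the 1 in the maximum.\<close>
  have ex: "\<exists>S. calc_rep (exp_neg t) S \<and> onorm S \<le> max 1 (4 / pi * C)" if t: "0 \<le> t" for t
  proof (cases "t = 0")
    case True
    have "onorm (\<lambda>x::'a. x) \<le> 1" by (rule onorm_id_le)
    thus ?thesis using True calc_rep_one by (intro exI[of _ "\<lambda>x. x"]) auto
  next
    case False
    thus ?thesis using calc_rep_exp_exists[of t] t by (auto intro: max.coboundedI2)
  qed
  have T_rep: "calc_rep (exp_neg t) (T t)" and T_le: "onorm (T t) \<le> max 1 (4 / pi * C)"
    if "0 \<le> t" for t
    using ex[OF that] T[OF that] by auto
  have bl: "bounded_linear (T t)" if "0 \<le> t" for t using T_rep[OF that] by (simp add: calc_rep_def)
  have T0: "T 0 = (\<lambda>x. x)" using calc_rep_one by (intro T) auto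
  have semi: "T (t + s) = T t \<circ> T s" if ts: "0 \<le> t" "0 \<le> s" for t s
  proof (cases "t = 0 \<or> s = 0")
    case True
    thus ?thesis using T0 by (auto simp: fun_eq_iff)
  next
    case False
    hence "0 < t" "0 < s" using ts by auto
    thus ?thesis using calc_rep_exp_semigroup[OF _ _ T_rep T_rep T_rep, of t s] by (auto simp: fun_eq_iff)
  qed
  show ?thesis
  proof (rule exp_decay_of_submultiplicative[OF _ T_le _ lim])
    show "onorm (T (t + s)) \<le> onorm (T t) * onorm (T s)" if "0 \<le> t" "0 \<le> s" for t s
      unfolding semi[OF that] by (intro onorm_compose bl that)
  qed (use bl in \<open>auto intro: onorm_pos_le\<close>)
qed

end

lemma exp_neg_in_B0_space: "(\<lambda>z. exp (- z)) \<in> B0_space"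
proof -
  have "bounded ((\<lambda>z. exp (- z :: complex)) ` rhp)"
    by (rule boundedI[where B = 1]) (auto simp: rhp_def)
  moreover have "B0_norm (\<lambda>z. exp (- z)) \<le> 1"
    using nn_integral_deriv_sup_exp_neg[of 1] by simp
  hence "B0_norm (\<lambda>z. exp (- z)) < \<infinity>"
    by (rule le_less_trans) simp
  moreover have "val_infty (\<lambda>z. exp (- z)) = 0" using val_infty_exp_neg[of 1] by simp
  ultimately show ?thesis
    by (auto simp: B0_space_def B_space_def deriv_sup_def intro!: holomorphic_intros)
qed

section \<open>From the operator to its resolvent family\<close>

lemma res_plus_properties:
  fixes D :: "'a::complex_banach set"
  assumes lin: "lin_operator D A" and spec: "op_spectrum D A \<subseteq> {z. Re z \<ge> 0}" and z: "0 < Re z"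
  shows "res_plus D A z y \<in> D" and "cscale z (res_plus D A z y) + A (res_plus D A z y) = y"
    and "x \<in> D \<Longrightarrow> cscale z x + A x = y \<Longrightarrow> res_plus D A z y = x"
    and "bounded_linear (res_plus D A z)"
proof -
  have "- z \<in> resolvent_set D A" using spec z by (auto simp: op_spectrum_def)
  hence ex1: "\<And>y. \<exists>!x. x \<in> D \<and> cscale (- z) x - A x = y" and bl: "bounded_linear (resolvent D A (- z))"
    by (auto simp: resolvent_set_def)
  have eq: "cscale (- z) x - A x = - y \<longleftrightarrow> cscale z x + A x = y" for x y
  proof -
    have "cscale (- z) x - A x = - (cscale z x + A x)" by (simp add: cscale_minus_left)
    thus ?thesis by (simp only: neg_equal_iff_equal)
  qed
  have res: "res_plus D A z y = resolvent D A (- z) (- y)" for y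
    unfolding res_plus_def resolvent_def eq ..
  have ex1': "\<exists>!x. x \<in> D \<and> cscale z x + A x = y" for y using ex1[of "- y"] unfolding eq .
  show "res_plus D A z y \<in> D" "cscale z (res_plus D A z y) + A (res_plus D A z y) = y"
    using theI'[OF ex1'] unfolding res_plus_def by auto
  show "res_plus D A z y = x" if "x \<in> D" "cscale z x + A x = y"
    unfolding res_plus_def by (rule the1_equality[OF ex1']) (use that in auto)
  have "res_plus D A z = (\<lambda>y. resolvent D A (- z) (- y))" using res by (auto simp: fun_eq_iff)
  thus "bounded_linear (res_plus D A z)"
    using bounded_linear_compose[OF bl bounded_linear_minus[OF bounded_linear_ident]] by simp
qed

text \<open>Both algebraic laws are proved by exhibiting an element of the domain that solves the
  defining equation and invoking uniqueness.\<close>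

lemma resolvent_family_res_plus:
  fixes D :: "'a::complex_banach set"
  assumes lin: "lin_operator D A" and spec: "op_spectrum D A \<subseteq> {z. Re z \<ge> 0}"
  shows "resolvent_family (res_plus D A)"
proof (rule resolvent_family.intro)
  note R = res_plus_properties[OF lin spec]
  have D_add: "x + y \<in> D" "A (x + y) = A x + A y" if "x \<in> D" "y \<in> D" for x y
    using lin that unfolding lin_operator_def by blast+
  have D_cs: "cscale c x \<in> D" "A (cscale c x) = cscale c (A x)" if "x \<in> D" for c x
    using lin that unfolding lin_operator_def by blast+
  fix z :: complex assume z: "0 < Re z"
  show "bounded_linear (res_plus D A z)" by (rule R(4)[OF z])
  show "res_plus D A z (cscale c x) = cscale c (res_plus D A z x)" for c x
  proof (rule R(3)[OF z D_cs(1)[OF R(1)[OF z]]])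
    have "cscale z (cscale c (res_plus D A z x)) + A (cscale c (res_plus D A z x)) =
      cscale c (cscale z (res_plus D A z x) + A (res_plus D A z x))"
      by (simp add: D_cs[OF R(1)[OF z]] cscale_add_right cscale_cscale mult.commute)
    thus "cscale z (cscale c (res_plus D A z x)) + A (cscale c (res_plus D A z x)) = cscale c x"
      unfolding R(2)[OF z] .
  qed
  fix w :: complex and x assume w: "0 < Re w"
  let ?v = "res_plus D A w x" let ?u = "res_plus D A z ?v"
  have vD: "?v \<in> D" and uD: "?u \<in> D" by (rule R(1)[OF w], rule R(1)[OF z])
  have "res_plus D A z x = ?v + cscale (w - z) ?u"
  proof (rule R(3)[OF z])
    show "?v + cscale (w - z) ?u \<in> D" by (intro D_add D_cs vD uD)
    have "cscale z (?v + cscale (w - z) ?u) + A (?v + cscale (w - z) ?u)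
      = cscale z ?v + A ?v + cscale (w - z) (cscale z ?u + A ?u)"
      by (simp add: D_add D_cs vD uD cscale_add_right cscale_cscale mult.commute)
    also have "cscale z ?u + A ?u = ?v" by (rule R(2)[OF z])
    also have "cscale z ?v + A ?v + cscale (w - z) ?v = cscale w ?v + A ?v"
      by (simp add: cscale_diff_left)
    also have "\<dots> = x" by (rule R(2)[OF w])
    finally show "cscale z (?v + cscale (w - z) ?u) + A (?v + cscale (w - z) ?u) = x" .
  qed
  thus "res_plus D A z x - ?v = cscale (w - z) ?u" by simp
qed

theorem mainTheorem19:
  fixes D :: "'a::complex_banach set" and A :: "'a \<Rightarrow> 'a"
  assumes "lin_operator D A"
    and "densely_defined D"
    and "op_spectrum D A \<subseteq> {z. Re z \<ge> 0}"
    and "\<forall>x. \<forall>\<phi>\<in>dual_space.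
           (SUP \<alpha>\<in>{0<..}. ennreal (\<alpha> + 1) *
              (\<integral>\<^sup>+ \<beta>. ennreal (cmod (\<phi> (res_plus D A (Complex \<alpha> \<beta>) (res_plus D A (Complex \<alpha> \<beta>) x)))) \<partial>lborel)) < \<infinity>"
  shows "(\<forall>f\<in>B0_space. ((\<lambda>t. onorm (B_calc D A (\<lambda>z. f (of_real t * z)))) \<longlongrightarrow> 0) at_top)
       \<and> (\<exists>M \<omega>. \<omega> > 0 \<and> (\<forall>t\<ge>0. onorm (B_calc D A (\<lambda>z. exp (- (of_real t * z)))) \<le> M * exp (- \<omega> * t)))"
proof -
  interpret R: resolvent_family "res_plus D A"
    by (rule resolvent_family_res_plus[OF assms(1,3)])
  obtain C where C: "C \<ge> 0" "\<And>\<phi> x. \<phi> \<in> dual_space \<Longrightarrow> R.gsf_sup \<phi> x \<le> ennreal (C * onorm \<phi> * norm x)"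
    using R.gsf_sup_bounded assms(4) unfolding R.gsf_sup_def by blast
  interpret gsf_family "res_plus D A" C
  proof
    show "0 \<le> C" by (rule C(1))
    \<comment> \<open>An element x of the domain is the image of x + A x, so density of the domain
      passes to the range.\<close>
    have "D \<subseteq> range (res_plus D A 1)"
    proof
      fix x assume "x \<in> D"
      hence "res_plus D A 1 (cscale 1 x + A x) = x"
        by (intro res_plus_properties(3)[OF assms(1,3)]) auto
      thus "x \<in> range (res_plus D A 1)" by (metis rangeI)
    qed
    hence "closure D \<subseteq> closure (range (res_plus D A 1))" by (rule closure_mono)
    thus "closure (range (res_plus D A 1)) = UNIV"
      using assms(2) unfolding densely_defined_def by auto
    fix \<alpha> :: real and \<phi> :: "'a \<Rightarrow> complex" and x assume \<alpha>: "0 < \<alpha>" and \<phi>: "\<phi> \<in> dual_space"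
    let ?I = "\<integral>\<^sup>+ \<beta>. ennreal (cmod (\<phi> (res_plus D A (Complex \<alpha> \<beta>) (res_plus D A (Complex \<alpha> \<beta>) x)))) \<partial>lborel"
    have "ennreal (\<alpha> + 1) * ?I \<le> R.gsf_sup \<phi> x"
      unfolding R.gsf_sup_def using \<alpha> by (intro SUP_upper) auto
    also have "\<dots> \<le> ennreal (C * onorm \<phi> * norm x)" by (rule C(2)[OF \<phi>])
    finally have "ennreal (1 / (\<alpha> + 1)) * (ennreal (\<alpha> + 1) * ?I) \<le> ennreal (1 / (\<alpha> + 1)) * ennreal (C * onorm \<phi> * norm x)"
      by (intro mult_left_mono) auto
    moreover have "ennreal (1 / (\<alpha> + 1)) * (ennreal (\<alpha> + 1) * ?I) = ?I"
    proof -
      have "ennreal (1 / (\<alpha> + 1)) * ennreal (\<alpha> + 1) = ennreal (1 / (\<alpha> + 1) * (\<alpha> + 1))"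
        using \<alpha> by (intro ennreal_mult[symmetric]) auto
      also have "\<dots> = 1" using \<alpha> by simp
      finally show ?thesis by (simp only: mult.assoc[symmetric] mult_1)
    qed
    moreover have "ennreal (1 / (\<alpha> + 1)) * ennreal (C * onorm \<phi> * norm x) = ennreal (C * onorm \<phi> * norm x / (\<alpha> + 1))"
      using \<alpha> C(1) dual_onorm_nonneg[OF \<phi>] by (simp flip: ennreal_mult)
    ultimately show "?I \<le> ennreal (C * onorm \<phi> * norm x / (\<alpha> + 1))" by simp
  qed
  \<comment> \<open>Uniqueness resolves the definite description; existence is supplied where the
    norms are estimated.\<close>
  have calc: "B_calc D A f = T" if "calc_rep f T" for f T
  proof -
    have "B_calc D A f = (THE T. calc_rep f T)"
      unfolding B_calc_def calc_rep_def B_form_def ..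
    thus ?thesis using that calc_rep_unique by (simp add: the_equality)
  qed
  have 1: "((\<lambda>t. onorm (B_calc D A (\<lambda>z. f (of_real t * z)))) \<longlongrightarrow> 0) at_top" if "f \<in> B0_space" for f
    using that by (intro calc_rep_dilate_tendsto[of f] calc)
      (auto simp: B0_space_def B_space_def deriv_sup_def)
  \<comment> \<open>The exponential family consists of the dilates of exp (-z), so the first claim
    already gives norms tending to zero.\<close>
  have "((\<lambda>t. onorm (B_calc D A (\<lambda>z. exp (- (of_real t * z))))) \<longlongrightarrow> 0) at_top"
    by (rule 1[OF exp_neg_in_B0_space])
  hence "\<exists>M \<omega>. \<omega> > 0 \<and> (\<forall>t\<ge>0. onorm (B_calc D A (\<lambda>z. exp (- (of_real t * z)))) \<le> M * exp (- \<omega> * t))"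
    by (intro exp_calculus_decay calc)
  thus ?thesis using 1 by blast
qed

end
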